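(* Let $\gamma$ be the standard Gaussian measure on $\mathbb{R}^n$, let $f:\mathbb{R}^n\to\mathbb{R}$ be twice-differentiable, and suppose that $d\nu = e^f\,d\gamma$ defines a probability measure $\nu$ on $\mathbb{R}^n$. Assume that the relative entropy $\mathrm{D_{KL}}(\nu\,||\,\gamma)=\int_{\mathbb{R}^n} f\,d\nu$ and the Fisher information $\mathcal{I}(\nu)=\int_{\mathbb{R}^n}|\nabla f|^2\,d\nu$ are finite. Let $K=\{\nabla f(x): x\in\mathbb{R}^n\}$, assume that $y\mapsto \sup_{t\in K}\langle y,t\rangle$ is integrable with respect to $\gamma$, and set $\mathcal{D}(\nu)=\int_{\mathbb{R}^n}\sup_{t\in K}\langle y,t\rangle\,d\gamma(y)$. Set $M(\nu)=-\inf_{x\in\mathbb{R}^n}\Delta f(x)$ and assume that $M(\nu)$ is finite. Then there exists a probability measure $\mu$ on $\mathbb{R}^n$ such that $$\mathrm{W}_2^2(\nu,\gamma\star\mu)\;\leq\;16\,n^{1/3}\big(M(\nu)+\mathcal{D}(\nu)\big)^{2/3}.$$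
   Context: $\langle\cdot,\cdot\rangle$ and $|\cdot|$ denote the Euclidean inner product and norm on $\mathbb{R}^n$, and $\Delta$ is the usual Laplacian. The quantity $\mathcal{D}(\nu)$ is the Gaussian-width of the set $K$ of gradients of $f$. $\gamma\star\mu$ denotes the convolution of the measures $\gamma$ and $\mu$. $\mathrm{W}_2$ is the quadratic Kantorovich metric: for probability measures $\alpha,\beta$ on $\mathbb{R}^n$, $\mathrm{W}_2^2(\alpha,\beta)=\inf\int_{\mathbb{R}^n\times\mathbb{R}^n}|x-y|^2\,d\pi(x,y)$, where the infimum is over all couplings $\pi$ on $\mathbb{R}^n\times\mathbb{R}^n$ with respective marginals $\alpha$ and $\beta$. *)

theory Defs
  imports "HOL-Probability.Probability"
begin

definition std_gaussian :: "'a::euclidean_space measure" where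
  "std_gaussian =
     density lborel (\<lambda>x. ennreal (exp (- (norm x)\<^sup>2 / 2) / sqrt (2 * pi) ^ DIM('a)))"

definition grad :: "('a::euclidean_space \<Rightarrow> real) \<Rightarrow> 'a \<Rightarrow> 'a" where
  "grad f x = (THE D. GDERIV f x :> D)"

definition twice_differentiable :: "('a::euclidean_space \<Rightarrow> real) \<Rightarrow> bool" where
  "twice_differentiable f \<longleftrightarrow>
     (\<forall>x. f differentiable (at x)) \<and> (\<forall>x. grad f differentiable (at x))"

(* Sum of the unmixed second partial derivatives along the standard basis. *)
definition laplacian :: "('a::euclidean_space \<Rightarrow> real) \<Rightarrow> 'a \<Rightarrow> real" where
  "laplacian f x = (\<Sum>b\<in>Basis. (deriv ^^ 2) (\<lambda>t. f (x + t *\<^sub>R b)) 0)"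

(* The real-valued supremum is meaningful only where the set of inner products is bounded
   above, so almost-everywhere finiteness is part of the integrability condition. *)
definition support_fun :: "'a::euclidean_space set \<Rightarrow> 'a \<Rightarrow> real" where
  "support_fun K y = (SUP t\<in>K. y \<bullet> t)"

definition support_fun_integrable :: "'a::euclidean_space set \<Rightarrow> bool" where
  "support_fun_integrable K \<longleftrightarrow>
     (AE y in std_gaussian. bdd_above ((\<lambda>t. y \<bullet> t) ` K)) \<and>
     integrable std_gaussian (support_fun K)"

definition gaussian_width :: "'a::euclidean_space set \<Rightarrow> real" where
  "gaussian_width K = (LINT y|std_gaussian. support_fun K y)"

definition couplings :: "'a::euclidean_space measure \<Rightarrow> 'a measure \<Rightarrow> ('a \<times> 'a) measure set" where
  "couplings \<alpha> \<beta> =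
     {\<pi>. prob_space \<pi> \<and> sets \<pi> = sets borel \<and>
         distr \<pi> borel fst = \<alpha> \<and> distr \<pi> borel snd = \<beta>}"

(* The square of the quadratic Kantorovich distance, with value \<infinity> allowed. *)
definition W2_squared :: "'a::euclidean_space measure \<Rightarrow> 'a measure \<Rightarrow> ennreal" where
  "W2_squared \<alpha> \<beta> =
     (INF \<pi>\<in>couplings \<alpha> \<beta>. \<integral>\<^sup>+(x, y). ennreal ((norm (x - y))\<^sup>2) \<partial>\<pi>)"

end

theory Submission
  imports Defs
begin

text \<open>Integrability of the support function makes $K$ bounded, so $f$ is Lipschitz. Let $X$ be the
  Foellmer process of $\nu$: it has law $g_t\,dN(0,t)$ with $g_t=P_{1-t}e^f$, its drift
  $v_t=\nabla\log g_t$ is a martingale with $v_1=\nabla f$, and $m(t)=E|v_t(X_t)|^2$ is nondecreasing.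
  Given $X_t$, the end point $X_1$ is $X_t+(1-t)v_t(X_t)$ plus an independent Gaussian of variance $1-t$ plus the
  fluctuation of the drift, so for $\mu$ the law of $X_t+(1-t)v_t(X_t)$ the squared distance is at most
  $2(1-t)^2(m(1)-m(t))+2n(1-\sqrt{1-t})^2$.

  Gaussian integration by parts gives $m(1)\leq M+E\langle\nabla f(X_1),X_1\rangle$. Writing $X_1$ as noise plus
  drift, the noise contributes at most the Gaussian width $D$ and the drift $\int_0^1 m$, whence
  $t(m(1)-m(t))\leq M+D$. Take $t=((M+D)/n)^{1/3}$.

  No stochastic calculus is needed: the process is replaced by its Euler chain with explicit
  Gaussian increments, whose likelihood ratio against the true law tends to $1$ in $L^2$ as the
  step tends to $0$.\<close>

section \<open>Gaussian integrals\<close>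


text \<open>Twice differentiability gives a second derivative at every point, but neither its
  continuity nor its integrability, so the Laplacian cannot be integrated by parts directly. Its
  lower bound is first turned into a lower bound for heat averages of \<open>f\<close> by a maximum
  principle; after that only first difference quotients are passed to the limit.

  The chain lives under two measures. Unweighted, its accumulated noise is exactly Gaussian and
  independent of the start, but its end point has the wrong law. Weighted by the likelihood ratio,
  the laws and the martingale identities are exact at every step size, but the noise is no longer
  Gaussian. Width and transport cost need both sides at once, and the price of switching is the L^2
  distance of the ratio from 1. One-step errors of order \<open>h\<close> do not sum to something
  small; a second-order estimate is needed, and it degenerates at time 1, where no smoothing is
  left.

  The time \<open>t\<close> equalises \<open>(M + D) / t\<close> and \<open>n t^2\<close>. If
  \<open>M + D >= n\<close> no such \<open>t < 1\<close> exists, and \<open>\<mu> = \<nu>\<close> is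
  good enough.\<close>

lemma sets_std_gaussian [simp, measurable_cong]: "sets std_gaussian = sets borel"
  by (simp add: std_gaussian_def)

lemma space_std_gaussian [simp]: "space std_gaussian = UNIV"
  by (simp add: std_gaussian_def)

lemma nn_integral_std_gaussian:
  fixes F :: "'a::euclidean_space \<Rightarrow> ennreal"
  assumes [measurable]: "F \<in> borel_measurable borel"
  shows "(\<integral>\<^sup>+x. F x \<partial>std_gaussian) =
    (\<integral>\<^sup>+x. ennreal (exp (- (norm x)\<^sup>2 / 2) / sqrt (2 * pi) ^ DIM('a)) * F x \<partial>lborel)"
  unfolding std_gaussian_def by (rule nn_integral_density) auto

lemma nn_integral_lborel_translate:
  fixes F :: "'a::euclidean_space \<Rightarrow> ennreal"
  assumes [measurable]: "F \<in> borel_measurable borel"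
  shows "(\<integral>\<^sup>+x. F (x + a) \<partial>lborel) = (\<integral>\<^sup>+x. F x \<partial>lborel)"
  by (subst (2) lborel_distr_plus[of a, symmetric], subst nn_integral_distr) (auto simp: add.commute)

lemma nn_integral_lborel_scale:
  fixes F :: "'a::euclidean_space \<Rightarrow> ennreal"
  assumes [measurable]: "F \<in> borel_measurable borel" and c: "c \<noteq> 0"
  shows "(\<integral>\<^sup>+x. F x \<partial>lborel) = ennreal (\<bar>c\<bar> ^ DIM('a)) * (\<integral>\<^sup>+x. F (c *\<^sub>R x) \<partial>lborel)"
  by (subst lborel_affine[OF c, of 0])
     (simp add: nn_integral_density nn_integral_distr nn_integral_cmult)

lemma prod_Basis_std_normal_density:
  fixes x :: "'a::euclidean_space"
  shows "(\<Prod>b\<in>Basis. std_normal_density (x \<bullet> b)) = exp (- (norm x)\<^sup>2 / 2) / sqrt (2 * pi) ^ DIM('a)"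
proof -
  have "(norm x)\<^sup>2 = (\<Sum>b\<in>Basis. (x \<bullet> b)\<^sup>2)"
    unfolding power2_norm_eq_inner by (subst euclidean_inner) (simp add: power2_eq_square)
  then have "exp (- (norm x)\<^sup>2 / 2) = (\<Prod>b\<in>Basis. exp (- (x \<bullet> b)\<^sup>2 / 2))"
    by (simp add: exp_sum[symmetric] sum_negf sum_divide_distrib)
  then show ?thesis
    by (simp add: std_normal_density_def prod_dividef)
qed

lemma emeasure_std_gaussian_UNIV: "emeasure (std_gaussian :: 'a::euclidean_space measure) UNIV = 1"
proof -
  have "emeasure (std_gaussian :: 'a measure) UNIV = (\<integral>\<^sup>+x. 1 \<partial>(std_gaussian :: 'a measure))"
    by simp
  also have "\<dots> = (\<integral>\<^sup>+x. (\<Prod>b\<in>Basis. ennreal (std_normal_density ((x::'a) \<bullet> b))) \<partial>lborel)"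
    by (subst nn_integral_std_gaussian) (simp_all add: prod_ennreal prod_Basis_std_normal_density)
  also have "\<dots> = (\<Prod>b\<in>(Basis :: 'a set). (\<integral>\<^sup>+x. ennreal (std_normal_density x) \<partial>lborel))"
    by (rule nn_integral_lborel_prod) auto
  also have "(\<integral>\<^sup>+x. ennreal (std_normal_density x) \<partial>lborel) = 1"
    by (subst nn_integral_eq_integral) auto
  finally show ?thesis by simp
qed

interpretation std_gaussian: prob_space "std_gaussian :: 'a::euclidean_space measure"
  by standard (simp add: emeasure_std_gaussian_UNIV)

lemma AE_std_gaussian_iff:
  fixes P :: "'a::euclidean_space \<Rightarrow> bool"
  shows "(AE x in std_gaussian. P x) \<longleftrightarrow> (AE x in lborel. P x)"
  unfolding std_gaussian_def by (subst AE_density) auto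

text \<open>Completing the square moves the translation from the argument of \<open>F\<close> into
  the Gaussian weight, and Lebesgue measure absorbs the rest. Every change of drift below reduces to
  this formula.\<close>

lemma nn_integral_std_gaussian_shift:
  fixes F :: "'a::euclidean_space \<Rightarrow> ennreal"
  assumes [measurable]: "F \<in> borel_measurable borel"
  shows "(\<integral>\<^sup>+x. F (x + a) \<partial>std_gaussian) = (\<integral>\<^sup>+x. ennreal (exp (a \<bullet> x - (norm a)\<^sup>2 / 2)) * F x \<partial>std_gaussian)"
proof -
  have e: "exp (- (norm x)\<^sup>2 / 2) = exp (a \<bullet> (x + a) - (norm a)\<^sup>2 / 2) * exp (- (norm (x + a))\<^sup>2 / 2)" for x
  proof -
    have "- (norm x)\<^sup>2 / 2 = (a \<bullet> (x + a) - (norm a)\<^sup>2 / 2) + (- (norm (x + a))\<^sup>2 / 2)"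
      unfolding power2_norm_eq_inner by (simp add: inner_add_left inner_add_right inner_commute[of x a] diff_divide_distrib)
    then show ?thesis by (simp only: exp_add[symmetric])
  qed
  have "(\<integral>\<^sup>+x. F (x + a) \<partial>std_gaussian) =
     (\<integral>\<^sup>+x. (\<lambda>y. ennreal (exp (- (norm y)\<^sup>2 / 2) / sqrt (2 * pi) ^ DIM('a)) *
        (ennreal (exp (a \<bullet> y - (norm a)\<^sup>2 / 2)) * F y)) (x + a) \<partial>lborel)"
    by (subst nn_integral_std_gaussian, measurable, intro nn_integral_cong, subst e)
       (simp add: ennreal_mult'[symmetric] mult.assoc[symmetric] mult.commute[of "exp (a \<bullet> _ - _)"])
  also have "\<dots> = (\<integral>\<^sup>+x. ennreal (exp (a \<bullet> x - (norm a)\<^sup>2 / 2)) * F x \<partial>std_gaussian)"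
    by (subst nn_integral_lborel_translate, measurable, subst nn_integral_std_gaussian) auto
  finally show ?thesis .
qed

text \<open>The factor $e^{\langle a,x\rangle-|a|^2/2}$ is the Cameron--Martin density of the translate.\<close>

lemma distr_std_gaussian_shift:
  fixes a :: "'a::euclidean_space"
  shows "distr std_gaussian borel (\<lambda>x. x + a) = density std_gaussian (\<lambda>x. ennreal (exp (a \<bullet> x - (norm a)\<^sup>2 / 2)))"
proof (rule measure_eqI)
  fix A assume "A \<in> sets (distr std_gaussian borel (\<lambda>x::'a. x + a))"
  then have A [measurable]: "A \<in> sets borel" by simp
  show "emeasure (distr std_gaussian borel (\<lambda>x. x + a)) A =
      emeasure (density std_gaussian (\<lambda>x. ennreal (exp (a \<bullet> x - (norm a)\<^sup>2 / 2)))) A"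
    using nn_integral_std_gaussian_shift[of "indicator A" a]
    by (subst emeasure_density) (simp_all add: nn_integral_indicator[symmetric] nn_integral_distr del: nn_integral_indicator)
qed simp

lemma
  fixes F :: "'a::euclidean_space \<Rightarrow> 'b::{banach, second_countable_topology}"
  assumes [measurable]: "F \<in> borel_measurable borel"
  shows integral_std_gaussian_shift:
      "(\<integral>x. F (x + a) \<partial>std_gaussian) = (\<integral>x. exp (a \<bullet> x - (norm a)\<^sup>2 / 2) *\<^sub>R F x \<partial>std_gaussian)"
    and integrable_std_gaussian_shift:
      "integrable std_gaussian (\<lambda>x. F (x + a)) \<longleftrightarrow> integrable std_gaussian (\<lambda>x. exp (a \<bullet> x - (norm a)\<^sup>2 / 2) *\<^sub>R F x)"
proof -
  have "(\<integral>x. F (x + a) \<partial>std_gaussian) = (\<integral>x. F x \<partial>distr std_gaussian borel (\<lambda>x. x + a))"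
    by (simp add: integral_distr)
  then show "(\<integral>x. F (x + a) \<partial>std_gaussian) = (\<integral>x. exp (a \<bullet> x - (norm a)\<^sup>2 / 2) *\<^sub>R F x \<partial>std_gaussian)"
    unfolding distr_std_gaussian_shift by (simp add: integral_density)
  have "integrable std_gaussian (\<lambda>x. F (x + a)) \<longleftrightarrow> integrable (distr std_gaussian borel (\<lambda>x. x + a)) F"
    by (simp add: integrable_distr_eq)
  then show "integrable std_gaussian (\<lambda>x. F (x + a)) \<longleftrightarrow> integrable std_gaussian (\<lambda>x. exp (a \<bullet> x - (norm a)\<^sup>2 / 2) *\<^sub>R F x)"
    unfolding distr_std_gaussian_shift by (simp add: integrable_density)
qed

lemma distr_std_gaussian_uminus:
  "distr std_gaussian borel (\<lambda>x::'a::euclidean_space. - x) = std_gaussian"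
proof (rule measure_eqI)
  fix A assume "A \<in> sets (distr std_gaussian borel (\<lambda>x::'a. - x))"
  then have A [measurable]: "A \<in> sets borel" by simp
  have "emeasure (distr std_gaussian borel (\<lambda>x. - x)) A = (\<integral>\<^sup>+x. indicator A (- x) \<partial>std_gaussian)"
    by (simp add: nn_integral_indicator[symmetric] nn_integral_distr del: nn_integral_indicator)
  also have "\<dots> = (\<integral>\<^sup>+x. ennreal (exp (- (norm x)\<^sup>2 / 2) / sqrt (2 * pi) ^ DIM('a)) * indicator A x \<partial>lborel)"
    by (subst nn_integral_std_gaussian, measurable, subst (2) nn_integral_lborel_scale[of _ "-1"]) auto
  also have "\<dots> = emeasure std_gaussian A"
    by (subst nn_integral_std_gaussian[symmetric]) auto
  finally show "emeasure (distr std_gaussian borel (\<lambda>x. - x)) A = emeasure std_gaussian A" .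
qed simp

lemma integral_std_gaussian_uminus:
  fixes F :: "'a::euclidean_space \<Rightarrow> 'b::{banach, second_countable_topology}"
  assumes [measurable]: "F \<in> borel_measurable borel"
  shows "(\<integral>x. F (- x) \<partial>std_gaussian) = (\<integral>x. F x \<partial>std_gaussian)"
  by (subst (2) distr_std_gaussian_uminus[symmetric]) (simp add: integral_distr)

text \<open>After normalising, substitute \<open>w = \<alpha> x + \<beta> y\<close> for
  \<open>y\<close>. In the pair \<open>(x, w)\<close> the joint density is that of \<open>w\<close>
  times a Gaussian density in \<open>x\<close> centred at \<open>\<alpha> w\<close>, and the second
  factor integrates to 1. All semigroup and Markov identities rest on this.\<close>

lemma nn_integral_std_gaussian_add:
  fixes F :: "'a::euclidean_space \<Rightarrow> ennreal"
  assumes [measurable]: "F \<in> borel_measurable borel" and "a \<ge> 0" "b \<ge> 0"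
  shows "(\<integral>\<^sup>+x. \<integral>\<^sup>+y. F (sqrt a *\<^sub>R x + sqrt b *\<^sub>R y) \<partial>std_gaussian \<partial>std_gaussian) =
     (\<integral>\<^sup>+x. F (sqrt (a + b) *\<^sub>R x) \<partial>std_gaussian)"
\<comment> \<open>The substitution divides by \<open>\<beta>\<close>, so degenerate variances are
  treated apart.\<close>
proof (cases "a = 0 \<or> b = 0")
  case True
  then show ?thesis by (auto simp: emeasure_std_gaussian_UNIV)
next
  case False
  then have ab: "a > 0" "b > 0" using assms by auto
  define d where "d = (\<lambda>x::'a. ennreal (exp (- (norm x)\<^sup>2 / 2) / sqrt (2 * pi) ^ DIM('a)))"
  have [measurable]: "d \<in> borel_measurable borel" unfolding d_def by measurable
  define s where "s = sqrt (a + b)"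
  have s: "s > 0" "s * s = a + b" using ab by (auto simp: s_def)
  define \<alpha> \<beta> where "\<alpha> = sqrt a / s" and "\<beta> = sqrt b / s"
  have \<alpha>\<beta>: "\<alpha>\<^sup>2 + \<beta>\<^sup>2 = 1" "\<alpha> > 0" "\<beta> > 0"
    using ab s by (auto simp: \<alpha>_def \<beta>_def power_divide power2_eq_square add_divide_distrib[symmetric])
  have G: "(\<integral>\<^sup>+x. H x \<partial>std_gaussian) = (\<integral>\<^sup>+x. d x * H x \<partial>lborel)" if "H \<in> borel_measurable borel" for H
    unfolding d_def using that by (rule nn_integral_std_gaussian)
  have "(\<integral>\<^sup>+x. \<integral>\<^sup>+y. F (sqrt a *\<^sub>R x + sqrt b *\<^sub>R y) \<partial>std_gaussian \<partial>std_gaussian)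
      = (\<integral>\<^sup>+x. \<integral>\<^sup>+y. d x * d y * F (sqrt a *\<^sub>R x + sqrt b *\<^sub>R y) \<partial>lborel \<partial>lborel)"
    by (simp add: G nn_integral_cmult[symmetric] mult_ac)
  also have "\<dots> = (\<integral>\<^sup>+x. \<integral>\<^sup>+w. ennreal (1 / \<beta> ^ DIM('a)) * (d x * d ((w - \<alpha> *\<^sub>R x) /\<^sub>R \<beta>) * F (s *\<^sub>R w)) \<partial>lborel \<partial>lborel)"
  proof (rule nn_integral_cong)
    fix x :: 'a
    let ?H = "\<lambda>w. ennreal (1 / \<beta> ^ DIM('a)) * (d x * d ((w - \<alpha> *\<^sub>R x) /\<^sub>R \<beta>) * F (s *\<^sub>R w))"
    have e: "s *\<^sub>R (\<alpha> *\<^sub>R x + \<beta> *\<^sub>R y) = sqrt a *\<^sub>R x + sqrt b *\<^sub>R y" for y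
      using s by (simp add: \<alpha>_def \<beta>_def scaleR_add_right)
    have "(\<integral>\<^sup>+w. ?H w \<partial>lborel) = (\<integral>\<^sup>+w. ?H (w + \<alpha> *\<^sub>R x) \<partial>lborel)"
      by (subst nn_integral_lborel_translate) auto
    also have "\<dots> = ennreal (\<bar>\<beta>\<bar> ^ DIM('a)) * (\<integral>\<^sup>+y. ?H (\<beta> *\<^sub>R y + \<alpha> *\<^sub>R x) \<partial>lborel)"
      using \<alpha>\<beta> by (subst nn_integral_lborel_scale[of _ \<beta>]) auto
    also have "\<dots> = (\<integral>\<^sup>+y. d x * d y * F (sqrt a *\<^sub>R x + sqrt b *\<^sub>R y) \<partial>lborel)"
      using \<alpha>\<beta> e by (subst nn_integral_cmult[symmetric], measurable, intro nn_integral_cong)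
        (simp add: mult.assoc[symmetric] ennreal_mult[symmetric] add.commute)
    finally show "(\<integral>\<^sup>+y. d x * d y * F (sqrt a *\<^sub>R x + sqrt b *\<^sub>R y) \<partial>lborel) = (\<integral>\<^sup>+w. ?H w \<partial>lborel)" ..
  qed
  also have "\<dots> = (\<integral>\<^sup>+w. \<integral>\<^sup>+x. ennreal (1 / \<beta> ^ DIM('a)) * (d x * d ((w - \<alpha> *\<^sub>R x) /\<^sub>R \<beta>) * F (s *\<^sub>R w)) \<partial>lborel \<partial>lborel)"
    by (rule lborel_pair.Fubini') measurable
  also have "\<dots> = (\<integral>\<^sup>+w. d w * F (s *\<^sub>R w) \<partial>lborel)"
  proof (rule nn_integral_cong)
    fix w :: 'a
    \<comment> \<open>Because \<open>\<alpha>\<^sup>2 + \<beta>\<^sup>2 = 1\<close>, the quadratic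
      form in \<open>(x, w)\<close> is symmetric in its two arguments, so the roles of
      \<open>x\<close> and \<open>w\<close> can be exchanged.\<close>
    have dd: "d x * d ((w - \<alpha> *\<^sub>R x) /\<^sub>R \<beta>) = d w * d ((x - \<alpha> *\<^sub>R w) /\<^sub>R \<beta>)" for x
    proof -
      have n: "(norm x)\<^sup>2 + (norm ((w - \<alpha> *\<^sub>R x) /\<^sub>R \<beta>))\<^sup>2 = (norm w)\<^sup>2 + (norm ((x - \<alpha> *\<^sub>R w) /\<^sub>R \<beta>))\<^sup>2"
      proof -
        have b2: "\<beta>\<^sup>2 \<noteq> 0" using \<alpha>\<beta> by auto
        have "\<beta>\<^sup>2 * (norm x)\<^sup>2 + (norm (w - \<alpha> *\<^sub>R x))\<^sup>2 = \<beta>\<^sup>2 * (norm w)\<^sup>2 + (norm (x - \<alpha> *\<^sub>R w))\<^sup>2"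
        proof -
          have *: "\<beta>\<^sup>2 = 1 - \<alpha>\<^sup>2" using \<alpha>\<beta> by simp
          show ?thesis unfolding * power2_norm_eq_inner
            by (simp add: inner_diff algebra_simps inner_commute power2_eq_square)
        qed
        moreover have "(norm (v /\<^sub>R \<beta>))\<^sup>2 = (norm v)\<^sup>2 / \<beta>\<^sup>2" for v :: 'a
          by (simp add: power_mult_distrib power_inverse field_simps)
        ultimately show ?thesis using b2 by (simp only:) (simp add: field_simps)
      qed
      have ed: "d u * d v = ennreal (exp (- ((norm u)\<^sup>2 + (norm v)\<^sup>2) / 2) / sqrt (2 * pi) ^ DIM('a) / sqrt (2 * pi) ^ DIM('a))" for u v
        unfolding d_def by (subst ennreal_mult[symmetric]) (auto simp: exp_add[symmetric] add_divide_distrib)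
      show ?thesis unfolding ed n ..
    qed
    have 1: "ennreal (1 / \<beta> ^ DIM('a)) * (\<integral>\<^sup>+x. d ((x - \<alpha> *\<^sub>R w) /\<^sub>R \<beta>) \<partial>lborel) = 1"
    proof -
      have "(\<integral>\<^sup>+x. d ((x - \<alpha> *\<^sub>R w) /\<^sub>R \<beta>) \<partial>lborel) = (\<integral>\<^sup>+x. d (((x + \<alpha> *\<^sub>R w) - \<alpha> *\<^sub>R w) /\<^sub>R \<beta>) \<partial>lborel)"
        by (subst nn_integral_lborel_translate[where F="\<lambda>x. d ((x - \<alpha> *\<^sub>R w) /\<^sub>R \<beta>)"]) auto
      also have "\<dots> = ennreal (\<bar>\<beta>\<bar> ^ DIM('a)) * (\<integral>\<^sup>+x. d x \<partial>lborel)"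
        using \<alpha>\<beta> by (subst nn_integral_lborel_scale[of _ \<beta>]) auto
      also have "(\<integral>\<^sup>+x. d x \<partial>lborel) = 1"
        using G[of "\<lambda>_. 1"] by (simp add: emeasure_std_gaussian_UNIV)
      finally show ?thesis using \<alpha>\<beta> by (simp add: ennreal_mult[symmetric])
    qed
    have "(\<integral>\<^sup>+x. ennreal (1 / \<beta> ^ DIM('a)) * (d x * d ((w - \<alpha> *\<^sub>R x) /\<^sub>R \<beta>) * F (s *\<^sub>R w)) \<partial>lborel) =
        (\<integral>\<^sup>+x. (d w * F (s *\<^sub>R w) * ennreal (1 / \<beta> ^ DIM('a))) * d ((x - \<alpha> *\<^sub>R w) /\<^sub>R \<beta>) \<partial>lborel)"
      unfolding dd by (simp add: mult_ac)
    also have "\<dots> = d w * F (s *\<^sub>R w)"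
      by (subst nn_integral_cmult, measurable) (simp add: mult.assoc 1)
    finally show "(\<integral>\<^sup>+x. ennreal (1 / \<beta> ^ DIM('a)) * (d x * d ((w - \<alpha> *\<^sub>R x) /\<^sub>R \<beta>) * F (s *\<^sub>R w)) \<partial>lborel) = d w * F (s *\<^sub>R w)" .
  qed
  also have "\<dots> = (\<integral>\<^sup>+x. F (sqrt (a + b) *\<^sub>R x) \<partial>std_gaussian)"
    by (simp add: G s_def)
  finally show ?thesis .
qed

text \<open>The weight cancels half of the Gaussian exponent; what remains is the density taken at
  \<open>z / sqrt 2\<close>, which still has finite mass.\<close>

lemma nn_integral_std_gaussian_exp_sq:
  "(\<integral>\<^sup>+z. ennreal (exp ((norm (z :: 'a::euclidean_space))\<^sup>2 / 4)) \<partial>std_gaussian) < \<infinity>"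
proof -
  define d where "d = (\<lambda>x::'a. ennreal (exp (- (norm x)\<^sup>2 / 2) / sqrt (2 * pi) ^ DIM('a)))"
  have [measurable]: "d \<in> borel_measurable borel" unfolding d_def by measurable
  have d1: "(\<integral>\<^sup>+x. d x \<partial>lborel) = 1"
    using nn_integral_std_gaussian[of "\<lambda>_::'a. 1"] by (simp add: emeasure_std_gaussian_UNIV d_def)
  have "d x * ennreal (exp ((norm x)\<^sup>2 / 4)) = d ((1 / sqrt 2) *\<^sub>R x)" for x
    unfolding d_def
    by (subst ennreal_mult[symmetric]) (auto simp: power_mult_distrib power_divide exp_add[symmetric] mult.commute)
  then have "(\<integral>\<^sup>+z. ennreal (exp ((norm (z :: 'a))\<^sup>2 / 4)) \<partial>std_gaussian) = (\<integral>\<^sup>+z. d ((1 / sqrt 2) *\<^sub>R z) \<partial>lborel)"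
    by (subst nn_integral_std_gaussian) (auto simp: d_def)
  also have "\<dots> = ennreal (\<bar>sqrt 2\<bar> ^ DIM('a)) * (\<integral>\<^sup>+z. d z \<partial>lborel)"
    by (subst nn_integral_lborel_scale[of _ "sqrt 2"]) auto
  also have "\<dots> < \<infinity>" by (simp add: d1)
  finally show ?thesis .
qed

lemma exp_bound_sq: "exp (B * (r::real) + r\<^sup>2 / 8) \<le> exp (2 * B\<^sup>2) * exp (r\<^sup>2 / 4)"
proof -
  have "0 \<le> 2 * (B - r / 4)\<^sup>2" by simp
  then have "B * r + r\<^sup>2 / 8 \<le> 2 * B\<^sup>2 + r\<^sup>2 / 4"
    by (simp add: power2_eq_square algebra_simps)
  then show ?thesis by (simp add: exp_add[symmetric])
qed

text \<open>The allowance \<open>(norm z)\<^sup>2 / 8\<close> is meant for Cameron-Martin factors in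
  two Gaussian variables, whose cross term \<open>x \<bullet> z\<close> is controlled only by
  squares. \<open>exp_bound_sq\<close> trades the linear exponent for a constant and ends at
  \<open>(norm z)\<^sup>2 / 4\<close>, still below the Gaussian \<open>1/2\<close>.\<close>

lemma integrable_std_gaussian_exp_bound:
  fixes F :: "'a::euclidean_space \<Rightarrow> 'b::{banach, second_countable_topology}"
  assumes [measurable]: "F \<in> borel_measurable borel"
    and F: "\<And>z. norm (F z) \<le> C * exp (B * norm z + (norm z)\<^sup>2 / 8)"
  shows "integrable std_gaussian F"
proof (rule Bochner_Integration.integrable_bound)
  show "integrable std_gaussian (\<lambda>z::'a. C * exp (2 * B\<^sup>2) * exp ((norm z)\<^sup>2 / 4))"
    using nn_integral_std_gaussian_exp_sq by (intro integrable_mult_right integrableI_bounded) auto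
  have "0 \<le> C" using order_trans[OF norm_ge_zero F[of 0]] by (auto simp: zero_le_mult_iff)
  then show "AE z in std_gaussian. norm (F z) \<le> norm (C * exp (2 * B\<^sup>2) * exp ((norm (z::'a))\<^sup>2 / 4))"
    using exp_bound_sq[of B] by (intro AE_I2 order_trans[OF F]) (auto simp: abs_mult mult.assoc intro!: mult_left_mono)
qed simp

lemma integrable_std_gaussian_exp_bound':
  fixes F :: "'a::euclidean_space \<Rightarrow> 'b::{banach, second_countable_topology}"
  assumes [measurable]: "F \<in> borel_measurable borel" and F: "\<And>z. norm (F z) \<le> C * exp (B * norm z)"
  shows "integrable std_gaussian F"
proof (rule integrable_std_gaussian_exp_bound)
  fix z :: 'a
  have "0 \<le> C" using order_trans[OF norm_ge_zero F[of 0]] by (auto simp: zero_le_mult_iff)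
  then have "C * exp (B * norm z) \<le> C * exp (B * norm z + (norm z)\<^sup>2 / 8)" by (intro mult_left_mono) auto
  then show "norm (F z) \<le> C * exp (B * norm z + (norm z)\<^sup>2 / 8)" using F[of z] by linarith
qed simp

lemma integrable_std_gaussian_pair_exp_bound:
  fixes F :: "'a::euclidean_space \<times> 'a \<Rightarrow> 'b::{banach, second_countable_topology}"
  assumes [measurable]: "F \<in> borel_measurable (borel \<Otimes>\<^sub>M borel)"
    and F: "\<And>x z. norm (F (x, z)) \<le> C * (exp (B * norm x + (norm x)\<^sup>2 / 8) * exp (B * norm z + (norm z)\<^sup>2 / 8))"
  shows "integrable (std_gaussian \<Otimes>\<^sub>M std_gaussian) F"
proof (rule Bochner_Integration.integrable_bound)
  let ?e = "\<lambda>z::'a. exp (B * norm z + (norm z)\<^sup>2 / 8)"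
  interpret P: pair_sigma_finite "std_gaussian :: 'a measure" "std_gaussian :: 'a measure" ..
  have i: "integrable std_gaussian ?e"
    by (rule integrable_std_gaussian_exp_bound[of _ 1 B]) auto
  have "integrable (std_gaussian \<Otimes>\<^sub>M std_gaussian) (\<lambda>p. ?e (fst p) * ?e (snd p))"
    using i by (intro P.Fubini_integrable) (auto simp: abs_mult)
  then show "integrable (std_gaussian \<Otimes>\<^sub>M std_gaussian) (\<lambda>p. C * (?e (fst p) * ?e (snd p)))"
    by simp
  have C: "0 \<le> C" using order_trans[OF norm_ge_zero F[of 0 0]] by (auto simp: zero_le_mult_iff)
  have "norm (F p) \<le> norm (C * (?e (fst p) * ?e (snd p)))" for p
    using F[of "fst p" "snd p"] C by (simp add: abs_mult)
  then show "AE p in std_gaussian \<Otimes>\<^sub>M std_gaussian. norm (F p) \<le> norm (C * (?e (fst p) * ?e (snd p)))" by simp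
  show "F \<in> borel_measurable (std_gaussian \<Otimes>\<^sub>M std_gaussian)" by measurable
qed

lemma distr_std_gaussian_add:
  assumes "a \<ge> 0" "b \<ge> 0"
  shows "distr (std_gaussian \<Otimes>\<^sub>M std_gaussian) borel (\<lambda>(x, y). sqrt a *\<^sub>R x + sqrt b *\<^sub>R y) =
    distr std_gaussian borel (\<lambda>x::'a::euclidean_space. sqrt (a + b) *\<^sub>R x)"
proof (rule measure_eqI)
  fix A assume "A \<in> sets (distr (std_gaussian \<Otimes>\<^sub>M std_gaussian) borel (\<lambda>(x::'a, y). sqrt a *\<^sub>R x + sqrt b *\<^sub>R y))"
  then have A [measurable]: "A \<in> sets borel" by simp
  show "emeasure (distr (std_gaussian \<Otimes>\<^sub>M std_gaussian) borel (\<lambda>(x::'a, y). sqrt a *\<^sub>R x + sqrt b *\<^sub>R y)) A =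
      emeasure (distr std_gaussian borel (\<lambda>x::'a. sqrt (a + b) *\<^sub>R x)) A"
    using nn_integral_std_gaussian_add[OF _ assms, of "indicator A"]
    by (simp add: nn_integral_indicator[symmetric] nn_integral_distr std_gaussian.nn_integral_fst[symmetric] del: nn_integral_indicator)
qed simp

lemma
  fixes F :: "'a::euclidean_space \<Rightarrow> 'b::{banach, second_countable_topology}"
  assumes [measurable]: "F \<in> borel_measurable borel" and ab: "a \<ge> 0" "b \<ge> 0"
    and I: "integrable std_gaussian (\<lambda>x. F (sqrt (a + b) *\<^sub>R x))"
  shows integral_std_gaussian_add:
      "(\<integral>x. \<integral>y. F (sqrt a *\<^sub>R x + sqrt b *\<^sub>R y) \<partial>std_gaussian \<partial>std_gaussian) = (\<integral>x. F (sqrt (a + b) *\<^sub>R x) \<partial>std_gaussian)"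
    and integrable_std_gaussian_add:
      "integrable std_gaussian (\<lambda>x. \<integral>y. F (sqrt a *\<^sub>R x + sqrt b *\<^sub>R y) \<partial>std_gaussian)"
proof -
  interpret P: pair_sigma_finite "std_gaussian :: 'a measure" "std_gaussian :: 'a measure" ..
  have "integrable (distr std_gaussian borel (\<lambda>x::'a. sqrt (a + b) *\<^sub>R x)) F"
    using I by (subst integrable_distr_eq) auto
  then have i: "integrable (std_gaussian \<Otimes>\<^sub>M std_gaussian) (\<lambda>(x, y). F (sqrt a *\<^sub>R x + sqrt b *\<^sub>R y))"
    unfolding distr_std_gaussian_add[OF ab, symmetric]
    by (subst (asm) integrable_distr_eq) (auto simp: case_prod_beta')
  have "(\<integral>x. F (sqrt (a + b) *\<^sub>R x) \<partial>std_gaussian) = (\<integral>p. F p \<partial>distr std_gaussian borel (\<lambda>x::'a. sqrt (a + b) *\<^sub>R x))"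
    by (simp add: integral_distr)
  also have "\<dots> = (\<integral>p. (case p of (x, y) \<Rightarrow> F (sqrt a *\<^sub>R x + sqrt b *\<^sub>R y)) \<partial>(std_gaussian \<Otimes>\<^sub>M std_gaussian))"
    unfolding distr_std_gaussian_add[OF ab, symmetric]
    by (subst integral_distr) (auto simp: case_prod_beta')
  also have "\<dots> = (\<integral>x. \<integral>y. F (sqrt a *\<^sub>R x + sqrt b *\<^sub>R y) \<partial>std_gaussian \<partial>std_gaussian)"
    by (subst P.integral_fst'[OF i, symmetric]) simp
  finally show "(\<integral>x. \<integral>y. F (sqrt a *\<^sub>R x + sqrt b *\<^sub>R y) \<partial>std_gaussian \<partial>std_gaussian) = (\<integral>x. F (sqrt (a + b) *\<^sub>R x) \<partial>std_gaussian)" ..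
  show "integrable std_gaussian (\<lambda>x. \<integral>y. F (sqrt a *\<^sub>R x + sqrt b *\<^sub>R y) \<partial>std_gaussian)"
    using P.integrable_fst'[OF i] by simp
qed

section \<open>Stein's identity and Gaussian moments\<close>

lemma abs_exp_minus_1_le: "\<bar>exp (w::real) - 1\<bar> \<le> \<bar>w\<bar> * exp \<bar>w\<bar>"
proof (cases "w \<ge> 0")
  case True
  have "1 - w \<le> exp (- w)" using exp_ge_add_one_self[of "- w"] by simp
  then have "exp w * (1 - w) \<le> exp w * exp (- w)" by (rule mult_left_mono) simp
  then show ?thesis using True by (simp add: exp_minus algebra_simps)
next
  case False
  have "1 + w \<le> exp w" "exp w \<le> 1" using False by (auto simp: exp_ge_add_one_self)
  then have "\<bar>exp w - 1\<bar> \<le> \<bar>w\<bar> * 1" using False by linarith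
  also have "\<dots> \<le> \<bar>w\<bar> * exp \<bar>w\<bar>" by (intro mult_left_mono) auto
  finally show ?thesis .
qed

lemma tendsto_inverse_Suc: "(\<lambda>k. 1 / real (Suc k)) \<longlonglongrightarrow> 0"
  using LIMSEQ_inverse_real_of_nat by (simp add: inverse_eq_divide)

text \<open>Differentiate the Cameron--Martin formula for the translates $z + su$ at $s = 0$.\<close>

lemma std_gaussian_stein:
  fixes \<psi> \<psi>' :: "'a::euclidean_space \<Rightarrow> real" and u :: 'a
  assumes [measurable]: "\<psi> \<in> borel_measurable borel" "\<psi>' \<in> borel_measurable borel"
    and der: "\<And>z s. ((\<lambda>s. \<psi> (z + s *\<^sub>R u)) has_real_derivative \<psi>' (z + s *\<^sub>R u)) (at s)"
    and b: "\<And>z. \<bar>\<psi> z\<bar> \<le> C * exp (B * norm z)" and b': "\<And>z. \<bar>\<psi>' z\<bar> \<le> C * exp (B * norm z)"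
    and B: "B \<ge> 0"
  shows "(\<integral>z. \<psi> z * (u \<bullet> z) \<partial>std_gaussian) = (\<integral>z. \<psi>' z \<partial>std_gaussian)"
proof -
  define s where "s k = 1 / real (Suc k)" for k
  have s0: "s k > 0" "s k \<le> 1" for k by (auto simp: s_def)
  have slim: "s \<longlonglongrightarrow> 0" unfolding s_def by (rule tendsto_inverse_Suc)
  then have slim': "filterlim s (at 0) sequentially"
    using s0 by (auto simp: filterlim_at intro!: always_eventually less_imp_neq[symmetric])
  have C: "C \<ge> 0" using order_trans[OF abs_ge_zero b[of 0]] by (auto simp: zero_le_mult_iff)
  \<comment> \<open>\<open>L\<close> is the difference quotient of the translated function and
    \<open>R\<close> that of the Cameron-Martin density. Their integrals agree for every
    \<open>k\<close>, and each side is passed to the limit by dominated convergence.\<close>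
  define L where "L k z = (\<psi> (z + s k *\<^sub>R u) - \<psi> z) / s k" for k z
  define R where "R k z = \<psi> z * ((exp (s k * (u \<bullet> z) - (s k)\<^sup>2 * (norm u)\<^sup>2 / 2) - 1) / s k)" for k z
  have [measurable]: "L k \<in> borel_measurable borel" "R k \<in> borel_measurable borel" for k
    unfolding L_def R_def by measurable
  have ub: "\<bar>u \<bullet> z\<bar> \<le> norm u * norm z" for z by (rule Cauchy_Schwarz_ineq2)
  have psi_int: "integrable std_gaussian \<psi>"
    using b by (intro integrable_std_gaussian_exp_bound'[of _ C B]) auto
  have psi_shift: "integrable std_gaussian (\<lambda>z. \<psi> (z + s k *\<^sub>R u))" for k
  proof (rule integrable_std_gaussian_exp_bound[of _ "C * exp (B * norm u)" B])
    fix z :: 'a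
    have "s k * norm u \<le> norm u" using s0[of k] mult_right_mono[of "s k" 1 "norm u"] by simp
    then have "norm (z + s k *\<^sub>R u) \<le> norm z + norm u"
      using norm_triangle_ineq[of z "s k *\<^sub>R u"] s0[of k] by simp
    then have "B * norm (z + s k *\<^sub>R u) \<le> B * norm u + (B * norm z + (norm z)\<^sup>2 / 8)"
      using mult_left_mono[OF _ B, of "norm (z + s k *\<^sub>R u)" "norm z + norm u"]
      using zero_le_power2[of "norm z"] unfolding distrib_left by linarith
    then show "norm (\<psi> (z + s k *\<^sub>R u)) \<le> C * exp (B * norm u) * exp (B * norm z + (norm z)\<^sup>2 / 8)"
      using b[of "z + s k *\<^sub>R u"] C
      by (auto simp: mult.assoc exp_add[symmetric] intro: order_trans mult_left_mono)
  qed simp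
  have eq: "(\<integral>z. L k z \<partial>std_gaussian) = (\<integral>z. R k z \<partial>std_gaussian)" for k
  proof -
    have e: "s k *\<^sub>R u \<bullet> z - (norm (s k *\<^sub>R u))\<^sup>2 / 2 = s k * (u \<bullet> z) - (s k)\<^sup>2 * (norm u)\<^sup>2 / 2" for z
      by (simp add: power_mult_distrib)
    let ?e = "\<lambda>z. exp (s k * (u \<bullet> z) - (s k)\<^sup>2 * (norm u)\<^sup>2 / 2)"
    have i2: "integrable std_gaussian (\<lambda>z. ?e z * \<psi> z)"
      by (rule iffD1[OF integrable_std_gaussian_shift[of \<psi> "s k *\<^sub>R u"] psi_shift, unfolded e real_scaleR_def]) simp
    have "(\<integral>z. \<psi> (z + s k *\<^sub>R u) \<partial>std_gaussian) = (\<integral>z. ?e z * \<psi> z \<partial>std_gaussian)"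
      by (rule integral_std_gaussian_shift[of \<psi> "s k *\<^sub>R u", unfolded e real_scaleR_def]) simp
    then have "(\<integral>z. L k z \<partial>std_gaussian) = ((\<integral>z. ?e z * \<psi> z \<partial>std_gaussian) - (\<integral>z. \<psi> z \<partial>std_gaussian)) / s k"
      unfolding L_def using psi_int psi_shift by simp
    also have "\<dots> = (\<integral>z. (?e z * \<psi> z - \<psi> z) / s k \<partial>std_gaussian)"
      using psi_int i2 by simp
    also have "\<dots> = (\<integral>z. R k z \<partial>std_gaussian)"
      unfolding R_def by (intro Bochner_Integration.integral_cong) (auto simp: field_simps)
    finally show ?thesis .
  qed
  have l1: "(\<lambda>k. \<integral>z. L k z \<partial>std_gaussian) \<longlonglongrightarrow> (\<integral>z. \<psi>' z \<partial>std_gaussian)"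
  proof (rule integral_dominated_convergence[where w="\<lambda>z. C * exp (B * norm u) * exp (B * norm z)"])
    show "integrable std_gaussian (\<lambda>z::'a. C * exp (B * norm u) * exp (B * norm z))"
      using C by (intro integrable_mult_right integrable_std_gaussian_exp_bound[of _ 1 B]) auto
    show "AE z in std_gaussian. (\<lambda>k. L k z) \<longlonglongrightarrow> \<psi>' z"
    proof (rule AE_I2)
      fix z
      have "((\<lambda>h. (\<psi> (z + h *\<^sub>R u) - \<psi> z) / h) \<longlongrightarrow> \<psi>' z) (at 0)"
        using der[of z 0] by (simp add: DERIV_def)
      from filterlim_compose[OF this slim'] show "(\<lambda>k. L k z) \<longlonglongrightarrow> \<psi>' z" by (simp add: L_def)
    qed
    fix k
    show "AE z in std_gaussian. norm (L k z) \<le> C * exp (B * norm u) * exp (B * norm z)"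
    proof (rule AE_I2)
      fix z :: 'a
      obtain r where r: "0 < r" "r < s k" "\<psi> (z + s k *\<^sub>R u) - \<psi> (z + 0 *\<^sub>R u) = (s k - 0) * \<psi>' (z + r *\<^sub>R u)"
        using MVT2[of 0 "s k" "\<lambda>s. \<psi> (z + s *\<^sub>R u)" "\<lambda>s. \<psi>' (z + s *\<^sub>R u)"] s0[of k] der by auto
      have "r * norm u \<le> norm u" using r s0(2)[of k] mult_right_mono[of r 1 "norm u"] by simp
      then have "norm (z + r *\<^sub>R u) \<le> norm z + norm u"
        using norm_triangle_ineq[of z "r *\<^sub>R u"] r by simp
      then have "B * norm (z + r *\<^sub>R u) \<le> B * norm u + B * norm z"
        using mult_left_mono[OF _ B, of "norm (z + r *\<^sub>R u)" "norm z + norm u"] by (simp add: algebra_simps)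
      then have "\<bar>\<psi>' (z + r *\<^sub>R u)\<bar> \<le> C * exp (B * norm u) * exp (B * norm z)"
        using b'[of "z + r *\<^sub>R u"] C
        by (auto simp: mult.assoc exp_add[symmetric] intro: order_trans mult_left_mono)
      moreover have "L k z = \<psi>' (z + r *\<^sub>R u)" using r s0[of k] by (simp add: L_def)
      ultimately show "norm (L k z) \<le> C * exp (B * norm u) * exp (B * norm z)" by simp
    qed
  qed auto
  have l2: "(\<lambda>k. \<integral>z. R k z \<partial>std_gaussian) \<longlonglongrightarrow> (\<integral>z. \<psi> z * (u \<bullet> z) \<partial>std_gaussian)"
  \<comment> \<open>In the exponent, \<open>B\<close> comes from \<open>\<psi>\<close>,
    \<open>1 + norm u\<close> pays for the polynomial factor of the quotient, and the remaining
    \<open>norm u\<close>, together with \<open>exp ((norm u)\<^sup>2)\<close>, comes from the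
    exponential factor in \<open>abs_exp_minus_1_le\<close>.\<close>
  proof (rule integral_dominated_convergence[where w="\<lambda>z. C * exp ((norm u)\<^sup>2) * exp ((B + norm u + 1 + norm u) * norm z)
        * (norm u + (norm u)\<^sup>2)"])
    show "integrable std_gaussian (\<lambda>z::'a. C * exp ((norm u)\<^sup>2) * exp ((B + norm u + 1 + norm u) * norm z) * (norm u + (norm u)\<^sup>2))"
      using C by (intro integrable_mult_right integrable_mult_left
          integrable_std_gaussian_exp_bound[of _ 1 "B + norm u + 1 + norm u"]) auto
    show "AE z in std_gaussian. (\<lambda>k. R k z) \<longlonglongrightarrow> \<psi> z * (u \<bullet> z)"
    proof (rule AE_I2)
      fix z
      have "((\<lambda>h. exp (h * (u \<bullet> z) - h\<^sup>2 * (norm u)\<^sup>2 / 2)) has_real_derivative (u \<bullet> z)) (at 0)"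
        by (auto intro!: derivative_eq_intros)
      then have "((\<lambda>h. (exp (h * (u \<bullet> z) - h\<^sup>2 * (norm u)\<^sup>2 / 2) - 1) / h) \<longlongrightarrow> u \<bullet> z) (at 0)"
        by (simp add: DERIV_def)
      from filterlim_compose[OF this slim'] show "(\<lambda>k. R k z) \<longlonglongrightarrow> \<psi> z * (u \<bullet> z)"
        unfolding R_def by (intro tendsto_mult tendsto_const)
    qed
    fix k
    show "AE z in std_gaussian. norm (R k z) \<le> C * exp ((norm u)\<^sup>2) * exp ((B + norm u + 1 + norm u) * norm z) * (norm u + (norm u)\<^sup>2)"
    proof (rule AE_I2)
      fix z :: 'a
      let ?w = "s k * (u \<bullet> z) - (s k)\<^sup>2 * (norm u)\<^sup>2 / 2"
      let ?v = "norm u * norm z + (norm u)\<^sup>2"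
      have v0: "?v \<ge> 0" by simp
      have w1: "\<bar>?w\<bar> \<le> s k * ?v"
      proof -
        have "s k * s k * (norm u)\<^sup>2 \<le> s k * 1 * (norm u)\<^sup>2"
          using s0[of k] by (intro mult_right_mono mult_left_mono) auto
        moreover have "s k * \<bar>u \<bullet> z\<bar> \<le> s k * (norm u * norm z)"
          using s0[of k] ub[of z] by (intro mult_left_mono) auto
        moreover have "0 \<le> s k * s k * (norm u)\<^sup>2" using s0[of k] by simp
        moreover have "\<bar>s k * (u \<bullet> z)\<bar> = s k * \<bar>u \<bullet> z\<bar>" using s0[of k] by (simp add: abs_mult)
        ultimately show ?thesis unfolding power2_eq_square[of "s k"] distrib_left by linarith
      qed
      have w2: "\<bar>?w\<bar> \<le> ?v" using w1 mult_left_le_one_le[OF v0, of "s k"] s0[of k] by linarith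
      have "\<bar>exp ?w - 1\<bar> \<le> \<bar>?w\<bar> * exp \<bar>?w\<bar>" by (rule abs_exp_minus_1_le)
      also have "\<dots> \<le> (s k * ?v) * exp ?v"
        by (rule mult_mono[OF w1]) (use w2 v0 s0[of k] in auto)
      finally have *: "\<bar>exp ?w - 1\<bar> / s k \<le> ?v * exp ?v"
        using s0[of k] by (simp add: pos_divide_le_eq mult_ac)
      have "?v \<le> (norm u + (norm u)\<^sup>2) * exp ((1 + norm u) * norm z)"
      proof -
        have "norm z \<le> (1 + norm u) * norm z" by (simp add: distrib_right)
        then have "norm z \<le> exp ((1 + norm u) * norm z)"
          using exp_ge_add_one_self[of "(1 + norm u) * norm z"] by linarith
        moreover have "1 \<le> exp ((1 + norm u) * norm z)" by simp
        ultimately have "norm u * norm z + (norm u)\<^sup>2 * 1 \<le> norm u * exp ((1 + norm u) * norm z) + (norm u)\<^sup>2 * exp ((1 + norm u) * norm z)"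
          by (intro add_mono mult_left_mono) auto
        then show ?thesis by (simp only: distrib_right mult_1_right)
      qed
      then have "?v * exp ?v \<le> (norm u + (norm u)\<^sup>2) * exp ((1 + norm u) * norm z) * exp ?v"
        by (rule mult_right_mono) simp
      with * have "\<bar>exp ?w - 1\<bar> / s k \<le> (norm u + (norm u)\<^sup>2) * exp ((1 + norm u) * norm z) * exp ?v"
        by linarith
      then have "\<bar>\<psi> z\<bar> * (\<bar>exp ?w - 1\<bar> / s k) \<le> (C * exp (B * norm z)) * ((norm u + (norm u)\<^sup>2) * exp ((1 + norm u) * norm z) * exp ?v)"
        using b[of z] C s0[of k] by (intro mult_mono) auto
      also have "\<dots> = C * (norm u + (norm u)\<^sup>2) * exp (B * norm z + (1 + norm u) * norm z + ?v)"
        by (simp only: exp_add mult_ac)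
      also have "B * norm z + (1 + norm u) * norm z + ?v = (norm u)\<^sup>2 + (B + norm u + 1 + norm u) * norm z"
        by (simp only: distrib_right mult_1_left add_ac)
      also have "C * (norm u + (norm u)\<^sup>2) * exp \<dots> = C * exp ((norm u)\<^sup>2) * exp ((B + norm u + 1 + norm u) * norm z) * (norm u + (norm u)\<^sup>2)"
        by (simp only: exp_add mult_ac)
      finally show "norm (R k z) \<le> C * exp ((norm u)\<^sup>2) * exp ((B + norm u + 1 + norm u) * norm z) * (norm u + (norm u)\<^sup>2)"
        using s0[of k] by (simp add: R_def abs_mult)
    qed
  qed auto
  show ?thesis
    by (rule LIMSEQ_unique[OF l2 l1[unfolded eq]])
qed

lemma norm_power_le_exp: "norm (z::'a::real_normed_vector) ^ k \<le> fact k * exp (norm z)"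
proof -
  have "(\<Sum>n\<in>{k}. norm z ^ n /\<^sub>R fact n) \<le> exp (norm z)"
    unfolding exp_def using summable_exp_generic[of "norm z"] by (rule sum_le_suminf) auto
  then show ?thesis by (simp add: field_simps)
qed

lemma integrable_std_gaussian_norm_power: "integrable std_gaussian (\<lambda>z::'a::euclidean_space. norm z ^ k)"
  using norm_power_le_exp[of _ k]
  by (intro integrable_std_gaussian_exp_bound'[of _ "fact k" 1]) auto

lemma integral_std_gaussian_inner: "(\<integral>z. u \<bullet> z \<partial>std_gaussian) = 0"
proof -
  have "(\<integral>z. 1 * (u \<bullet> z) \<partial>std_gaussian) = (\<integral>z. 0 \<partial>(std_gaussian :: 'a::euclidean_space measure))"
    by (rule std_gaussian_stein[where C=1 and B=0]) auto
  then show ?thesis by simp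
qed

text \<open>Stein's identity in direction \<open>v\<close>, applied to a linear function, whose
  derivative is constant.\<close>

lemma integral_std_gaussian_inner_inner:
  fixes u v :: "'a::euclidean_space"
  shows "(\<integral>z. (u \<bullet> z) * (v \<bullet> z) \<partial>std_gaussian) = u \<bullet> v"
proof -
  have "(\<integral>z. (u \<bullet> z) * (v \<bullet> z) \<partial>std_gaussian) = (\<integral>z. u \<bullet> v \<partial>(std_gaussian :: 'a measure))"
  proof (rule std_gaussian_stein[where C="norm u + \<bar>u \<bullet> v\<bar>" and B=1])
    fix z :: 'a and s :: real
    show "((\<lambda>s. u \<bullet> (z + s *\<^sub>R v)) has_real_derivative u \<bullet> v) (at s)"
      by (auto simp: inner_add_right intro!: derivative_eq_intros)
    have "\<bar>u \<bullet> z\<bar> \<le> norm u * norm z" by (rule Cauchy_Schwarz_ineq2)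
    also have "\<dots> \<le> (norm u + \<bar>u \<bullet> v\<bar>) * exp (norm z)"
      using exp_ge_add_one_self[of "norm z"] by (intro mult_mono) (auto intro: order_trans[OF _ exp_ge_add_one_self])
    finally show "\<bar>u \<bullet> z\<bar> \<le> (norm u + \<bar>u \<bullet> v\<bar>) * exp (1 * norm z)" by simp
    have "\<bar>u \<bullet> v\<bar> * 1 \<le> (norm u + \<bar>u \<bullet> v\<bar>) * exp (norm z)"
      by (intro mult_mono) auto
    then show "\<bar>u \<bullet> v\<bar> \<le> (norm u + \<bar>u \<bullet> v\<bar>) * exp (1 * norm z)" by simp
  qed auto
  then show ?thesis by (simp add: emeasure_std_gaussian_UNIV std_gaussian.prob_space[simplified])
qed

lemma integrable_std_gaussian_inner: "integrable std_gaussian (\<lambda>z. u \<bullet> z)"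
proof (rule Bochner_Integration.integrable_bound)
  show "integrable std_gaussian (\<lambda>z. norm u * norm z ^ 1)" by (intro integrable_mult_right integrable_std_gaussian_norm_power)
qed (auto simp: Cauchy_Schwarz_ineq2)

lemma integrable_std_gaussian_inner_inner: "integrable std_gaussian (\<lambda>z. (u \<bullet> z) * (v \<bullet> z))"
proof (rule Bochner_Integration.integrable_bound)
  show "integrable std_gaussian (\<lambda>z. (norm u * norm v) * norm z ^ 2)" by (intro integrable_mult_right integrable_std_gaussian_norm_power)
  have "\<bar>u \<bullet> z\<bar> * \<bar>v \<bullet> z\<bar> \<le> (norm u * norm z) * (norm v * norm z)" for z
    by (intro mult_mono Cauchy_Schwarz_ineq2) auto
  then show "AE z in std_gaussian. norm ((u \<bullet> z) * (v \<bullet> z)) \<le> norm (norm u * norm v * norm z ^ 2)"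
    by (auto simp: abs_mult power2_eq_square mult_ac)
qed auto

lemma integral_std_gaussian_norm_sq: "(\<integral>z. (norm (z::'a::euclidean_space))\<^sup>2 \<partial>std_gaussian) = DIM('a)"
proof -
  have "(norm (z::'a))\<^sup>2 = (\<Sum>b\<in>Basis. (b \<bullet> z) * (b \<bullet> z))" for z
    unfolding power2_norm_eq_inner by (subst euclidean_inner) (simp add: inner_commute)
  then show ?thesis
    by (simp add: Bochner_Integration.integral_sum integrable_std_gaussian_inner_inner integral_std_gaussian_inner_inner)
qed

text \<open>In the basis expansion only covariances survive, so a Gaussian average of a quadratic
  form is a trace. This is how the Laplacian enters: as the first-order term of a Gaussian
  average.\<close>

lemma integral_std_gaussian_quadratic:
  fixes H :: "'a::euclidean_space \<Rightarrow> 'a"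
  assumes H: "bounded_linear H"
  shows "(\<integral>z. H z \<bullet> z \<partial>std_gaussian) = (\<Sum>b\<in>Basis. H b \<bullet> b)"
    and "integrable std_gaussian (\<lambda>z. H z \<bullet> z)"
proof -
  interpret H: bounded_linear H by fact
  have e: "H z \<bullet> z = (\<Sum>b\<in>Basis. (b \<bullet> z) * (H b \<bullet> z))" for z
  proof -
    have "H z = H (\<Sum>b\<in>Basis. (z \<bullet> b) *\<^sub>R b)" by (simp add: euclidean_representation)
    also have "\<dots> = (\<Sum>b\<in>Basis. (z \<bullet> b) *\<^sub>R H b)" by (simp add: H.sum H.scaleR)
    finally have "H z = (\<Sum>b\<in>Basis. (z \<bullet> b) *\<^sub>R H b)" .
    then show ?thesis by (simp only: inner_sum_left inner_scaleR_left inner_commute[of z])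
  qed
  show "(\<integral>z. H z \<bullet> z \<partial>std_gaussian) = (\<Sum>b\<in>Basis. H b \<bullet> b)"
    unfolding e
    by (subst Bochner_Integration.integral_sum)
      (auto simp: integrable_std_gaussian_inner_inner integral_std_gaussian_inner_inner intro!: sum.cong inner_commute)
  show "integrable std_gaussian (\<lambda>z. H z \<bullet> z)"
    by (simp add: e integrable_std_gaussian_inner_inner)
qed

section \<open>Lipschitz potentials and the heat semigroup\<close>

lemma le_exp_self: "(t::real) \<le> exp t"
  using exp_ge_add_one_self[of t] by linarith

text \<open>Only first-order data are fixed here. The second derivative of a twice differentiable
  function need not be continuous or integrable, so it appears as a separate hypothesis
  \<open>H\<close> in the few lemmas that use the Laplacian bound.\<close>

locale lipschitz_potential =
  fixes f :: "'a::euclidean_space \<Rightarrow> real" and df :: "'a \<Rightarrow> 'a" and L :: real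
  assumes has_derivative_f: "(f has_derivative (\<lambda>h. df x \<bullet> h)) (at x)"
    and continuous_df: "continuous_on UNIV df"
    and norm_df_le: "norm (df x) \<le> L"
begin

lemma L_nonneg: "L \<ge> 0"
  using order_trans[OF norm_ge_zero norm_df_le] .

lemma inner_df_le: "\<bar>df x \<bullet> z\<bar> \<le> L * norm z"
  by (meson Cauchy_Schwarz_ineq2 mult_right_mono norm_df_le norm_ge_zero order_trans)

lemma lipschitz_f: "\<bar>f x - f y\<bar> \<le> L * norm (x - y)"
proof -
  have "norm (f x - f y) \<le> L * norm (x - y)"
  proof (rule differentiable_bound)
    show "convex (UNIV :: 'a set)" by simp
    fix x
    show "(f has_derivative (\<lambda>h. df x \<bullet> h)) (at x within UNIV)" using has_derivative_f by simp
    show "onorm (\<lambda>h. df x \<bullet> h) \<le> L"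
      by (rule onorm_le) (simp add: inner_df_le)
  qed auto
  then show ?thesis by simp
qed

lemma continuous_f: "continuous_on S f"
  by (meson continuous_at_imp_continuous_on has_derivative_continuous has_derivative_f)

lemma borel_measurable_f [measurable]: "f \<in> borel_measurable borel"
  by (rule borel_measurable_continuous_onI[OF continuous_f])

lemma borel_measurable_df [measurable]: "df \<in> borel_measurable borel"
  by (rule borel_measurable_continuous_onI[OF continuous_df])

lemma DERIV_f_line: "((\<lambda>s. f (x + s *\<^sub>R z)) has_real_derivative df (x + s *\<^sub>R z) \<bullet> z) (at s)"
proof -
  have "((\<lambda>s. x + s *\<^sub>R z) has_derivative (\<lambda>h. h *\<^sub>R z)) (at s)"
    by (auto intro!: derivative_eq_intros)
  from has_derivative_compose[OF this has_derivative_f]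
  show ?thesis by (simp add: has_field_derivative_def mult.commute[of _ "df (x + s *\<^sub>R z) \<bullet> z"] cong: if_cong)
qed

lemma f_shift_le: "\<bar>f (x + z) - f x\<bar> \<le> L * norm z"
  using lipschitz_f[of "x + z" x] by simp

lemma integrable_f_shift: "integrable std_gaussian (\<lambda>z. f (x + r *\<^sub>R z))"
proof (rule integrable_std_gaussian_exp_bound'[where C="\<bar>f x\<bar> + L * \<bar>r\<bar>" and B=1])
  fix z :: 'a
  have "\<bar>f (x + r *\<^sub>R z)\<bar> \<le> \<bar>f x\<bar> * 1 + L * \<bar>r\<bar> * norm z" using f_shift_le[of x "r *\<^sub>R z"] by simp
  also have "\<dots> \<le> \<bar>f x\<bar> * exp (norm z) + L * \<bar>r\<bar> * exp (norm z)"
    using L_nonneg by (intro add_mono mult_left_mono le_exp_self) auto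
  finally show "norm (f (x + r *\<^sub>R z)) \<le> (\<bar>f x\<bar> + L * \<bar>r\<bar>) * exp (1 * norm z)" by (simp add: algebra_simps)
qed simp

text \<open>The parameter is the variance, so this is the semigroup generated by half the Laplacian;
  hence the factors \<open>M / 2\<close> below.\<close>

definition heat :: "real \<Rightarrow> 'a \<Rightarrow> real" where
  "heat r x = (\<integral>z. f (x + sqrt r *\<^sub>R z) \<partial>std_gaussian)"

lemma heat_0: "heat 0 x = f x"
  by (simp add: heat_def std_gaussian.prob_space[simplified])

lemma heat_lipschitz: "\<bar>heat r x - heat r' x'\<bar> \<le> L * (norm (x - x') + \<bar>sqrt r - sqrt r'\<bar> * (\<integral>z. norm (z::'a) \<partial>std_gaussian))"
proof -
  have i: "integrable std_gaussian (\<lambda>z::'a. norm z)" using integrable_std_gaussian_norm_power[of 1] by simp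
  have "\<bar>heat r x - heat r' x'\<bar> = \<bar>\<integral>z. f (x + sqrt r *\<^sub>R z) - f (x' + sqrt r' *\<^sub>R z) \<partial>std_gaussian\<bar>"
    unfolding heat_def by (simp add: integrable_f_shift)
  also have "\<dots> \<le> (\<integral>z. \<bar>f (x + sqrt r *\<^sub>R z) - f (x' + sqrt r' *\<^sub>R z)\<bar> \<partial>std_gaussian)"
    by (rule integral_abs_bound)
  also have "\<dots> \<le> (\<integral>z. L * (norm (x - x') + \<bar>sqrt r - sqrt r'\<bar> * norm (z::'a)) \<partial>std_gaussian)"
  proof (rule integral_mono)
    fix z :: 'a
    have "\<bar>f (x + sqrt r *\<^sub>R z) - f (x' + sqrt r' *\<^sub>R z)\<bar> \<le> L * norm ((x - x') + (sqrt r - sqrt r') *\<^sub>R z)"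
      using lipschitz_f[of "x + sqrt r *\<^sub>R z" "x' + sqrt r' *\<^sub>R z"] by (simp add: algebra_simps)
    also have "\<dots> \<le> L * (norm (x - x') + norm ((sqrt r - sqrt r') *\<^sub>R z))"
      by (intro mult_left_mono norm_triangle_ineq L_nonneg)
    finally show "\<bar>f (x + sqrt r *\<^sub>R z) - f (x' + sqrt r' *\<^sub>R z)\<bar> \<le> L * (norm (x - x') + \<bar>sqrt r - sqrt r'\<bar> * norm z)" by simp
  qed (use i integrable_f_shift in \<open>auto\<close>)
  also have "\<dots> = L * (norm (x - x') + \<bar>sqrt r - sqrt r'\<bar> * (\<integral>z. norm (z::'a) \<partial>std_gaussian))"
    using i by (simp add: std_gaussian.prob_space[simplified])
  finally show ?thesis .
qed

text \<open>Joint continuity down to time 0 lets the minimum in the maximum principle be attained on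
  a compact set.\<close>

lemma continuous_heat: "continuous_on S (\<lambda>p. heat (fst p) (snd p))"
proof (rule continuous_at_imp_continuous_on, rule ballI)
  fix p :: "real \<times> 'a"
  let ?m = "\<integral>z. norm (z::'a) \<partial>std_gaussian"
  have "((\<lambda>q. L * (norm (snd q - snd p) + \<bar>sqrt (fst q) - sqrt (fst p)\<bar> * ?m)) \<longlongrightarrow> L * (norm (snd p - snd p) + \<bar>sqrt (fst p) - sqrt (fst p)\<bar> * ?m)) (at p)"
    by (intro tendsto_intros)
  then have "((\<lambda>q. L * (norm (snd q - snd p) + \<bar>sqrt (fst q) - sqrt (fst p)\<bar> * ?m)) \<longlongrightarrow> 0) (at p)" by simp
  then have "((\<lambda>q. heat (fst q) (snd q) - heat (fst p) (snd p)) \<longlongrightarrow> 0) (at p)"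
    by (rule Lim_null_comparison[rotated]) (use heat_lipschitz in auto)
  then show "isCont (\<lambda>p. heat (fst p) (snd p)) p"
    unfolding isCont_def by (rule LIM_zero_cancel)
qed

lemma heat_heat:
  assumes "r \<ge> 0" "s \<ge> 0"
  shows "(\<integral>z. heat r (x + sqrt s *\<^sub>R z) \<partial>std_gaussian) = heat (r + s) x"
    and "integrable std_gaussian (\<lambda>z. heat r (x + sqrt s *\<^sub>R z))"
proof -
  have i: "integrable std_gaussian (\<lambda>z. f (x + sqrt (s + r) *\<^sub>R z))" by (rule integrable_f_shift)
  have m: "(\<lambda>w. f (x + w)) \<in> borel_measurable borel" by measurable
  show "(\<integral>z. heat r (x + sqrt s *\<^sub>R z) \<partial>std_gaussian) = heat (r + s) x"
    using integral_std_gaussian_add[OF m assms(2,1) i] by (simp add: heat_def add.assoc add.commute[of r s])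
  show "integrable std_gaussian (\<lambda>z. heat r (x + sqrt s *\<^sub>R z))"
    using integrable_std_gaussian_add[OF m assms(2,1) i] by (simp add: heat_def add.assoc)
qed

text \<open>Differentiability of \<open>df\<close> at the single point \<open>x\<close> gives an
  error \<open>e * (norm z)\<^sup>2\<close> near \<open>x\<close> only. Far away everything grows at
  most quadratically and is absorbed in the cubic term, which is of order \<open>s^(3/2)\<close>
  when \<open>z\<close> is scaled by \<open>sqrt s\<close>.\<close>

lemma taylor_f:
  assumes H: "(df has_derivative H) (at x)" and e: "e > 0"
  obtains C where "C \<ge> 0" "\<And>z. \<bar>f (x + z) - f x - df x \<bullet> z - H z \<bullet> z / 2\<bar> \<le> e * (norm z)\<^sup>2 + C * norm z ^ 3"
proof -
  have bl: "bounded_linear H" using H by (rule has_derivative_bounded_linear)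
  interpret H: bounded_linear H by fact
  from H e obtain d where d: "d > 0" "\<And>y. norm (y - x) < d \<Longrightarrow> norm (df y - df x - H (y - x)) \<le> e * norm (y - x)"
    unfolding has_derivative_at_alt by metis
  obtain K where K: "K > 0" "\<And>z. norm (H z) \<le> norm z * K" using H.pos_bounded by blast
  \<comment> \<open>For \<open>norm z >= d\<close> one has
    \<open>norm z <= norm z ^ 3 / d\<^sup>2\<close> and
    \<open>(norm z)\<^sup>2 <= norm z ^ 3 / d\<close>; these convert the linear and quadratic bounds
    into cubic ones.\<close>
  define C where "C = 2 * L / d\<^sup>2 + K / d"
  have C0: "C \<ge> 0" using L_nonneg K d by (simp add: C_def)
  have "\<bar>f (x + z) - f x - df x \<bullet> z - H z \<bullet> z / 2\<bar> \<le> e * (norm z)\<^sup>2 + C * norm z ^ 3" for z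
  proof (cases "norm z < d")
    case True
    \<comment> \<open>The function along the segment minus its quadratic Taylor polynomial. One
      application of the mean value theorem reduces the claim to the first-order expansion of
      \<open>df\<close> at \<open>x\<close>, so no second derivative at other points is
      used.\<close>
    define \<phi> where "\<phi> s = f (x + s *\<^sub>R z) - s * (df x \<bullet> z) - s\<^sup>2 * (H z \<bullet> z) / 2" for s
    have "(\<phi> has_real_derivative (df (x + s *\<^sub>R z) - df x - H (s *\<^sub>R z)) \<bullet> z) (at s)" for s
      unfolding \<phi>_def
      by (auto intro!: derivative_eq_intros DERIV_f_line simp: inner_diff_left H.scaleR)
    then obtain s where s: "0 < s" "s < 1" "\<phi> 1 - \<phi> 0 = (df (x + s *\<^sub>R z) - df x - H (s *\<^sub>R z)) \<bullet> z"
      using MVT2[of 0 1 \<phi> "\<lambda>s. (df (x + s *\<^sub>R z) - df x - H (s *\<^sub>R z)) \<bullet> z"] by auto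
    have sz: "s * norm z \<le> norm z" using s mult_right_mono[of s 1 "norm z"] by simp
    have "\<bar>\<phi> 1 - \<phi> 0\<bar> \<le> norm (df (x + s *\<^sub>R z) - df x - H (s *\<^sub>R z)) * norm z"
      unfolding s by (rule Cauchy_Schwarz_ineq2)
    also have "\<dots> \<le> (e * (s * norm z)) * norm z"
      using d(2)[of "x + s *\<^sub>R z"] sz True s by (intro mult_right_mono) auto
    also have "\<dots> \<le> (e * norm z) * norm z"
      using sz e by (intro mult_right_mono mult_left_mono) auto
    finally have "\<bar>\<phi> 1 - \<phi> 0\<bar> \<le> e * (norm z)\<^sup>2" by (simp add: power2_eq_square mult.assoc)
    moreover have "0 \<le> C * norm z ^ 3" using C0 by simp
    ultimately show ?thesis unfolding \<phi>_def by simp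
  next
    case False
    then have nz: "d \<le> norm z" by simp
    have a: "norm z * d\<^sup>2 \<le> norm z * (norm z)\<^sup>2" using nz d by (intro mult_left_mono power_mono) auto
    then have 1: "2 * L * norm z \<le> 2 * L / d\<^sup>2 * norm z ^ 3"
      using d mult_left_mono[OF a, of "2 * L"] L_nonneg by (simp add: field_simps power3_eq_cube power2_eq_square)
    have b: "(norm z)\<^sup>2 * d \<le> (norm z)\<^sup>2 * norm z" using nz by (intro mult_left_mono) auto
    then have 2: "K * (norm z)\<^sup>2 \<le> K / d * norm z ^ 3"
      using d mult_left_mono[OF b, of K] K by (simp add: field_simps power3_eq_cube power2_eq_square)
    have "\<bar>H z \<bullet> z\<bar> \<le> norm (H z) * norm z" by (rule Cauchy_Schwarz_ineq2)
    also have "\<dots> \<le> (norm z * K) * norm z" using K by (intro mult_right_mono) auto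
    finally have 3: "\<bar>H z \<bullet> z\<bar> \<le> K * (norm z)\<^sup>2" by (simp add: power2_eq_square mult_ac)
    have "\<bar>f (x + z) - f x - df x \<bullet> z - H z \<bullet> z / 2\<bar> \<le> 2 * L * norm z + K * (norm z)\<^sup>2"
      using f_shift_le[of x z] inner_df_le[of x z] 3 by linarith
    also have "\<dots> \<le> C * norm z ^ 3" using 1 2 by (simp add: C_def distrib_right)
    finally show ?thesis using e by (simp add: add_increasing)
  qed
  with C0 show ?thesis by (rule that)
qed

text \<open>Averaging the Taylor expansion kills the linear term and turns the quadratic one into
  \<open>s / 2\<close> times the trace, so a bound on heat increments for small \<open>s\<close>
  bounds the trace.\<close>

lemma heat_second_order:
  assumes H: "(df has_derivative H) (at x)" and r: "r > 0"
    and le: "\<And>s. 0 < s \<Longrightarrow> s \<le> r \<Longrightarrow> heat s x - f x \<le> - \<kappa> * s"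
  shows "(\<Sum>b\<in>Basis. H b \<bullet> b) / 2 \<le> - \<kappa>"
proof -
  define m2 where "m2 = (\<integral>z. (norm (z::'a))\<^sup>2 \<partial>std_gaussian)"
  define m3 where "m3 = (\<integral>z. norm (z::'a) ^ 3 \<partial>std_gaussian)"
  have m: "m2 \<ge> 0" "m3 \<ge> 0" unfolding m2_def m3_def by (auto intro!: integral_nonneg_AE)
  have bl: "bounded_linear H" using H by (rule has_derivative_bounded_linear)
  interpret H: bounded_linear H by fact
  let ?T = "\<Sum>b\<in>Basis. H b \<bullet> b"
  \<comment> \<open>The limit \<open>s -> 0\<close> comes first and removes the cubic term. The
    error \<open>e * m2\<close> survives it, since the expansion is only \<open>o(|z|^2)\<close>;
    \<open>e\<close> is sent to 0 afterwards.\<close>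
  have main: "?T / 2 \<le> - \<kappa> + e * m2" if e: "e > 0" for e
  proof -
    obtain C where C: "C \<ge> 0" "\<And>z. \<bar>f (x + z) - f x - df x \<bullet> z - H z \<bullet> z / 2\<bar> \<le> e * (norm z)\<^sup>2 + C * norm z ^ 3"
      using taylor_f[OF H e] by blast
    have key: "?T / 2 \<le> - \<kappa> + e * m2 + C * sqrt s * m3" if s: "0 < s" "s \<le> r" for s
    proof -
      have i2: "integrable std_gaussian (\<lambda>z. s * (norm (z::'a))\<^sup>2)" and i3: "integrable std_gaussian (\<lambda>z. s * sqrt s * norm (z::'a) ^ 3)"
        by (intro integrable_mult_right integrable_std_gaussian_norm_power)+
      have iq: "integrable std_gaussian (\<lambda>z. s / 2 * (H z \<bullet> z))"
        by (intro integrable_mult_right integral_std_gaussian_quadratic bl)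
      have il: "integrable std_gaussian (\<lambda>z. sqrt s * (df x \<bullet> z))"
        by (intro integrable_mult_right integrable_std_gaussian_inner)
      have "(\<integral>z. f x + sqrt s * (df x \<bullet> z) + s / 2 * (H z \<bullet> z) - (e * (s * (norm z)\<^sup>2) + C * (s * sqrt s * norm z ^ 3)) \<partial>std_gaussian)
          \<le> (\<integral>z. f (x + sqrt s *\<^sub>R z) \<partial>std_gaussian)"
      proof (rule integral_mono)
        fix z :: 'a
        have "(sqrt s) ^ 3 = s * sqrt s" using s by (simp add: power3_eq_cube)
        then show "f x + sqrt s * (df x \<bullet> z) + s / 2 * (H z \<bullet> z) - (e * (s * (norm z)\<^sup>2) + C * (s * sqrt s * norm z ^ 3)) \<le> f (x + sqrt s *\<^sub>R z)"
          using C(2)[of "sqrt s *\<^sub>R z"] s by (simp add: H.scaleR power_mult_distrib mult.assoc[symmetric])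
      qed (use i2 i3 iq il integrable_f_shift in auto)
      moreover have "(\<integral>z. f x + sqrt s * (df x \<bullet> z) + s / 2 * (H z \<bullet> z) - (e * (s * (norm z)\<^sup>2) + C * (s * sqrt s * norm z ^ 3)) \<partial>std_gaussian)
          = f x + s / 2 * ?T - (e * (s * m2) + C * (s * sqrt s * m3))"
        using i2 i3 iq il integral_std_gaussian_quadratic(1)[OF bl] integral_std_gaussian_inner[of "df x"]
        by (simp add: std_gaussian.prob_space[simplified] m2_def m3_def)
      ultimately have "f x + s / 2 * ?T - (e * (s * m2) + C * (s * sqrt s * m3)) \<le> f x - \<kappa> * s"
        using le[OF s] by (simp add: heat_def)
      then have "s * (?T / 2) \<le> s * (- \<kappa> + e * m2 + C * sqrt s * m3)" by (simp add: algebra_simps)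
      then show ?thesis using s by (simp only: mult_le_cancel_left_pos)
    qed
    have "((\<lambda>s. - \<kappa> + e * m2 + C * sqrt s * m3) \<longlongrightarrow> - \<kappa> + e * m2 + C * sqrt 0 * m3) (at_right 0)"
      by (intro tendsto_intros)
    moreover have "eventually (\<lambda>s. ?T / 2 \<le> - \<kappa> + e * m2 + C * sqrt s * m3) (at_right 0)"
      by (rule eventually_at_rightI[OF _ r]) (use key in auto)
    ultimately show ?thesis
      by (intro tendsto_lowerbound[of _ _ "at_right 0"]) auto
  qed
  show ?thesis
  proof (rule field_le_epsilon)
    fix d :: real assume d: "d > 0"
    have "d / (m2 + 1) * m2 \<le> d" using m d by (simp add: field_simps)
    moreover have "d / (m2 + 1) > 0" using d m by simp
    ultimately show "?T / 2 \<le> - \<kappa> + d" using main[of "d / (m2 + 1)"] by linarith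
  qed
qed

text \<open>A maximum principle for the heat semigroup: at a minimum point $(r_0,x_0)$ of
  $P_rf-f+(M/2+\kappa n)r+\kappa\sqrt{1+|x|^2}$ with $r_0>0$, averaging the values at time $r_0-s$ over a
  Gaussian of variance $s$ around $x_0$ gives $P_sf(x_0)-f(x_0)\leq-(M/2+\kappa n/2)s$ for all small $s$.\<close>

lemma heat_lower_bound:
  assumes H: "\<And>x. (df has_derivative H x) (at x)"
    and M: "\<And>x. - M \<le> (\<Sum>b\<in>Basis. H x b \<bullet> b)"
    and r: "r \<ge> 0"
  shows "heat r x \<ge> f x - M * r / 2"
proof -
  define n where "n = real DIM('a)"
  have n: "n \<ge> 1" unfolding n_def using DIM_positive[where 'a='a] by linarith
  define m where "m = (\<integral>z. norm (z::'a) \<partial>std_gaussian)"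
  \<comment> \<open>A smooth substitute for the norm: it grows linearly, which forces the minimum to
    exist, and is at least 1, which keeps its second-order increments bounded.\<close>
  define p where "p x = sqrt (1 + (norm x)\<^sup>2)" for x :: 'a
  have p1: "p x \<ge> 1" and pn: "p x \<ge> norm x" for x by (auto simp: p_def intro!: real_le_rsqrt)
  have pp: "p x * p x = 1 + (norm x)\<^sup>2" for x by (simp add: p_def)
  \<comment> \<open>The tangent bound \<open>sqrt (p^2 + b) <= p + b / (2 p)\<close>. As
    \<open>p >= 1\<close>, a Gaussian increment of variance \<open>s\<close> raises \<open>p\<close>
    by at most \<open>n * s / 2\<close> on average.\<close>
  have pt: "p (x + w) \<le> p x + (2 * (x \<bullet> w) + (norm w)\<^sup>2) / (2 * p x)" for x w
  proof -
    let ?b = "2 * (x \<bullet> w) + (norm w)\<^sup>2"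
    have eq: "1 + (norm (x + w))\<^sup>2 = p x * p x + ?b"
      unfolding pp power2_norm_eq_inner by (simp add: inner_add inner_commute)
    have "0 \<le> p x * p x + ?b" unfolding eq[symmetric] by simp
    then have "0 \<le> 2 * (p x * p x) + ?b" using pp[of x] by (smt (verit) zero_le_power2)
    then have pos: "0 \<le> p x + ?b / (2 * p x)" using p1[of x] by (simp add: field_simps)
    have "2 * p x * (?b / (2 * p x)) = ?b" using p1[of x] by simp
    then have "p x * p x + ?b \<le> (p x + ?b / (2 * p x))\<^sup>2"
      using zero_le_power2[of "?b / (2 * p x)"] unfolding power2_sum by (simp add: power2_eq_square)
    then have "sqrt (1 + (norm (x + w))\<^sup>2) \<le> p x + ?b / (2 * p x)"
      unfolding eq using pos by (simp add: real_le_lsqrt)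
    then show ?thesis by (simp add: p_def)
  qed
  have pcont: "continuous_on S p" for S unfolding p_def by (intro continuous_intros)
  have main: "heat r x - f x + (M / 2 + \<kappa> * n) * r + \<kappa> * p x \<ge> 0" if \<kappa>: "\<kappa> > 0" for \<kappa>
  proof (rule ccontr)
    define h where "h r x = heat r x - f x + (M / 2 + \<kappa> * n) * r + \<kappa> * p x" for r x
    assume "\<not> heat r x - f x + (M / 2 + \<kappa> * n) * r + \<kappa> * p x \<ge> 0"
    then have neg: "h r x < 0" by (simp add: h_def)
    \<comment> \<open>Beyond radius \<open>R\<close> the penalty \<open>\<kappa> * p\<close> exceeds
      every bound on the other terms for times up to \<open>r\<close>, so negative values occur only
      inside the ball. The summand \<open>norm x\<close> keeps the assumed bad point in the
      ball.\<close>
    define R where "R = norm x + (L * sqrt r * m + \<bar>M / 2 + \<kappa> * n\<bar> * r) / \<kappa>"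
    have m0: "m \<ge> 0" unfolding m_def by (auto intro!: integral_nonneg_AE)
    have R: "R \<ge> norm x" unfolding R_def using L_nonneg m0 r \<kappa> by simp
    have out: "h s y > 0" if "norm y > R" "0 \<le> s" "s \<le> r" for s y
    proof -
      have "\<bar>heat s y - f y\<bar> \<le> L * (sqrt s * m)"
        using heat_lipschitz[of s y 0 y] that by (simp add: heat_0 m_def)
      also have "\<dots> \<le> L * (sqrt r * m)"
        using that m0 L_nonneg by (intro mult_left_mono mult_right_mono) auto
      finally have 1: "\<bar>heat s y - f y\<bar> \<le> L * sqrt r * m" by simp
      have 2: "\<bar>(M / 2 + \<kappa> * n) * s\<bar> \<le> \<bar>M / 2 + \<kappa> * n\<bar> * r"
        unfolding abs_mult using that by (intro mult_left_mono) auto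
      have "norm x + (L * sqrt r * m + \<bar>M / 2 + \<kappa> * n\<bar> * r) / \<kappa> < p y"
        using that pn[of y] by (simp add: R_def)
      then have "(L * sqrt r * m + \<bar>M / 2 + \<kappa> * n\<bar> * r) / \<kappa> < p y" using norm_ge_zero[of x] by linarith
      then have "L * sqrt r * m + \<bar>M / 2 + \<kappa> * n\<bar> * r < \<kappa> * p y" using \<kappa> by (simp add: field_simps)
      then show ?thesis using 1 2 unfolding h_def by linarith
    qed
    have "compact ({0..r} \<times> cball (0::'a) R)" by (intro compact_Times compact_Icc compact_cball)
    moreover have "continuous_on ({0..r} \<times> cball (0::'a) R) (\<lambda>q. h (fst q) (snd q))"
      unfolding h_def
      by (intro continuous_intros continuous_heat continuous_on_compose2[OF continuous_f[of UNIV]] continuous_on_compose2[OF pcont[of UNIV]]) auto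
    moreover have "(r, x) \<in> {0..r} \<times> cball (0::'a) R" using r R by simp
    ultimately obtain q where q: "q \<in> {0..r} \<times> cball (0::'a) R" "\<And>q'. q' \<in> {0..r} \<times> cball (0::'a) R \<Longrightarrow> h (fst q) (snd q) \<le> h (fst q') (snd q')"
      using continuous_attains_inf[of "{0..r} \<times> cball (0::'a) R" "\<lambda>q. h (fst q) (snd q)"] by blast
    define r0 x0 where "r0 = fst q" and "x0 = snd q"
    have r0: "0 \<le> r0" "r0 \<le> r" using q(1) by (auto simp: r0_def)
    have "h r0 x0 \<le> h r x" using q(2)[of "(r, x)"] r R by (simp add: r0_def x0_def)
    then have neg0: "h r0 x0 < 0" using neg by simp
    \<comment> \<open>The minimum over the compact cylinder is a minimum over the whole strip,
      because \<open>h\<close> is positive outside and negative at the minimum point. The Gaussian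
      average below needs all of space.\<close>
    have min: "h r0 x0 \<le> h s y" if "0 \<le> s" "s \<le> r" for s y
    proof (cases "norm y \<le> R")
      case True then show ?thesis using q(2)[of "(s, y)"] that by (simp add: r0_def x0_def)
    next
      case False then show ?thesis using out[of y s] that neg0 by simp
    qed
    have "r0 \<noteq> 0"
    proof
      assume "r0 = 0"
      then have "h r0 x0 = \<kappa> * p x0" by (simp add: h_def heat_0)
      moreover have "\<kappa> * p x0 > 0" using \<kappa> p1[of x0] by simp
      ultimately show False using neg0 by simp
    qed
    with r0 have r0p: "r0 > 0" by simp
    have "(\<Sum>b\<in>Basis. H x0 b \<bullet> b) / 2 \<le> - (M / 2 + \<kappa> * n / 2)"
    proof (rule heat_second_order[OF H r0p])
      fix s assume s: "0 < s" "s \<le> r0"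
      have "h r0 x0 \<le> (\<integral>z. heat (r0 - s) (x0 + sqrt s *\<^sub>R z) - f (x0 + sqrt s *\<^sub>R z)
          + (M / 2 + \<kappa> * n) * (r0 - s) + \<kappa> * (p x0 + (2 * sqrt s * (x0 \<bullet> z) + s * (norm z)\<^sup>2) / (2 * p x0)) \<partial>std_gaussian)" (is "_ \<le> ?I")
      proof -
        have "h r0 x0 = (\<integral>z. h r0 x0 \<partial>(std_gaussian :: 'a measure))" by (simp add: std_gaussian.prob_space[simplified])
        also have "\<dots> \<le> ?I"
        proof (rule integral_mono)
          fix z :: 'a
          have "h r0 x0 \<le> h (r0 - s) (x0 + sqrt s *\<^sub>R z)" using min s r0 by simp
          also have "\<dots> \<le> heat (r0 - s) (x0 + sqrt s *\<^sub>R z) - f (x0 + sqrt s *\<^sub>R z)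
            + (M / 2 + \<kappa> * n) * (r0 - s) + \<kappa> * (p x0 + (2 * sqrt s * (x0 \<bullet> z) + s * (norm z)\<^sup>2) / (2 * p x0))"
            using pt[of x0 "sqrt s *\<^sub>R z"] \<kappa> s
            unfolding h_def by (intro add_left_mono mult_left_mono) (auto simp: power_mult_distrib mult.assoc)
          finally show "h r0 x0 \<le> heat (r0 - s) (x0 + sqrt s *\<^sub>R z) - f (x0 + sqrt s *\<^sub>R z)
            + (M / 2 + \<kappa> * n) * (r0 - s) + \<kappa> * (p x0 + (2 * sqrt s * (x0 \<bullet> z) + s * (norm z)\<^sup>2) / (2 * p x0))" .
        qed (use heat_heat(2)[of "r0 - s" s x0] s r0 integrable_std_gaussian_norm_power[of 2] in
            \<open>auto intro!: Bochner_Integration.integrable_add Bochner_Integration.integrable_diff integrable_mult_right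
              integrable_divide integrable_f_shift integrable_std_gaussian_inner simp del: integrable_mult_right_iff\<close>)
        finally show ?thesis .
      qed
      \<comment> \<open>By the semigroup law the average of \<open>heat (r0 - s)\<close> is
        \<open>heat r0 x0\<close>, which cancels the same term in \<open>h r0 x0\<close>. What is
        left is an upper bound for \<open>heat s x0 - f x0\<close>.\<close>
      also have "?I = heat r0 x0 - heat s x0 + (M / 2 + \<kappa> * n) * (r0 - s) + \<kappa> * (p x0 + s * n / (2 * p x0))"
      proof -
        define c a b where "c = (M / 2 + \<kappa> * n) * (r0 - s) + \<kappa> * p x0" and "a = \<kappa> * sqrt s / p x0" and "b = \<kappa> * s / (2 * p x0)"
        have e: "heat (r0 - s) (x0 + sqrt s *\<^sub>R z) - f (x0 + sqrt s *\<^sub>R z)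
            + (M / 2 + \<kappa> * n) * (r0 - s) + \<kappa> * (p x0 + (2 * sqrt s * (x0 \<bullet> z) + s * (norm z)\<^sup>2) / (2 * p x0))
          = heat (r0 - s) (x0 + sqrt s *\<^sub>R z) - f (x0 + sqrt s *\<^sub>R z) + (c + (a * (x0 \<bullet> z) + b * (norm z)\<^sup>2))" for z
          using p1[of x0] unfolding a_def b_def c_def by (simp add: field_simps)
        have "?I = heat r0 x0 - heat s x0 + (c + (a * 0 + b * n))"
          unfolding e
        proof (intro has_bochner_integral_integral_eq has_bochner_integral_add has_bochner_integral_diff has_bochner_integral_mult_right)
          show "has_bochner_integral std_gaussian (\<lambda>z. heat (r0 - s) (x0 + sqrt s *\<^sub>R z)) (heat r0 x0)"
            using heat_heat[of "r0 - s" s x0] s r0 by (simp add: has_bochner_integral_iff)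
          show "has_bochner_integral std_gaussian (\<lambda>z. f (x0 + sqrt s *\<^sub>R z)) (heat s x0)"
            using integrable_f_shift by (simp add: has_bochner_integral_iff heat_def)
          show "has_bochner_integral std_gaussian (\<lambda>z::'a. c) c"
            by (simp add: has_bochner_integral_iff std_gaussian.prob_space[simplified])
          show "has_bochner_integral std_gaussian (\<lambda>z. x0 \<bullet> z) 0"
            using integrable_std_gaussian_inner[of x0] integral_std_gaussian_inner[of x0] by (simp add: has_bochner_integral_iff)
          show "has_bochner_integral std_gaussian (\<lambda>z::'a. (norm z)\<^sup>2) n"
            using integrable_std_gaussian_norm_power[of 2] integral_std_gaussian_norm_sq[where 'a='a]
            by (simp add: has_bochner_integral_iff n_def)
        qed
        then show ?thesis unfolding a_def b_def c_def by (simp add: algebra_simps)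
      qed
      finally have "heat s x0 - f x0 \<le> - (M / 2 + \<kappa> * n) * s + \<kappa> * (s * n / (2 * p x0))"
        unfolding h_def by (simp add: algebra_simps diff_divide_distrib)
      \<comment> \<open>The penalty consumes at most half of the extra slope
        \<open>\<kappa> * n\<close>; the other half makes the contradiction with \<open>M\<close>
        strict.\<close>
      also have "s * n / (2 * p x0) \<le> s * n / 2"
        using s n p1[of x0] by (intro divide_left_mono) auto
      finally show "heat s x0 - f x0 \<le> - (M / 2 + \<kappa> * n / 2) * s"
        using \<kappa> by (simp add: algebra_simps)
    qed
    with M[of x0] \<kappa> n show False by (smt (verit) mult_pos_pos field_sum_of_halves)
  qed
  have "((\<lambda>\<kappa>. heat r x - f x + (M / 2 + \<kappa> * n) * r + \<kappa> * p x) \<longlongrightarrow> heat r x - f x + (M / 2 + 0 * n) * r + 0 * p x) (at_right 0)"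
    by (intro tendsto_intros)
  then have "0 \<le> heat r x - f x + (M / 2 + 0 * n) * r + 0 * p x"
    by (rule tendsto_lowerbound) (auto intro!: eventually_at_rightI[of 0 1] main)
  then show ?thesis by simp
qed

text \<open>Integrate the heat bound against $e^f\,d\gamma$ and symmetrise the increment $z\mapsto-z$ by the
  Cameron--Martin formula: this produces a product of two difference quotients, so that only first
  derivatives of $f$ survive in the limit.\<close>

lemma integral_norm_df_sq_le:
  assumes H: "\<And>x. (df has_derivative H x) (at x)"
    and M: "\<And>x. - M \<le> (\<Sum>b\<in>Basis. H x b \<bullet> b)"
    and one: "(\<integral>x. exp (f x) \<partial>std_gaussian) = 1"
  shows "(\<integral>x. exp (f x) * (df x \<bullet> (df x - x)) \<partial>std_gaussian) \<le> M"
proof -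
  interpret P: pair_sigma_finite "std_gaussian :: 'a measure" "std_gaussian :: 'a measure" ..
  \<comment> \<open>In the \<open>z\<close> variable: \<open>L\<close> from \<open>f\<close>, plus
    one for each of three factors \<open>exp (norm z)\<close> that dominate polynomial
    factors.\<close>
  define B where "B = L + 3"
  define E where "E x z = exp (B * norm x + (norm x)\<^sup>2 / 8) * exp (B * norm z + (norm z)\<^sup>2 / 8)" for x z :: 'a
  \<comment> \<open>Step sizes at most 1/8 keep the cross term and the square term of
    \<open>J\<close> within \<open>(norm x)\<^sup>2 / 8 + (norm z)\<^sup>2 / 8\<close>, as the
    integrability lemmas require.\<close>
  define \<rho> where "\<rho> k = (1 / 8) * (1 / real (Suc k))" for k
  have \<rho>: "0 < \<rho> k" "\<rho> k \<le> 1 / 8" for k by (auto simp: \<rho>_def field_simps)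
  have "\<rho> \<longlonglongrightarrow> (1 / 8) * 0" unfolding \<rho>_def by (intro tendsto_intros tendsto_inverse_Suc)
  then have \<rho>lim: "filterlim \<rho> (at 0) sequentially"
    using \<rho>(1) by (auto simp: filterlim_at intro!: always_eventually less_imp_neq[symmetric])
  \<comment> \<open>The logarithm of the ratio of the Lebesgue densities of
    \<open>e^f d\<gamma>\<close> at \<open>x + \<rho> z\<close> and at \<open>x\<close>. Its
    difference quotient tends to \<open>(df x - x) \<bullet> z\<close>, the logarithmic derivative
    of that density.\<close>
  define J where "J k x z = f (x + \<rho> k *\<^sub>R z) - f x - \<rho> k * (x \<bullet> z) - (\<rho> k)\<^sup>2 * (norm z)\<^sup>2 / 2" for k x z
  define T where "T k x z = (f (x + \<rho> k *\<^sub>R z) - f x) / \<rho> k" for k x z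
  define D where "D k x z = exp (f x) * (T k x z * ((exp (J k x z) - 1) / \<rho> k))" for k x z
  have [measurable]: "(\<lambda>(x, z). J k x z) \<in> borel_measurable (borel \<Otimes>\<^sub>M borel)"
     "(\<lambda>(x, z). T k x z) \<in> borel_measurable (borel \<Otimes>\<^sub>M borel)"
     "(\<lambda>(x, z). D k x z) \<in> borel_measurable (borel \<Otimes>\<^sub>M borel)" for k
    unfolding D_def J_def T_def by measurable
  have fx: "exp (f x) \<le> exp (f 0) * exp (L * norm x)" for x
    using f_shift_le[of 0 x] by (auto simp: exp_add[symmetric])
  have Tb: "\<bar>T k x z\<bar> \<le> L * norm z" for k x z
    using f_shift_le[of x "\<rho> k *\<^sub>R z"] \<rho>(1)[of k] by (simp add: T_def field_simps)
  have Jb: "\<bar>J k x z\<bar> \<le> \<rho> k * ((L + norm x + norm z) * norm z)" for k x z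
  proof -
    have 1: "\<bar>f (x + \<rho> k *\<^sub>R z) - f x\<bar> \<le> \<rho> k * (L * norm z)"
      using f_shift_le[of x "\<rho> k *\<^sub>R z"] \<rho>(1)[of k] by (simp add: mult_ac)
    have 2: "\<bar>\<rho> k * (x \<bullet> z)\<bar> \<le> \<rho> k * (norm x * norm z)"
      unfolding abs_mult using \<rho>(1)[of k] Cauchy_Schwarz_ineq2[of x z] by simp
    have "\<rho> k * \<rho> k \<le> \<rho> k * 1" using \<rho>[of k] by (intro mult_left_mono) auto
    then have "(\<rho> k)\<^sup>2 * (norm z)\<^sup>2 \<le> \<rho> k * (norm z)\<^sup>2"
      by (intro mult_right_mono) (auto simp: power2_eq_square)
    moreover have "0 \<le> (\<rho> k)\<^sup>2 * (norm z)\<^sup>2" by simp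
    ultimately have "\<bar>J k x z\<bar> \<le> \<rho> k * (L * norm z) + \<rho> k * (norm x * norm z) + \<rho> k * (norm z)\<^sup>2"
      using 1 2 unfolding J_def by linarith
    then show ?thesis by (simp add: algebra_simps power2_eq_square)
  qed
  have Jb2: "\<bar>J k x z\<bar> \<le> L * norm z + ((norm x)\<^sup>2 / 8 + (norm z)\<^sup>2 / 8)" for k x z
  proof -
    have 1: "\<bar>f (x + \<rho> k *\<^sub>R z) - f x\<bar> \<le> L * norm z"
    proof -
      have "\<bar>f (x + \<rho> k *\<^sub>R z) - f x\<bar> \<le> L * (\<rho> k * norm z)" using f_shift_le[of x "\<rho> k *\<^sub>R z"] \<rho>(1)[of k] by simp
      also have "\<dots> \<le> L * (1 * norm z)" using \<rho>[of k] L_nonneg by (intro mult_left_mono mult_right_mono) auto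
      finally show ?thesis by simp
    qed
    have "\<bar>\<rho> k * (x \<bullet> z)\<bar> \<le> \<rho> k * (norm x * norm z)"
      unfolding abs_mult using \<rho>(1)[of k] Cauchy_Schwarz_ineq2[of x z] by simp
    also have "\<dots> \<le> 1 / 8 * (norm x * norm z)" using \<rho>[of k] by (intro mult_right_mono) auto
    also have "\<dots> \<le> (norm x)\<^sup>2 / 16 + (norm z)\<^sup>2 / 16"
      using zero_le_power2[of "norm x - norm z"] by (simp add: power2_diff)
    finally have 2: "\<bar>\<rho> k * (x \<bullet> z)\<bar> \<le> (norm x)\<^sup>2 / 16 + (norm z)\<^sup>2 / 16" .
    have "(\<rho> k)\<^sup>2 \<le> (1 / 8)\<^sup>2" using \<rho>[of k] by (intro power_mono) auto
    then have "(\<rho> k)\<^sup>2 \<le> 1 / 8" by (simp add: power2_eq_square)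
    then have "(\<rho> k)\<^sup>2 * (norm z)\<^sup>2 \<le> 1 / 8 * (norm z)\<^sup>2" by (rule mult_right_mono) simp
    moreover have "0 \<le> (\<rho> k)\<^sup>2 * (norm z)\<^sup>2" "0 \<le> (norm x)\<^sup>2" by auto
    ultimately show ?thesis using 1 2 unfolding J_def by linarith
  qed
  have n1: "norm z \<le> exp (norm z)" for z :: 'a by (rule le_exp_self)
  have n2: "L + norm x + norm z \<le> (1 + L) * (exp (norm x) * exp (norm z))" for x z :: 'a
  proof -
    have "1 + (norm x + norm z) \<le> exp (norm x + norm z)" by (rule exp_ge_add_one_self)
    moreover have "L * 1 \<le> L * exp (norm x + norm z)" using L_nonneg by (intro mult_left_mono) auto
    ultimately show ?thesis unfolding exp_add[symmetric] distrib_right by linarith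
  qed
  define C where "C = exp (f 0) * (L * (1 + L))"
  have C: "C \<ge> 0" using L_nonneg by (simp add: C_def)
  have Db: "\<bar>D k x z\<bar> \<le> C * E x z" for k x z
  proof -
    have "\<bar>exp (J k x z) - 1\<bar> \<le> \<bar>J k x z\<bar> * exp \<bar>J k x z\<bar>" by (rule abs_exp_minus_1_le)
    also have "\<dots> \<le> (\<rho> k * ((L + norm x + norm z) * norm z)) * exp (L * norm z + ((norm x)\<^sup>2 / 8 + (norm z)\<^sup>2 / 8))"
      using Jb[of k x z] Jb2[of k x z] L_nonneg \<rho>[of k] by (intro mult_mono) auto
    finally have "\<bar>(exp (J k x z) - 1) / \<rho> k\<bar> \<le> ((L + norm x + norm z) * norm z) * exp (L * norm z + ((norm x)\<^sup>2 / 8 + (norm z)\<^sup>2 / 8))"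
      using \<rho>(1)[of k] by (simp add: abs_div pos_divide_le_eq mult_ac)
    also have "\<dots> \<le> (((1 + L) * (exp (norm x) * exp (norm z))) * exp (norm z)) * exp (L * norm z + ((norm x)\<^sup>2 / 8 + (norm z)\<^sup>2 / 8))"
      using L_nonneg by (intro mult_right_mono mult_mono n1 n2) auto
    finally have 1: "\<bar>(exp (J k x z) - 1) / \<rho> k\<bar> \<le> \<dots>" .
    have "\<bar>D k x z\<bar> = exp (f x) * (\<bar>T k x z\<bar> * \<bar>(exp (J k x z) - 1) / \<rho> k\<bar>)"
      by (simp add: D_def abs_mult)
    also have "\<dots> \<le> (exp (f 0) * exp (L * norm x)) * ((L * exp (norm z)) *
        ((((1 + L) * (exp (norm x) * exp (norm z))) * exp (norm z)) * exp (L * norm z + ((norm x)\<^sup>2 / 8 + (norm z)\<^sup>2 / 8))))"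
      using L_nonneg order_trans[OF Tb mult_left_mono[OF n1 L_nonneg], of k x z] 1 by (intro mult_mono fx) auto
    also have "\<dots> = C * (exp (L * norm x + norm x + (norm x)\<^sup>2 / 8) * exp (B * norm z + (norm z)\<^sup>2 / 8))"
      by (simp add: C_def B_def exp_add[symmetric] algebra_simps)
    also have "\<dots> \<le> C * E x z"
      unfolding E_def using C by (intro mult_left_mono mult_right_mono) (auto simp: B_def algebra_simps)
    finally show ?thesis .
  qed
  have Eint: "integrable (std_gaussian \<Otimes>\<^sub>M std_gaussian) (\<lambda>p. c * E (fst p) (snd p))" for c
    by (rule integrable_std_gaussian_pair_exp_bound[of _ "\<bar>c\<bar>" B]) (auto simp: E_def abs_mult)
  have Dint: "integrable (std_gaussian \<Otimes>\<^sub>M std_gaussian) (\<lambda>(x, z). D k x z)" for k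
    using Db by (intro integrable_std_gaussian_pair_exp_bound[of _ C B]) (auto simp: E_def)
  have Dle: "(\<integral>p. (case p of (x, z) \<Rightarrow> D k x z) \<partial>(std_gaussian \<Otimes>\<^sub>M std_gaussian)) \<le> M" for k
  proof -
    define U where "U x z = (f (x + \<rho> k *\<^sub>R z) - f x) * exp (f x)" for x z
    define V where "V x z = (f (x + \<rho> k *\<^sub>R z) - f x) * (exp (f x) * exp (J k x z))" for x z
    have [measurable]: "(\<lambda>(x, z). U x z) \<in> borel_measurable (borel \<Otimes>\<^sub>M borel)"
      "(\<lambda>(x, z). V x z) \<in> borel_measurable (borel \<Otimes>\<^sub>M borel)"
      unfolding U_def V_def by measurable
    have fb: "\<bar>f (x + \<rho> k *\<^sub>R z) - f x\<bar> \<le> L * exp (norm z)" for x z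
    proof -
      have "\<bar>f (x + \<rho> k *\<^sub>R z) - f x\<bar> = \<rho> k * \<bar>T k x z\<bar>" using \<rho>(1)[of k] by (simp add: T_def abs_div)
      also have "\<dots> \<le> 1 * (L * norm z)" using \<rho>[of k] Tb[of k x z] by (intro mult_mono) auto
      also have "\<dots> \<le> L * exp (norm z)" using mult_left_mono[OF n1 L_nonneg] by simp
      finally show ?thesis .
    qed
    have Vint: "integrable (std_gaussian \<Otimes>\<^sub>M std_gaussian) (\<lambda>(x, z). V x z)"
    proof (rule integrable_std_gaussian_pair_exp_bound[of _ "exp (f 0) * L" B])
      fix x z :: 'a
      have "\<bar>V x z\<bar> \<le> (L * exp (norm z)) * ((exp (f 0) * exp (L * norm x)) * exp (L * norm z + ((norm x)\<^sup>2 / 8 + (norm z)\<^sup>2 / 8)))"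
        unfolding V_def abs_mult using L_nonneg fb fx Jb2[of k x z] by (intro mult_mono) auto
      also have "\<dots> = exp (f 0) * L * (exp (L * norm x + (norm x)\<^sup>2 / 8) * exp (L * norm z + norm z + (norm z)\<^sup>2 / 8))"
        by (simp add: exp_add[symmetric] algebra_simps)
      also have "\<dots> \<le> exp (f 0) * L * (exp (B * norm x + (norm x)\<^sup>2 / 8) * exp (B * norm z + (norm z)\<^sup>2 / 8))"
        using L_nonneg by (intro mult_left_mono mult_mono) (auto simp: B_def algebra_simps)
      finally show "norm (case (x, z) of (x, z) \<Rightarrow> V x z) \<le> exp (f 0) * L * (exp (B * norm x + (norm x)\<^sup>2 / 8) * exp (B * norm z + (norm z)\<^sup>2 / 8))" by simp
    qed measurable
    have Uint: "integrable (std_gaussian \<Otimes>\<^sub>M std_gaussian) (\<lambda>(x, z). U x z)"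
    proof (rule integrable_std_gaussian_pair_exp_bound[of _ "exp (f 0) * L" B])
      fix x z :: 'a
      have "\<bar>U x z\<bar> \<le> (L * exp (norm z)) * (exp (f 0) * exp (L * norm x))"
        unfolding U_def abs_mult using L_nonneg fb fx by (intro mult_mono) auto
      also have "\<dots> = exp (f 0) * L * (exp (L * norm x) * exp (norm z))" by simp
      also have "\<dots> \<le> exp (f 0) * L * (exp (B * norm x + (norm x)\<^sup>2 / 8) * exp (B * norm z + (norm z)\<^sup>2 / 8))"
        using L_nonneg by (intro mult_left_mono mult_mono) (auto simp: B_def algebra_simps add_increasing)
      finally show "norm (case (x, z) of (x, z) \<Rightarrow> U x z) \<le> exp (f 0) * L * (exp (B * norm x + (norm x)\<^sup>2 / 8) * exp (B * norm z + (norm z)\<^sup>2 / 8))" by simp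
    qed measurable
    have DUV: "(\<rho> k)\<^sup>2 * D k x z = V x z - U x z" for x z
      using \<rho>(1)[of k] by (simp add: D_def U_def V_def T_def field_simps power2_eq_square)
    have intf: "integrable std_gaussian (\<lambda>x. exp (f x))"
      using fx by (intro integrable_std_gaussian_exp_bound'[of _ "exp (f 0)" L]) auto
    have A1: "- M * (\<rho> k)\<^sup>2 / 2 \<le> (\<integral>x. \<integral>z. U x z \<partial>std_gaussian \<partial>std_gaussian)"
    proof -
      have "- M * (\<rho> k)\<^sup>2 / 2 = (\<integral>x. (- M * (\<rho> k)\<^sup>2 / 2) * exp (f x) \<partial>std_gaussian)"
        using one by simp
      also have "\<dots> \<le> (\<integral>x. \<integral>z. U x z \<partial>std_gaussian \<partial>std_gaussian)"
      proof (rule integral_mono)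
        fix x
        have "(\<integral>z. U x z \<partial>std_gaussian) = (heat ((\<rho> k)\<^sup>2) x - f x) * exp (f x)"
          unfolding U_def heat_def using integrable_f_shift[of x "\<rho> k"] \<rho>(1)[of k]
          by (simp add: std_gaussian.prob_space[simplified])
        moreover have "- M * (\<rho> k)\<^sup>2 / 2 \<le> heat ((\<rho> k)\<^sup>2) x - f x"
          using heat_lower_bound[OF H M, of "(\<rho> k)\<^sup>2" x] by simp
        then have "- M * (\<rho> k)\<^sup>2 / 2 * exp (f x) \<le> (heat ((\<rho> k)\<^sup>2) x - f x) * exp (f x)"
          by (rule mult_right_mono) simp
        ultimately show "- M * (\<rho> k)\<^sup>2 / 2 * exp (f x) \<le> (\<integral>z. U x z \<partial>std_gaussian)"
          by linarith
      qed (use intf P.integrable_fst'[OF Uint] in auto)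
      finally show ?thesis .
    qed
    have swap: "(\<integral>x. \<integral>z. U x z \<partial>std_gaussian \<partial>std_gaussian) = (\<integral>z. \<integral>x. U x z \<partial>std_gaussian \<partial>std_gaussian)"
      by (rule P.Fubini_integral[symmetric]) (rule Uint)
    have swapV: "(\<integral>x. \<integral>z. V x z \<partial>std_gaussian \<partial>std_gaussian) = (\<integral>z. \<integral>x. V x z \<partial>std_gaussian \<partial>std_gaussian)"
      by (rule P.Fubini_integral[symmetric]) (rule Vint)
    \<comment> \<open>Reflect \<open>z\<close>, then move \<open>x\<close> to
      \<open>x + \<rho> z\<close>: the increment of \<open>f\<close> changes sign and the weight
      becomes \<open>exp (f x) * exp (J k x z)\<close>. So \<open>U\<close> and \<open>- V\<close>
      have the same integral.\<close>
    have "(\<integral>z. \<integral>x. U x z \<partial>std_gaussian \<partial>std_gaussian) = (\<integral>z. \<integral>x. U x (- z) \<partial>std_gaussian \<partial>std_gaussian)"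
      by (rule integral_std_gaussian_uminus[symmetric]) measurable
    also have "\<dots> = (\<integral>z. \<integral>x. - V x z \<partial>std_gaussian \<partial>std_gaussian)"
    proof (rule Bochner_Integration.integral_cong[OF refl])
      fix z :: 'a
      let ?a = "\<rho> k *\<^sub>R z"
      let ?\<Psi> = "\<lambda>x. (f x - f (x + ?a)) * exp (f (x + ?a))"
      have "(\<integral>x. U x (- z) \<partial>std_gaussian) = (\<integral>x. ?\<Psi> (x + (- ?a)) \<partial>std_gaussian)" by (simp add: U_def)
      also have "\<dots> = (\<integral>x. exp (- ?a \<bullet> x - (norm (- ?a))\<^sup>2 / 2) *\<^sub>R ?\<Psi> x \<partial>std_gaussian)"
        by (rule integral_std_gaussian_shift) measurable
      also have "\<dots> = (\<integral>x. - V x z \<partial>std_gaussian)"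
      proof (rule Bochner_Integration.integral_cong[OF refl])
        fix x
        have "exp (- ?a \<bullet> x - (norm (- ?a))\<^sup>2 / 2) * exp (f (x + ?a)) = exp (f x) * exp (J k x z)"
          using \<rho>(1)[of k] by (simp add: exp_add[symmetric] J_def inner_commute power_mult_distrib)
        then show "exp (- ?a \<bullet> x - (norm (- ?a))\<^sup>2 / 2) *\<^sub>R ?\<Psi> x = - V x z"
          unfolding V_def by (simp add: algebra_simps)
      qed
      finally show "(\<integral>x. U x (- z) \<partial>std_gaussian) = (\<integral>x. - V x z \<partial>std_gaussian)" .
    qed
    also have "\<dots> = - (\<integral>z. \<integral>x. V x z \<partial>std_gaussian \<partial>std_gaussian)" by simp
    finally have A2: "(\<integral>x. \<integral>z. U x z \<partial>std_gaussian \<partial>std_gaussian) = - (\<integral>x. \<integral>z. V x z \<partial>std_gaussian \<partial>std_gaussian)"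
      unfolding swap swapV .
    \<comment> \<open>The integral of \<open>V - U\<close> is \<open>-2\<close> times that of
      \<open>U\<close>, which turns the heat bound \<open>- M * \<rho>^2 / 2\<close> into exactly
      \<open>M * \<rho>^2\<close>.\<close>
    have "(\<rho> k)\<^sup>2 * (\<integral>p. (case p of (x, z) \<Rightarrow> D k x z) \<partial>(std_gaussian \<Otimes>\<^sub>M std_gaussian))
        = (\<integral>p. (case p of (x, z) \<Rightarrow> V x z) - (case p of (x, z) \<Rightarrow> U x z) \<partial>(std_gaussian \<Otimes>\<^sub>M std_gaussian))"
      unfolding Bochner_Integration.integral_mult_right_zero[symmetric]
      by (intro Bochner_Integration.integral_cong) (auto simp: DUV)
    also have "\<dots> = (\<integral>x. \<integral>z. V x z \<partial>std_gaussian \<partial>std_gaussian) - (\<integral>x. \<integral>z. U x z \<partial>std_gaussian \<partial>std_gaussian)"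
      using P.integral_fst'[OF Uint] P.integral_fst'[OF Vint] Bochner_Integration.integral_diff[OF Vint Uint] by simp
    also have "\<dots> \<le> (\<rho> k)\<^sup>2 * M" using A1 A2 by (simp add: field_simps)
    finally show ?thesis using \<rho>(1)[of k] by (simp add: mult_le_cancel_left_pos)
  qed
  define W where "W x z = exp (f x) * ((df x \<bullet> z) * ((df x - x) \<bullet> z))" for x z
  have [measurable]: "(\<lambda>(x, z). W x z) \<in> borel_measurable (borel \<Otimes>\<^sub>M borel)"
    unfolding W_def by measurable
  have lim: "(\<lambda>k. D k x z) \<longlonglongrightarrow> W x z" for x z
  proof -
    have d0: "((\<lambda>s. f (x + s *\<^sub>R z)) has_real_derivative df x \<bullet> z) (at 0)"
      using DERIV_f_line[of x z 0] by simp
    then have "((\<lambda>h. (f (x + h *\<^sub>R z) - f x) / h) \<longlongrightarrow> df x \<bullet> z) (at 0)"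
      by (simp add: DERIV_def)
    from filterlim_compose[OF this \<rho>lim] have 1: "(\<lambda>k. T k x z) \<longlonglongrightarrow> df x \<bullet> z" by (simp add: T_def)
    have "((\<lambda>s. exp (f (x + s *\<^sub>R z) - f x - s * (x \<bullet> z) - s\<^sup>2 * (norm z)\<^sup>2 / 2)) has_real_derivative (df x - x) \<bullet> z) (at 0)"
      by (rule derivative_eq_intros refl d0 | simp add: inner_diff_left)+
    then have "((\<lambda>h. (exp (f (x + h *\<^sub>R z) - f x - h * (x \<bullet> z) - h\<^sup>2 * (norm z)\<^sup>2 / 2) - 1) / h) \<longlongrightarrow> (df x - x) \<bullet> z) (at 0)"
      by (simp add: DERIV_def)
    from filterlim_compose[OF this \<rho>lim] have 2: "(\<lambda>k. (exp (J k x z) - 1) / \<rho> k) \<longlonglongrightarrow> (df x - x) \<bullet> z" by (simp add: J_def)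
    show ?thesis unfolding D_def W_def by (intro tendsto_mult tendsto_const 1 2)
  qed
  have conv: "(\<lambda>k. \<integral>p. (case p of (x, z) \<Rightarrow> D k x z) \<partial>(std_gaussian \<Otimes>\<^sub>M std_gaussian)) \<longlonglongrightarrow>
      (\<integral>p. (case p of (x, z) \<Rightarrow> W x z) \<partial>(std_gaussian \<Otimes>\<^sub>M std_gaussian))"
    by (rule integral_dominated_convergence[where w="\<lambda>p. C * E (fst p) (snd p)"])
      (use Eint Db lim in \<open>auto\<close>)
  have Wint: "integrable (std_gaussian \<Otimes>\<^sub>M std_gaussian) (\<lambda>(x, z). W x z)"
    by (rule integrable_dominated_convergence[where w="\<lambda>p. C * E (fst p) (snd p)" and s="\<lambda>k (x, z). D k x z"])
      (use Eint Db lim in \<open>auto\<close>)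
  \<comment> \<open>The covariance identity integrates out \<open>z\<close> and merges the two
    directional derivatives into one inner product.\<close>
  have "(\<integral>x. exp (f x) * (df x \<bullet> (df x - x)) \<partial>std_gaussian) = (\<integral>x. \<integral>z. W x z \<partial>std_gaussian \<partial>std_gaussian)"
    unfolding W_def by (simp add: integral_std_gaussian_inner_inner)
  also have "\<dots> = (\<integral>p. (case p of (x, z) \<Rightarrow> W x z) \<partial>(std_gaussian \<Otimes>\<^sub>M std_gaussian))"
    using P.integral_fst'[OF Wint] by simp
  also have "\<dots> \<le> M"
    by (rule LIMSEQ_le_const2[OF conv]) (use Dle in auto)
  finally show ?thesis .
qed

end

section \<open>The drift and one step of the Euler scheme\<close>

lemma exp_second_order: "\<bar>exp (w::real) - 1 - w\<bar> \<le> w\<^sup>2 * exp \<bar>w\<bar>"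
proof -
  have key: "exp t - 1 - t \<le> t * (t * exp t)" if "t \<ge> 0" for t :: real
  proof -
    have "exp t - 1 \<le> t * exp t" using abs_exp_minus_1_le[of t] that by simp
    moreover have "t * (exp t - 1) \<le> t * (t * exp t)"
      using abs_exp_minus_1_le[of t] that by (intro mult_left_mono) auto
    ultimately show ?thesis by (simp add: algebra_simps)
  qed
  show ?thesis
  proof (cases "w \<ge> 0")
    case True
    have "\<bar>exp w - 1 - w\<bar> = exp w - 1 - w" using exp_ge_add_one_self[of w] by linarith
    then show ?thesis using key[of w] True by (simp add: power2_eq_square mult.assoc)
  next
    case False
    define t where "t = - w"
    have t: "t > 0" using False by (simp add: t_def)
    have "1 - t \<le> exp (- t)" using exp_ge_add_one_self[of "- t"] by simp
    moreover have "exp (- t) - 1 + t \<le> t * t"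
    proof -
      have "\<bar>exp (- t) - 1\<bar> \<le> t" using t exp_ge_add_one_self[of "- t"] by simp
      have 1: "1 + t \<le> exp t" by (rule exp_ge_add_one_self)
      have "exp (- t) \<le> 1 / (1 + t)" unfolding exp_minus inverse_eq_divide using t 1 by (intro divide_left_mono) auto
      also have "1 / (1 + t) \<le> 1 - t + t * t" using t by (simp add: field_simps)
      finally show ?thesis by simp
    qed
    moreover have "t * t * 1 \<le> t * t * exp t" using t by (intro mult_left_mono) auto
    ultimately have "\<bar>exp (- t) - 1 + t\<bar> \<le> t * t * exp t" by linarith
    then show ?thesis using t unfolding t_def by (simp add: power2_eq_square abs_if)
  qed
qed

text \<open>The Cameron-Martin exponential has orthogonal Hermite components of squared norm
  \<open>|b|^(2 k) / k!\<close>; removing orders 0 and 1 leaves the tail of an exponential series.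
  The proof expands the square instead and evaluates the terms by translation and
  covariance.\<close>

lemma integral_std_gaussian_exp_second_order:
  fixes b :: "'a::euclidean_space"
  defines "X \<equiv> \<lambda>z. exp (b \<bullet> z - (norm b)\<^sup>2 / 2) - 1 - b \<bullet> z"
  shows "integrable std_gaussian (\<lambda>z. (X z)\<^sup>2)"
    and "(\<integral>z. (X z)\<^sup>2 \<partial>std_gaussian) = exp ((norm b)\<^sup>2) - 1 - (norm b)\<^sup>2"
proof -
  let ?A = "(norm b)\<^sup>2"
  let ?e = "\<lambda>b z. exp (b \<bullet> z - (norm b)\<^sup>2 / 2)"
  have one: "has_bochner_integral std_gaussian (\<lambda>z::'a. 1 :: real) 1"
    by (simp add: has_bochner_integral_iff std_gaussian.prob_space[simplified])
  have e: "has_bochner_integral std_gaussian (?e b) 1" for b :: 'a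
    using integral_std_gaussian_shift[of "\<lambda>_. 1::real" b] integrable_std_gaussian_shift[of "\<lambda>_. 1::real" b]
    by (simp add: has_bochner_integral_iff std_gaussian.prob_space[simplified])
  have l: "has_bochner_integral std_gaussian (\<lambda>z. b \<bullet> z) 0"
    by (simp add: has_bochner_integral_iff integrable_std_gaussian_inner integral_std_gaussian_inner)
  have ll: "has_bochner_integral std_gaussian (\<lambda>z. (b \<bullet> z) * (b \<bullet> z)) ?A"
    by (simp add: has_bochner_integral_iff integrable_std_gaussian_inner_inner integral_std_gaussian_inner_inner power2_norm_eq_inner)
  have el: "has_bochner_integral std_gaussian (\<lambda>z. ?e b z * (b \<bullet> z)) ?A"
  proof -
    have "has_bochner_integral std_gaussian (\<lambda>z. b \<bullet> (z + b)) (0 + 1 * ?A)"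
      unfolding inner_add_right power2_norm_eq_inner
      by (intro has_bochner_integral_add l) (simp add: has_bochner_integral_iff std_gaussian.prob_space[simplified])
    then show ?thesis
      using integral_std_gaussian_shift[of "\<lambda>z. b \<bullet> z" b] integrable_std_gaussian_shift[of "\<lambda>z. b \<bullet> z" b]
      by (simp add: has_bochner_integral_iff)
  qed
  have eq: "(X z)\<^sup>2 = exp ?A * ?e (2 *\<^sub>R b) z + 1 + (b \<bullet> z) * (b \<bullet> z) - 2 * ?e b z - 2 * (?e b z * (b \<bullet> z)) + 2 * (b \<bullet> z)" for z
  proof -
    have "?e b z * ?e b z = exp ?A * ?e (2 *\<^sub>R b) z"
      unfolding exp_add[symmetric] by (simp add: power_mult_distrib)
    then show ?thesis
      unfolding X_def by (simp add: power2_eq_square algebra_simps)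
  qed
  have "has_bochner_integral std_gaussian (\<lambda>z. (X z)\<^sup>2) (exp ?A * 1 + 1 + ?A - 2 * 1 - 2 * ?A + 2 * 0)"
    unfolding eq
    by (intro has_bochner_integral_add has_bochner_integral_diff has_bochner_integral_mult_right one e l ll el)
  then show "integrable std_gaussian (\<lambda>z. (X z)\<^sup>2)"
    and "(\<integral>z. (X z)\<^sup>2 \<partial>std_gaussian) = exp ?A - 1 - ?A"
    by (simp_all add: has_bochner_integral_iff)
qed

section \<open>The backward heat flow of \<open>e^f\<close>, its logarithmic gradient, and one Euler
  step\<close>

context lipschitz_potential
begin

text \<open>$g_t = P_{1-t}e^f$, its gradient $V_t$, and $v_t=\nabla\log g_t$.\<close>

definition g :: "real \<Rightarrow> 'a \<Rightarrow> real" where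
  "g t y = (\<integral>z. exp (f (y + sqrt (1 - t) *\<^sub>R z)) \<partial>std_gaussian)"

definition V :: "real \<Rightarrow> 'a \<Rightarrow> 'a" where
  "V t y = (\<integral>z. exp (f (y + sqrt (1 - t) *\<^sub>R z)) *\<^sub>R df (y + sqrt (1 - t) *\<^sub>R z) \<partial>std_gaussian)"

definition v :: "real \<Rightarrow> 'a \<Rightarrow> 'a" where
  "v t y = V t y /\<^sub>R g t y"

lemma exp_f_shift_le: "exp (f (y + w)) \<le> exp (f y) * exp (L * norm w)"
  and exp_f_shift_ge: "exp (f (y + w)) \<ge> exp (f y) * exp (- (L * norm w))"
  using f_shift_le[of y w] by (auto simp: exp_add[symmetric])

lemma integrable_exp_f: "integrable std_gaussian (\<lambda>z. exp (f (y + s *\<^sub>R z)))"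
proof (rule integrable_std_gaussian_exp_bound'[of _ "exp (f y)" "L * \<bar>s\<bar>"])
  fix z show "norm (exp (f (y + s *\<^sub>R z))) \<le> exp (f y) * exp (L * \<bar>s\<bar> * norm z)"
    using exp_f_shift_le[of y "s *\<^sub>R z"] by (simp add: mult.assoc)
qed simp

lemma integrable_exp_f_df: "integrable std_gaussian (\<lambda>z. exp (f (y + s *\<^sub>R z)) *\<^sub>R df (y + s *\<^sub>R z))"
proof (rule Bochner_Integration.integrable_bound)
  show "integrable std_gaussian (\<lambda>z. L * exp (f (y + s *\<^sub>R z)))"
    using integrable_exp_f by simp
qed (auto simp: norm_df_le abs_mult L_nonneg)

lemma borel_measurable_g [measurable]: "g t \<in> borel_measurable borel"
  unfolding g_def by measurable

lemma borel_measurable_V [measurable]: "V t \<in> borel_measurable borel"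
  unfolding V_def by measurable

lemma borel_measurable_v [measurable]: "v t \<in> borel_measurable borel"
  unfolding v_def by measurable

text \<open>The constant in \<open>g t y >= exp (f y) * \<kappa>\<close>. It depends only on
  \<open>L\<close> and the dimension, so all ratio estimates below are uniform in \<open>t\<close>
  and \<open>y\<close>.\<close>

definition \<kappa> :: real where "\<kappa> = (\<integral>z. exp (- (L * norm (z::'a))) \<partial>std_gaussian)"

lemma integrable_exp_norm: "integrable std_gaussian (\<lambda>z::'a. exp (B * norm z))"
  by (rule integrable_std_gaussian_exp_bound'[of _ 1 B]) auto

lemma kappa_pos: "\<kappa> > 0"
proof -
  have i: "integrable std_gaussian (\<lambda>z::'a. exp (- (L * norm z)))"
    using integrable_exp_norm[of "- L"] by simp
  have "\<kappa> \<ge> 0" unfolding \<kappa>_def by (rule integral_nonneg_AE) auto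
  moreover have "\<kappa> \<noteq> 0"
  proof
    assume "\<kappa> = 0"
    then have "AE z in (std_gaussian :: 'a measure). exp (- (L * norm z)) = 0"
      unfolding \<kappa>_def using integral_nonneg_eq_0_iff_AE[OF i] by simp
    then have "AE z in (std_gaussian :: 'a measure). False" by simp
    then show False using std_gaussian.AE_False by simp
  qed
  ultimately show ?thesis by simp
qed

lemma g_ge: assumes "0 \<le> t" "t \<le> 1" shows "g t y \<ge> exp (f y) * \<kappa>"
proof -
  have i: "integrable std_gaussian (\<lambda>z::'a. exp (- (L * norm z)))"
    using integrable_exp_norm[of "- L"] by simp
  have "exp (f y) * \<kappa> = (\<integral>z. exp (f y) * exp (- (L * norm (z::'a))) \<partial>std_gaussian)"
    by (simp add: \<kappa>_def)
  also have "\<dots> \<le> g t y" unfolding g_def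
  proof (rule integral_mono)
    fix z :: 'a
    have "sqrt (1 - t) * norm z \<le> 1 * norm z" using assms by (intro mult_right_mono) auto
    then have "L * (sqrt (1 - t) * norm z) \<le> L * norm z" using L_nonneg by (intro mult_left_mono) auto
    then have "exp (f y) * exp (- (L * norm z)) \<le> exp (f y) * exp (- (L * norm (sqrt (1 - t) *\<^sub>R z)))"
      using assms by simp
    also have "\<dots> \<le> exp (f (y + sqrt (1 - t) *\<^sub>R z))" by (rule exp_f_shift_ge)
    finally show "exp (f y) * exp (- (L * norm z)) \<le> exp (f (y + sqrt (1 - t) *\<^sub>R z))" .
  qed (use i integrable_exp_f in auto)
  finally show ?thesis .
qed

lemma g_pos: assumes "0 \<le> t" "t \<le> 1" shows "g t y > 0"
  using g_ge[OF assms, of y] kappa_pos by (smt (verit) exp_gt_zero mult_pos_pos)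

lemma g_nonneg: "g t y \<ge> 0"
  unfolding g_def by (rule integral_nonneg_AE) auto

lemma g_1: "g 1 y = exp (f y)" and V_1: "V 1 y = exp (f y) *\<^sub>R df y"
  by (simp_all add: g_def V_def std_gaussian.prob_space[simplified])

lemma v_1: "v 1 y = df y" by (simp add: v_def g_1 V_1)

lemma V_eq: "0 \<le> t \<Longrightarrow> t \<le> 1 \<Longrightarrow> V t y = g t y *\<^sub>R v t y"
  using g_pos[of t y] by (simp add: v_def)

lemma norm_V_le: "norm (V t y) \<le> L * g t y"
proof -
  have "norm (V t y) \<le> (\<integral>z. norm (exp (f (y + sqrt (1 - t) *\<^sub>R z)) *\<^sub>R df (y + sqrt (1 - t) *\<^sub>R z)) \<partial>std_gaussian)"
    unfolding V_def by (rule integral_norm_bound)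
  also have "\<dots> \<le> (\<integral>z. L * exp (f (y + sqrt (1 - t) *\<^sub>R z)) \<partial>std_gaussian)"
    using integrable_exp_f integrable_exp_f_df by (intro integral_mono integrable_norm) (auto simp: norm_df_le)
  finally show ?thesis by (simp add: g_def)
qed

text \<open>The drift is an average of \<open>df\<close> with positive weights and inherits its
  bound. The case of a vanishing \<open>g\<close> is covered by the convention for division by zero,
  since positivity is available only for times in \<open>[0, 1]\<close>.\<close>

lemma norm_v_le: "norm (v t y) \<le> L"
proof (cases "g t y = 0")
  case True then show ?thesis by (simp add: v_def L_nonneg)
next
  case False
  then have "g t y > 0" using g_nonneg[of t y] by linarith
  then show ?thesis using norm_V_le[of t y] by (simp add: v_def field_simps)
qed

lemma g_shift_le: "g t (y + w) \<le> g t y * exp (L * norm w)"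
proof -
  have "g t (y + w) \<le> (\<integral>z. exp (f (y + sqrt (1 - t) *\<^sub>R z)) * exp (L * norm w) \<partial>std_gaussian)"
    unfolding g_def
  proof (rule integral_mono)
    fix z
    show "exp (f (y + w + sqrt (1 - t) *\<^sub>R z)) \<le> exp (f (y + sqrt (1 - t) *\<^sub>R z)) * exp (L * norm w)"
      using exp_f_shift_le[of "y + sqrt (1 - t) *\<^sub>R z" w] by (simp add: add_ac)
  qed (use integrable_exp_f in auto)
  then show ?thesis by (simp add: g_def)
qed

lemma g_shift_diff: "\<bar>g t (y + w) - g t y\<bar> \<le> g t y * (L * norm w * exp (L * norm w))"
proof -
  have 1: "g t (y + w) \<le> g t y * exp (L * norm w)" by (rule g_shift_le)
  have "g t y \<le> g t (y + w) * exp (L * norm w)" using g_shift_le[of t "y + w" "- w"] by simp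
  then have "g t y * exp (- (L * norm w)) \<le> g t (y + w)" by (simp add: exp_minus field_simps)
  moreover have "exp (L * norm w) - 1 \<le> L * norm w * exp (L * norm w)"
    using abs_exp_minus_1_le[of "L * norm w"] L_nonneg by simp
  then have "g t y * (exp (L * norm w) - 1) \<le> g t y * (L * norm w * exp (L * norm w))"
    by (rule mult_left_mono) (rule g_nonneg)
  moreover have "1 - exp (- (L * norm w)) \<le> L * norm w * exp (L * norm w)"
  proof -
    have "1 - exp (- (L * norm w)) \<le> L * norm w * 1" using exp_ge_add_one_self[of "- (L * norm w)"] by simp
    also have "\<dots> \<le> L * norm w * exp (L * norm w)" using L_nonneg by (intro mult_left_mono) auto
    finally show ?thesis .
  qed
  then have "g t y * (1 - exp (- (L * norm w))) \<le> g t y * (L * norm w * exp (L * norm w))"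
    by (rule mult_left_mono) (rule g_nonneg)
  ultimately show ?thesis using 1 by (simp add: algebra_simps)
qed

lemma integrable_g_shift: "integrable std_gaussian (\<lambda>z. g t (y + s *\<^sub>R z))"
proof (rule integrable_std_gaussian_exp_bound'[of _ "g t y" "L * \<bar>s\<bar>"])
  fix z show "norm (g t (y + s *\<^sub>R z)) \<le> g t y * exp (L * \<bar>s\<bar> * norm z)"
    using g_shift_le[of t y "s *\<^sub>R z"] g_nonneg[of t] by (simp add: mult.assoc)
qed simp

text \<open>The variances \<open>h\<close> and \<open>1 - t - h\<close> add up to
  \<open>1 - t\<close>. Hence \<open>g\<close>, and likewise \<open>V\<close>, is a martingale along
  Gaussian increments; this makes \<open>rho\<close> a probability density and later makes
  \<open>v\<close> a martingale of the tilted chain.\<close>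

lemma integral_g_shift:
  assumes "0 \<le> h" "t + h \<le> 1"
  shows "(\<integral>z. g (t + h) (y + sqrt h *\<^sub>R z) \<partial>std_gaussian) = g t y"
proof -
  have m: "(\<lambda>w. exp (f (y + w))) \<in> borel_measurable borel" by measurable
  have i: "integrable std_gaussian (\<lambda>z. exp (f (y + sqrt (h + (1 - (t + h))) *\<^sub>R z)))" by (rule integrable_exp_f)
  show ?thesis
    using integral_std_gaussian_add[OF m assms(1) _ i] assms(2) by (simp add: g_def add.assoc)
qed

lemma integral_V_shift:
  assumes "0 \<le> h" "t + h \<le> 1"
  shows "(\<integral>z. V (t + h) (y + sqrt h *\<^sub>R z) \<partial>std_gaussian) = V t y"
proof -
  have m: "(\<lambda>w. exp (f (y + w)) *\<^sub>R df (y + w)) \<in> borel_measurable borel" by measurable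
  have i: "integrable std_gaussian (\<lambda>z. exp (f (y + sqrt (h + (1 - (t + h))) *\<^sub>R z)) *\<^sub>R df (y + sqrt (h + (1 - (t + h))) *\<^sub>R z))"
    by (rule integrable_exp_f_df)
  show ?thesis
    using integral_std_gaussian_add[OF m assms(1) _ i] assms(2) by (simp add: V_def add.assoc)
qed

lemma integrable_V_shift: "integrable std_gaussian (\<lambda>z. V t (y + s *\<^sub>R z))"
proof (rule Bochner_Integration.integrable_bound)
  show "integrable std_gaussian (\<lambda>z. L * g t (y + s *\<^sub>R z))" using integrable_g_shift by simp
qed (auto simp: L_nonneg g_nonneg abs_mult norm_V_le)

text \<open>The likelihood ratio of a step of the tilted chain, with transition density
  $g_{t+h}(y')/g_t(y)$ relative to the Gaussian of variance $h$ around $y$, against the Euler step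
  $y' = y + h\,v_t(y) + \sqrt h\,z$.\<close>

definition wt :: "real \<Rightarrow> real \<Rightarrow> 'a \<Rightarrow> 'a \<Rightarrow> real" where
  "wt t h y z = g (t + h) (y + h *\<^sub>R v t y + sqrt h *\<^sub>R z) / g t y *
     exp (- (sqrt h * (v t y \<bullet> z)) - h * (norm (v t y))\<^sup>2 / 2)"

text \<open>The Doob transform of the driftless Gaussian step by \<open>g\<close>. Its counterpart
  \<open>tilt\<close> is the Cameron-Martin density of the Euler step, and \<open>wt\<close> is the
  quotient of the two read at the shifted noise (\<open>wt_eq\<close>).\<close>

definition rho :: "real \<Rightarrow> real \<Rightarrow> 'a \<Rightarrow> 'a \<Rightarrow> real" where
  "rho t h y z = g (t + h) (y + sqrt h *\<^sub>R z) / g t y"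

definition tilt :: "real \<Rightarrow> real \<Rightarrow> 'a \<Rightarrow> 'a \<Rightarrow> real" where
  "tilt t h y z = exp (sqrt h * (v t y \<bullet> z) - h * (norm (v t y))\<^sup>2 / 2)"

lemma borel_measurable_wt [measurable]: "(\<lambda>(y, z). wt t h y z) \<in> borel_measurable (borel \<Otimes>\<^sub>M borel)"
  unfolding wt_def by measurable

lemma borel_measurable_rho [measurable]: "(\<lambda>(y, z). rho t h y z) \<in> borel_measurable (borel \<Otimes>\<^sub>M borel)"
  unfolding rho_def by measurable

lemma borel_measurable_tilt [measurable]: "(\<lambda>(y, z). tilt t h y z) \<in> borel_measurable (borel \<Otimes>\<^sub>M borel)"
  unfolding tilt_def by measurable

lemma wt_nonneg: "wt t h y z \<ge> 0"
  unfolding wt_def using g_nonneg by simp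

lemma rho_nonneg: "rho t h y z \<ge> 0"
  unfolding rho_def using g_nonneg by simp

lemma y_shift: "h \<ge> 0 \<Longrightarrow> y + sqrt h *\<^sub>R (z + sqrt h *\<^sub>R v t y) = y + h *\<^sub>R v t y + sqrt h *\<^sub>R z"
  by (simp add: scaleR_add_right)

lemma wt_eq:
  assumes h: "h \<ge> 0"
  shows "wt t h y z = rho t h y (z + sqrt h *\<^sub>R v t y) / tilt t h y (z + sqrt h *\<^sub>R v t y)"
proof -
  have "sqrt h * (v t y \<bullet> (z + sqrt h *\<^sub>R v t y)) - h * (norm (v t y))\<^sup>2 / 2
      = - (- (sqrt h * (v t y \<bullet> z)) - h * (norm (v t y))\<^sup>2 / 2)"
    using h by (simp add: inner_add_right distrib_left power2_norm_eq_inner mult.assoc[symmetric])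
  then have "tilt t h y (z + sqrt h *\<^sub>R v t y) = inverse (exp (- (sqrt h * (v t y \<bullet> z)) - h * (norm (v t y))\<^sup>2 / 2))"
    unfolding tilt_def by (simp only: exp_minus)
  then show ?thesis unfolding wt_def rho_def y_shift[OF h] by (simp only: divide_inverse inverse_inverse_eq mult_ac)
qed

lemma tilt_eq: "h \<ge> 0 \<Longrightarrow> tilt t h y z = exp ((sqrt h *\<^sub>R v t y) \<bullet> z - (norm (sqrt h *\<^sub>R v t y))\<^sup>2 / 2)"
  by (simp add: tilt_def power_mult_distrib)

lemma tilt_pos: "tilt t h y z > 0" by (simp add: tilt_def)

text \<open>Translating the noise by \<open>sqrt h * v\<close> produces the factor
  \<open>tilt\<close>, which cancels the denominator of \<open>wt\<close>. So the weighted Euler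
  step is exactly the tilted transition, for every step size.\<close>

lemma nn_integral_wt:
  assumes h: "h \<ge> 0" and [measurable]: "\<phi> \<in> borel_measurable borel"
  shows "(\<integral>\<^sup>+z. ennreal (wt t h y z) * \<phi> (y + h *\<^sub>R v t y + sqrt h *\<^sub>R z) \<partial>std_gaussian) =
     (\<integral>\<^sup>+z. ennreal (rho t h y z) * \<phi> (y + sqrt h *\<^sub>R z) \<partial>std_gaussian)"
proof -
  let ?F = "\<lambda>z. ennreal (rho t h y z / tilt t h y z) * \<phi> (y + sqrt h *\<^sub>R z)"
  let ?a = "sqrt h *\<^sub>R v t y"
  have "(\<integral>\<^sup>+z. ennreal (wt t h y z) * \<phi> (y + h *\<^sub>R v t y + sqrt h *\<^sub>R z) \<partial>std_gaussian) = (\<integral>\<^sup>+z. ?F (z + ?a) \<partial>std_gaussian)"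
    by (simp only: wt_eq[OF h] y_shift[OF h])
  also have "\<dots> = (\<integral>\<^sup>+z. ennreal (exp (?a \<bullet> z - (norm ?a)\<^sup>2 / 2)) * ?F z \<partial>std_gaussian)"
    by (rule nn_integral_std_gaussian_shift) measurable
  also have "\<dots> = (\<integral>\<^sup>+z. ennreal (rho t h y z) * \<phi> (y + sqrt h *\<^sub>R z) \<partial>std_gaussian)"
  proof (rule nn_integral_cong)
    fix z
    have "ennreal (tilt t h y z) * ennreal (rho t h y z / tilt t h y z) = ennreal (rho t h y z)"
      using tilt_pos[of t h y z] rho_nonneg[of t h y z] by (subst ennreal_mult[symmetric]) auto
    then show "ennreal (exp (?a \<bullet> z - (norm ?a)\<^sup>2 / 2)) * ?F z = ennreal (rho t h y z) * \<phi> (y + sqrt h *\<^sub>R z)"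
      unfolding tilt_eq[OF h, symmetric] by (simp only: mult.assoc[symmetric])
  qed
  finally show ?thesis .
qed

lemma
  fixes \<phi> :: "'a \<Rightarrow> 'b::{banach, second_countable_topology}"
  assumes h: "h \<ge> 0" and [measurable]: "\<phi> \<in> borel_measurable borel"
  shows integral_wt: "(\<integral>z. wt t h y z *\<^sub>R \<phi> (y + h *\<^sub>R v t y + sqrt h *\<^sub>R z) \<partial>std_gaussian) =
     (\<integral>z. rho t h y z *\<^sub>R \<phi> (y + sqrt h *\<^sub>R z) \<partial>std_gaussian)"
    and integrable_wt: "integrable std_gaussian (\<lambda>z. wt t h y z *\<^sub>R \<phi> (y + h *\<^sub>R v t y + sqrt h *\<^sub>R z)) \<longleftrightarrow>
     integrable std_gaussian (\<lambda>z. rho t h y z *\<^sub>R \<phi> (y + sqrt h *\<^sub>R z))"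
proof -
  let ?F = "\<lambda>z. (rho t h y z / tilt t h y z) *\<^sub>R \<phi> (y + sqrt h *\<^sub>R z)"
  let ?a = "sqrt h *\<^sub>R v t y"
  have 1: "wt t h y z *\<^sub>R \<phi> (y + h *\<^sub>R v t y + sqrt h *\<^sub>R z) = ?F (z + ?a)" for z
    by (simp only: wt_eq[OF h] y_shift[OF h])
  have 2: "exp (?a \<bullet> z - (norm ?a)\<^sup>2 / 2) *\<^sub>R ?F z = rho t h y z *\<^sub>R \<phi> (y + sqrt h *\<^sub>R z)" for z
    unfolding tilt_eq[OF h, symmetric] using tilt_pos[of t h y z] by simp
  have m: "?F \<in> borel_measurable borel" by measurable
  show "(\<integral>z. wt t h y z *\<^sub>R \<phi> (y + h *\<^sub>R v t y + sqrt h *\<^sub>R z) \<partial>std_gaussian) =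
     (\<integral>z. rho t h y z *\<^sub>R \<phi> (y + sqrt h *\<^sub>R z) \<partial>std_gaussian)"
    unfolding 1 integral_std_gaussian_shift[OF m] 2 ..
  show "integrable std_gaussian (\<lambda>z. wt t h y z *\<^sub>R \<phi> (y + h *\<^sub>R v t y + sqrt h *\<^sub>R z)) \<longleftrightarrow>
     integrable std_gaussian (\<lambda>z. rho t h y z *\<^sub>R \<phi> (y + sqrt h *\<^sub>R z))"
    unfolding 1 integrable_std_gaussian_shift[OF m] 2 ..
qed

lemma integral_rho:
  assumes "0 \<le> t" "0 \<le> h" "t + h \<le> 1"
  shows "(\<integral>z. rho t h y z \<partial>std_gaussian) = 1" "integrable std_gaussian (rho t h y)"
  using integral_g_shift[of h t y] g_pos[of t y] assms integrable_g_shift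
  unfolding rho_def by (simp_all add: rho_def[abs_def])

lemma integral_tilt:
  assumes "0 \<le> h"
  shows "(\<integral>z. tilt t h y z \<partial>std_gaussian) = 1" "integrable std_gaussian (tilt t h y)"
proof -
  have e: "tilt t h y = (\<lambda>z. exp ((sqrt h *\<^sub>R v t y) \<bullet> z - (norm (sqrt h *\<^sub>R v t y))\<^sup>2 / 2))"
    using tilt_eq[OF assms] by blast
  show "(\<integral>z. tilt t h y z \<partial>std_gaussian) = 1" "integrable std_gaussian (tilt t h y)"
    using integral_std_gaussian_shift[of "\<lambda>_. 1::real" "sqrt h *\<^sub>R v t y"]
      integrable_std_gaussian_shift[of "\<lambda>_. 1::real" "sqrt h *\<^sub>R v t y"]
    unfolding e by (simp_all add: std_gaussian.prob_space[simplified] del: norm_scaleR inner_scaleR_left)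
qed

lemma integral_wt_1:
  assumes "0 \<le> t" "0 \<le> h" "t + h \<le> 1"
  shows "(\<integral>z. wt t h y z \<partial>std_gaussian) = 1" "integrable std_gaussian (wt t h y)"
  using integral_wt[OF assms(2), of "\<lambda>_. 1::real" t y] integrable_wt[OF assms(2), of "\<lambda>_. 1::real" t y] integral_rho[OF assms]
  by simp_all

text \<open>Since \<open>g * v = V\<close>, weighting \<open>v\<close> by the transition density
  leaves an average of \<open>V\<close>, to which the semigroup identity applies. This is the
  martingale property of the drift.\<close>

lemma integral_wt_v:
  assumes "0 \<le> t" "0 \<le> h" "t + h \<le> 1"
  shows "(\<integral>z. wt t h y z *\<^sub>R v (t + h) (y + h *\<^sub>R v t y + sqrt h *\<^sub>R z) \<partial>std_gaussian) = v t y"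
    and "integrable std_gaussian (\<lambda>z. wt t h y z *\<^sub>R v (t + h) (y + h *\<^sub>R v t y + sqrt h *\<^sub>R z))"
proof -
  have e: "rho t h y z *\<^sub>R v (t + h) (y + sqrt h *\<^sub>R z) = V (t + h) (y + sqrt h *\<^sub>R z) /\<^sub>R g t y" for z
    using V_eq[of "t + h" "y + sqrt h *\<^sub>R z"] assms by (simp add: rho_def divide_inverse_commute)
  show "(\<integral>z. wt t h y z *\<^sub>R v (t + h) (y + h *\<^sub>R v t y + sqrt h *\<^sub>R z) \<partial>std_gaussian) = v t y"
    unfolding integral_wt[OF assms(2) borel_measurable_v] e
    using integral_V_shift[OF assms(2,3), of y] by (simp add: v_def)
  show "integrable std_gaussian (\<lambda>z. wt t h y z *\<^sub>R v (t + h) (y + h *\<^sub>R v t y + sqrt h *\<^sub>R z))"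
    unfolding integrable_wt[OF assms(2) borel_measurable_v] e
    using integrable_V_shift by simp
qed

section \<open>Second moment of the one-step likelihood ratio\<close>

lemma abs_log_tilt_le:
  assumes "0 \<le> h" "h \<le> 1"
  shows "\<bar>sqrt h * (v t y \<bullet> z) - h * (norm (v t y))\<^sup>2 / 2\<bar> \<le> sqrt h * (L * norm z + L\<^sup>2)"
proof -
  have "\<bar>v t y \<bullet> z\<bar> \<le> norm (v t y) * norm z" by (rule Cauchy_Schwarz_ineq2)
  also have "\<dots> \<le> L * norm z" by (intro mult_right_mono norm_v_le) simp
  finally have 1: "\<bar>sqrt h * (v t y \<bullet> z)\<bar> \<le> sqrt h * (L * norm z)"
    unfolding abs_mult using assms by (intro mult_mono) auto
  have "(norm (v t y))\<^sup>2 \<le> L\<^sup>2" by (intro power_mono norm_v_le) simp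
  moreover have "h \<le> sqrt h"
  proof (rule real_le_rsqrt)
    show "h\<^sup>2 \<le> h" using assms mult_left_mono[of h 1 h] by (simp add: power2_eq_square)
  qed
  ultimately have "h * (norm (v t y))\<^sup>2 \<le> sqrt h * L\<^sup>2" using assms by (intro mult_mono) auto
  moreover have "0 \<le> h * (norm (v t y))\<^sup>2" using assms by simp
  ultimately show ?thesis using 1 unfolding distrib_left by linarith
qed

lemma tilt_ge:
  assumes "0 \<le> h" "h \<le> 1"
  shows "inverse (tilt t h y z) \<le> exp (L * norm z + L\<^sup>2)"
proof -
  have 0: "0 \<le> L * norm z + L\<^sup>2" using L_nonneg by simp
  have "sqrt h * (L * norm z + L\<^sup>2) \<le> L * norm z + L\<^sup>2"
    using assms mult_right_mono[of "sqrt h" 1 "L * norm z + L\<^sup>2"] 0 by simp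
  then show ?thesis using abs_log_tilt_le[OF assms, of t y z]
    unfolding tilt_def exp_minus[symmetric] by simp
qed

text \<open>The second moment of \<open>wt\<close> is the integral of \<open>rho^2 / tilt\<close>,
  which exceeds 1 by the chi-square distance of the two densities. The error therefore enters
  squared. The exponent \<open>1/16\<close> in the hypothesis becomes the admissible
  \<open>1/8\<close> on squaring.\<close>

lemma nn_integral_wt_sq_le:
  assumes t: "0 \<le> t" "0 \<le> h" "h \<le> 1" "t + h \<le> 1"
    and B: "\<And>z. \<bar>rho t h y z - tilt t h y z\<bar> \<le> \<delta> * exp (B * norm z + (norm z)\<^sup>2 / 16)" and \<delta>: "\<delta> \<ge> 0"
  shows "(\<integral>\<^sup>+z. ennreal ((wt t h y z)\<^sup>2) \<partial>std_gaussian) \<le>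
    ennreal (1 + \<delta>\<^sup>2 * (exp (L\<^sup>2) * (\<integral>z. exp ((2 * B + L) * norm (z::'a) + (norm z)\<^sup>2 / 8) \<partial>std_gaussian)))"
proof -
  define E where "E z = exp ((2 * B + L) * norm z + (norm z)\<^sup>2 / 8)" for z :: 'a
  have Ei: "integrable std_gaussian E"
    unfolding E_def by (rule integrable_std_gaussian_exp_bound[of _ 1 "2 * B + L"]) auto
  let ?F = "\<lambda>z. (rho t h y z - tilt t h y z)\<^sup>2 / tilt t h y z"
  have Fb: "?F z \<le> \<delta>\<^sup>2 * exp (L\<^sup>2) * E z" for z
  proof -
    have "(rho t h y z - tilt t h y z)\<^sup>2 = \<bar>rho t h y z - tilt t h y z\<bar>\<^sup>2" by simp
    also have "\<dots> \<le> (\<delta> * exp (B * norm z + (norm z)\<^sup>2 / 16))\<^sup>2" by (intro power_mono B) simp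
    also have "\<dots> = \<delta>\<^sup>2 * exp (2 * B * norm z + (norm z)\<^sup>2 / 8)"
      by (simp add: power_mult_distrib exp_double[symmetric] distrib_left)
    finally have "?F z \<le> (\<delta>\<^sup>2 * exp (2 * B * norm z + (norm z)\<^sup>2 / 8)) * exp (L * norm z + L\<^sup>2)"
      unfolding divide_inverse using tilt_ge[OF t(2,3), of t y z] tilt_pos[of t h y z] \<delta>
      by (intro mult_mono) auto
    also have "\<dots> = \<delta>\<^sup>2 * exp ((2 * B * norm z + (norm z)\<^sup>2 / 8) + (L * norm z + L\<^sup>2))"
      by (simp only: exp_add mult.assoc)
    also have "(2 * B * norm z + (norm z)\<^sup>2 / 8) + (L * norm z + L\<^sup>2) = L\<^sup>2 + ((2 * B + L) * norm z + (norm z)\<^sup>2 / 8)"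
      by (simp add: algebra_simps)
    also have "\<delta>\<^sup>2 * exp \<dots> = \<delta>\<^sup>2 * exp (L\<^sup>2) * E z"
      unfolding E_def exp_add[of "L\<^sup>2"] by (simp only: mult.assoc)
    finally show ?thesis .
  qed
  have F0: "?F z \<ge> 0" for z using tilt_pos[of t h y z] by simp
  have m: "(\<lambda>z. rho t h y z) \<in> borel_measurable borel" "(\<lambda>z. tilt t h y z) \<in> borel_measurable borel" by measurable
  have Fi: "integrable std_gaussian ?F"
  proof (rule Bochner_Integration.integrable_bound)
    show "integrable std_gaussian (\<lambda>z. \<delta>\<^sup>2 * exp (L\<^sup>2) * E z)" using Ei by simp
    show "AE z in std_gaussian. norm (?F z) \<le> norm (\<delta>\<^sup>2 * exp (L\<^sup>2) * E z)"
      using order_trans[OF Fb abs_ge_self] F0 by (intro AE_I2) (simp only: real_norm_def abs_of_nonneg[OF F0])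
  qed (use m in measurable)
  \<comment> \<open>Both densities have mass one, so the last two terms contribute
    \<open>2 - 1\<close> after integration.\<close>
  have eq: "(rho t h y z)\<^sup>2 / tilt t h y z = ?F z + 2 * rho t h y z - tilt t h y z" for z
    using tilt_pos[of t h y z] by (simp add: field_simps power2_eq_square)
  have r: "integrable std_gaussian (\<lambda>z. 2 * rho t h y z)" using integral_rho[OF t(1,2,4)] by simp
  have Ri: "integrable std_gaussian (\<lambda>z. (rho t h y z)\<^sup>2 / tilt t h y z)"
    unfolding eq using Fi r integral_tilt[OF t(2)] by (intro Bochner_Integration.integrable_diff Bochner_Integration.integrable_add) auto
  have "(\<integral>\<^sup>+z. ennreal ((wt t h y z)\<^sup>2) \<partial>std_gaussian) =
      (\<integral>\<^sup>+z. (\<lambda>w. ennreal ((rho t h y w / tilt t h y w)\<^sup>2)) (z + sqrt h *\<^sub>R v t y) \<partial>std_gaussian)"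
    by (simp only: wt_eq[OF t(2)])
  also have "\<dots> = (\<integral>\<^sup>+z. ennreal (tilt t h y z) * ennreal ((rho t h y z / tilt t h y z)\<^sup>2) \<partial>std_gaussian)"
    by (subst nn_integral_std_gaussian_shift) (use m tilt_eq[OF t(2)] in \<open>auto simp del: norm_scaleR inner_scaleR_left\<close>)
  also have "\<dots> = (\<integral>\<^sup>+z. ennreal ((rho t h y z)\<^sup>2 / tilt t h y z) \<partial>std_gaussian)"
  proof (rule nn_integral_cong)
    fix z
    show "ennreal (tilt t h y z) * ennreal ((rho t h y z / tilt t h y z)\<^sup>2) = ennreal ((rho t h y z)\<^sup>2 / tilt t h y z)"
      using tilt_pos[of t h y z] by (subst ennreal_mult[symmetric]) (auto simp: power2_eq_square)
  qed
  also have "\<dots> = ennreal (\<integral>z. (rho t h y z)\<^sup>2 / tilt t h y z \<partial>std_gaussian)"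
    using tilt_pos[of t h y] by (intro nn_integral_eq_integral Ri) (auto simp: less_imp_le)
  also have "(\<integral>z. (rho t h y z)\<^sup>2 / tilt t h y z \<partial>std_gaussian) = (\<integral>z. ?F z \<partial>std_gaussian) + 2 * 1 - 1"
    unfolding eq
    by (intro has_bochner_integral_integral_eq has_bochner_integral_add has_bochner_integral_diff has_bochner_integral_mult_right)
      (use Fi integral_rho[OF t(1,2,4)] integral_tilt[OF t(2)] in \<open>auto simp: has_bochner_integral_iff\<close>)
  also have "(\<integral>z. ?F z \<partial>std_gaussian) \<le> (\<integral>z. \<delta>\<^sup>2 * exp (L\<^sup>2) * E z \<partial>std_gaussian)"
    using Fi Ei Fb by (intro integral_mono) auto
  finally show ?thesis by (simp add: E_def[abs_def] ennreal_leI mult.assoc)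
qed

lemma integrable_norm_exp_norm: "integrable std_gaussian (\<lambda>z::'a. norm z * exp (L * norm z))"
proof (rule integrable_std_gaussian_exp_bound'[of _ 1 "L + 1"])
  fix z :: 'a
  have "norm z * exp (L * norm z) \<le> exp (norm z) * exp (L * norm z)" by (intro mult_right_mono le_exp_self) simp
  also have "\<dots> = exp ((L + 1) * norm z)" by (simp add: exp_add[symmetric] distrib_right add.commute)
  finally show "norm (norm z * exp (L * norm z)) \<le> 1 * exp ((L + 1) * norm z)" by simp
qed simp

text \<open>The Lipschitz bound alone puts \<open>rho\<close> and \<open>tilt\<close> within
  \<open>O(sqrt h)\<close> of 1, uniformly in \<open>t\<close> and \<open>y\<close>, hence a
  chi-square of order \<open>h\<close>. Over a whole chain this sums to a constant, so it serves
  only for the steps near time 1, where the remaining variance is too small for a finer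
  estimate.\<close>

lemma chi_square_crude:
  obtains C where "C \<ge> 0"
    "\<And>t h y. 0 \<le> t \<Longrightarrow> 0 \<le> h \<Longrightarrow> t + h \<le> 1 \<Longrightarrow> (\<integral>\<^sup>+z. ennreal ((wt t h y z)\<^sup>2) \<partial>std_gaussian) \<le> ennreal (1 + C * h)"
proof -
  define c1 where "c1 = (\<integral>z. norm (z::'a) * exp (L * norm z) \<partial>std_gaussian)"
  have c1: "c1 \<ge> 0" unfolding c1_def by (rule integral_nonneg_AE) auto
  define C1 where "C1 = L / \<kappa> * (1 + c1)"
  define C2 where "C2 = (L + L\<^sup>2) * exp (L\<^sup>2)"
  define B where "B = L + 1"
  have C: "C1 \<ge> 0" "C2 \<ge> 0" using L_nonneg kappa_pos c1 by (auto simp: C1_def C2_def)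
  define I where "I = exp (L\<^sup>2) * (\<integral>z. exp ((2 * B + L) * norm (z::'a) + (norm z)\<^sup>2 / 8) \<partial>std_gaussian)"
  have I: "I \<ge> 0" unfolding I_def by (intro mult_nonneg_nonneg integral_nonneg_AE) auto
  show ?thesis
  proof (rule that[of "(C1 + C2)\<^sup>2 * I"])
    show "0 \<le> (C1 + C2)\<^sup>2 * I" using I by simp
    fix t h :: real and y :: 'a
    assume t: "0 \<le> t" "0 \<le> h" "t + h \<le> 1"
    then have h1: "h \<le> 1" and t1: "t \<le> 1" by auto
    let ?m = "g (t + h) y"
    have m0: "?m \<ge> 0" by (rule g_nonneg)
    have gt: "g t y > 0" using g_pos t t1 by simp
    \<comment> \<open>The reference value is \<open>g (t + h)\<close> at the unshifted point;
      averaging the lower Lipschitz bound compares it with \<open>g t y\<close>.\<close>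
    have mk: "?m * \<kappa> \<le> g t y"
    proof -
      have i: "integrable std_gaussian (\<lambda>z::'a. ?m * exp (- (L * norm z)))"
        using integrable_exp_norm[of "- L"] by simp
      have "?m * \<kappa> = (\<integral>z. ?m * exp (- (L * norm (z::'a))) \<partial>std_gaussian)" by (simp add: \<kappa>_def)
      also have "\<dots> \<le> (\<integral>z. g (t + h) (y + sqrt h *\<^sub>R z) \<partial>std_gaussian)"
      proof (rule integral_mono[OF i integrable_g_shift])
        fix z :: 'a
        let ?w = "sqrt h *\<^sub>R z"
        have "sqrt h * norm z \<le> 1 * norm z" using t h1 by (intro mult_right_mono) auto
        then have "L * norm ?w \<le> L * norm z" using L_nonneg t by (intro mult_left_mono) auto
        then have "exp (- (L * norm z)) \<le> exp (- (L * norm ?w))" by simp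
        then have "?m * exp (- (L * norm z)) \<le> ?m * exp (- (L * norm ?w))" using m0 by (rule mult_left_mono)
        also have "?m \<le> g (t + h) (y + ?w) * exp (L * norm ?w)" using g_shift_le[of "t + h" "y + ?w" "- ?w"] by simp
        then have "?m * exp (- (L * norm ?w)) \<le> g (t + h) (y + ?w)" by (simp add: exp_minus field_simps)
        finally show "?m * exp (- (L * norm z)) \<le> g (t + h) (y + ?w)" .
      qed
      finally show ?thesis using integral_g_shift[of h t y] t by simp
    qed
    have mg: "?m / g t y \<le> 1 / \<kappa>" using mk gt kappa_pos by (simp add: field_simps)
    have db: "\<bar>g (t + h) (y + sqrt h *\<^sub>R z) - ?m\<bar> \<le> ?m * (L * sqrt h * (norm z * exp (L * norm z)))" for z
    proof -
      have "sqrt h * norm z \<le> 1 * norm z" using t h1 by (intro mult_right_mono) auto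
      then have 1: "L * norm (sqrt h *\<^sub>R z) \<le> L * norm z" using L_nonneg t by (intro mult_left_mono) auto
      have "\<bar>g (t + h) (y + sqrt h *\<^sub>R z) - ?m\<bar> \<le> ?m * (L * norm (sqrt h *\<^sub>R z) * exp (L * norm (sqrt h *\<^sub>R z)))"
        by (rule g_shift_diff)
      also have "\<dots> \<le> ?m * (L * norm (sqrt h *\<^sub>R z) * exp (L * norm z))"
        using 1 m0 L_nonneg by (intro mult_left_mono) auto
      finally show ?thesis using t by (simp add: mult_ac)
    qed
    have gm: "\<bar>g t y - ?m\<bar> \<le> ?m * (L * sqrt h * c1)"
    proof -
      have "g t y - ?m = (\<integral>z. g (t + h) (y + sqrt h *\<^sub>R z) - ?m \<partial>std_gaussian)"
        using integral_g_shift[of h t y] t integrable_g_shift by (simp add: std_gaussian.prob_space[simplified])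
      then have "\<bar>g t y - ?m\<bar> \<le> (\<integral>z. \<bar>g (t + h) (y + sqrt h *\<^sub>R z) - ?m\<bar> \<partial>std_gaussian)"
        by (simp add: integral_abs_bound)
      also have "\<dots> \<le> (\<integral>z. ?m * (L * sqrt h * (norm (z::'a) * exp (L * norm z))) \<partial>std_gaussian)"
        using integrable_norm_exp_norm db integrable_g_shift by (intro integral_mono) auto
      also have "\<dots> = ?m * (L * sqrt h * c1)" by (simp add: c1_def)
      finally show ?thesis .
    qed
    have rb: "\<bar>rho t h y z - 1\<bar> \<le> sqrt h * C1 * exp (B * norm z)" for z
    proof -
      have "rho t h y z - 1 = (g (t + h) (y + sqrt h *\<^sub>R z) - g t y) / g t y" using gt by (simp add: rho_def field_simps)
      then have "\<bar>rho t h y z - 1\<bar> = \<bar>g (t + h) (y + sqrt h *\<^sub>R z) - g t y\<bar> / g t y" using gt by simp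
      also have "\<dots> \<le> (?m * (L * sqrt h * (norm z * exp (L * norm z) + c1))) / g t y"
        using db[of z] gm gt by (intro divide_right_mono) (auto simp: distrib_left)
      also have "\<dots> = (?m / g t y) * (L * sqrt h * (norm z * exp (L * norm z) + c1))" by simp
      also have "\<dots> \<le> 1 / \<kappa> * (L * sqrt h * (norm z * exp (L * norm z) + c1))"
        using L_nonneg t c1 by (intro mult_right_mono mg) auto
      also have "1 / \<kappa> * (L * sqrt h * (norm z * exp (L * norm z) + c1)) \<le> 1 / \<kappa> * (L * sqrt h * ((1 + c1) * exp (B * norm z)))"
      proof (intro mult_left_mono)
        have "norm z * exp (L * norm z) \<le> exp (norm z) * exp (L * norm z)" by (intro mult_right_mono le_exp_self) simp
        also have "\<dots> = exp (B * norm z)" by (simp add: B_def exp_add[symmetric] distrib_right add.commute)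
        finally have "norm z * exp (L * norm z) \<le> exp (B * norm z)" .
        moreover have "c1 * 1 \<le> c1 * exp (B * norm z)" using c1 L_nonneg by (intro mult_left_mono) (auto simp: B_def)
        ultimately show "norm z * exp (L * norm z) + c1 \<le> (1 + c1) * exp (B * norm z)" by (simp add: distrib_right)
      qed (use L_nonneg kappa_pos t in auto)
      finally show ?thesis by (simp add: C1_def mult_ac)
    qed
    have qb: "\<bar>tilt t h y z - 1\<bar> \<le> sqrt h * C2 * exp (B * norm z)" for z
    proof -
      let ?w = "sqrt h * (v t y \<bullet> z) - h * (norm (v t y))\<^sup>2 / 2"
      have w1: "\<bar>?w\<bar> \<le> sqrt h * (L * norm z + L\<^sup>2)" using abs_log_tilt_le t h1 by blast
      have "0 \<le> L * norm z + L\<^sup>2" using L_nonneg by simp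
      then have w2: "\<bar>?w\<bar> \<le> L * norm z + L\<^sup>2"
        using w1 mult_right_mono[of "sqrt h" 1 "L * norm z + L\<^sup>2"] h1 by simp
      have "\<bar>tilt t h y z - 1\<bar> \<le> \<bar>?w\<bar> * exp \<bar>?w\<bar>" unfolding tilt_def by (rule abs_exp_minus_1_le)
      also have "\<dots> \<le> (sqrt h * (L * norm z + L\<^sup>2)) * exp (L * norm z + L\<^sup>2)"
        using w1 w2 t L_nonneg by (intro mult_mono) auto
      also have "L * norm z + L\<^sup>2 * 1 \<le> L * exp (norm z) + L\<^sup>2 * exp (norm z)"
        using L_nonneg by (intro add_mono mult_left_mono le_exp_self) auto
      then have "(sqrt h * (L * norm z + L\<^sup>2)) * exp (L * norm z + L\<^sup>2) \<le> (sqrt h * ((L + L\<^sup>2) * exp (norm z))) * exp (L * norm z + L\<^sup>2)"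
        using t by (intro mult_right_mono mult_left_mono) (auto simp: distrib_right)
      also have "\<dots> = sqrt h * C2 * exp (B * norm z)"
      proof -
        have "exp (B * norm z) = exp (norm z) * exp (L * norm z)"
          by (simp add: B_def exp_add[symmetric] distrib_right add.commute)
        then show ?thesis by (simp only: C2_def exp_add mult_ac)
      qed
      finally show ?thesis .
    qed
    have "(\<integral>\<^sup>+z. ennreal ((wt t h y z)\<^sup>2) \<partial>std_gaussian) \<le> ennreal (1 + (sqrt h * (C1 + C2))\<^sup>2 * I)"
      unfolding I_def
    proof (rule nn_integral_wt_sq_le[OF t(1,2) h1 t(3)])
      fix z :: 'a
      have "\<bar>rho t h y z - tilt t h y z\<bar> \<le> sqrt h * (C1 + C2) * exp (B * norm z)"
        using rb[of z] qb[of z] by (simp add: algebra_simps)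
      also have "\<dots> \<le> sqrt h * (C1 + C2) * exp (B * norm z + (norm z)\<^sup>2 / 16)"
        using C t by (intro mult_left_mono) auto
      finally show "\<bar>rho t h y z - tilt t h y z\<bar> \<le> sqrt h * (C1 + C2) * exp (B * norm z + (norm z)\<^sup>2 / 16)" .
    qed (use C t in auto)
    then show "(\<integral>\<^sup>+z. ennreal ((wt t h y z)\<^sup>2) \<partial>std_gaussian) \<le> ennreal (1 + (C1 + C2)\<^sup>2 * I * h)"
      using t by (simp add: power_mult_distrib mult_ac)
  qed
qed

lemma V_stein:
  assumes "0 \<le> s"
  shows "(\<integral>z. exp (f (y + s *\<^sub>R z)) * (u \<bullet> z) \<partial>std_gaussian) = s * (\<integral>z. exp (f (y + s *\<^sub>R z)) * (df (y + s *\<^sub>R z) \<bullet> u) \<partial>std_gaussian)"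
proof -
  have "(\<integral>z. exp (f (y + s *\<^sub>R z)) * (u \<bullet> z) \<partial>std_gaussian) = (\<integral>z. s * (exp (f (y + s *\<^sub>R z)) * (df (y + s *\<^sub>R z) \<bullet> u)) \<partial>std_gaussian)"
  proof (rule std_gaussian_stein[where B="L * s" and C="exp (f y) + s * (exp (f y) * (L * norm u))"])
    fix z :: 'a and r :: real
    have 1: "exp (f (y + s *\<^sub>R z)) \<le> exp (f y) * exp (L * s * norm z)"
      using exp_f_shift_le[of y "s *\<^sub>R z"] assms by (simp add: mult.assoc)
    have "\<bar>exp (f (y + s *\<^sub>R z))\<bar> \<le> exp (f y) * exp (L * s * norm z)" using 1 by simp
    also have "\<dots> \<le> (exp (f y) + s * (exp (f y) * (L * norm u))) * exp (L * s * norm z)"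
      using assms L_nonneg by (intro mult_right_mono) auto
    finally show "\<bar>exp (f (y + s *\<^sub>R z))\<bar> \<le> (exp (f y) + s * (exp (f y) * (L * norm u))) * exp (L * s * norm z)" .
    have "\<bar>s * (exp (f (y + s *\<^sub>R z)) * (df (y + s *\<^sub>R z) \<bullet> u))\<bar> \<le> s * ((exp (f y) * exp (L * s * norm z)) * (L * norm u))"
      unfolding abs_mult using 1 inner_df_le[of "y + s *\<^sub>R z" u] assms by (intro mult_mono) auto
    also have "\<dots> = (s * (exp (f y) * (L * norm u))) * exp (L * s * norm z)" by simp
    also have "\<dots> \<le> (exp (f y) + s * (exp (f y) * (L * norm u))) * exp (L * s * norm z)"
      by (intro mult_right_mono) auto
    finally show "\<bar>s * (exp (f (y + s *\<^sub>R z)) * (df (y + s *\<^sub>R z) \<bullet> u))\<bar> \<le> (exp (f y) + s * (exp (f y) * (L * norm u))) * exp (L * s * norm z)" .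
    have "((\<lambda>r. f ((y + s *\<^sub>R z) + r *\<^sub>R (s *\<^sub>R u))) has_real_derivative df ((y + s *\<^sub>R z) + r *\<^sub>R (s *\<^sub>R u)) \<bullet> (s *\<^sub>R u)) (at r)"
      by (rule DERIV_f_line)
    then have "((\<lambda>r. f (y + s *\<^sub>R (z + r *\<^sub>R u))) has_real_derivative s * (df (y + s *\<^sub>R (z + r *\<^sub>R u)) \<bullet> u)) (at r)"
      by (simp add: scaleR_add_right add_ac mult.commute)
    from DERIV_fun_exp[OF this]
    show "((\<lambda>r. exp (f (y + s *\<^sub>R (z + r *\<^sub>R u)))) has_real_derivative
        s * (exp (f (y + s *\<^sub>R (z + r *\<^sub>R u))) * (df (y + s *\<^sub>R (z + r *\<^sub>R u)) \<bullet> u))) (at r)"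
      by (simp add: mult_ac)
  qed (use assms L_nonneg in auto)
  then show ?thesis by simp
qed

text \<open>Write \<open>g (t + h)\<close> as an average over the remaining noise, exchange the
  integrals, and apply Stein's identity in the step noise: the factor \<open>z\<close> becomes a
  gradient, and the semigroup collapses the average to \<open>V t y\<close>. So the tilted
  transition has mean displacement exactly \<open>h * v t y\<close>.\<close>

lemma integral_rho_inner:
  assumes t: "0 \<le> t" "0 \<le> h" "t + h \<le> 1"
  shows "(\<integral>z. rho t h y z * (u \<bullet> z) \<partial>std_gaussian) = sqrt h * (v t y \<bullet> u)"
proof -
  interpret P: pair_sigma_finite "std_gaussian :: 'a measure" "std_gaussian :: 'a measure" ..
  define s where "s = sqrt (1 - (t + h))"
  have s: "0 \<le> s" "s \<le> 1" using t by (auto simp: s_def)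
  have h1: "sqrt h \<le> 1" using t by simp
  have gt: "g t y > 0" using g_pos t by simp
  let ?w = "\<lambda>z z'. y + sqrt h *\<^sub>R z + s *\<^sub>R z'"
  have wb: "exp (f (?w z z')) \<le> exp (f y) * (exp (L * norm z) * exp (L * norm z'))" for z z'
  proof -
    have "norm (sqrt h *\<^sub>R z + s *\<^sub>R z') \<le> sqrt h * norm z + s * norm z'"
      using norm_triangle_ineq[of "sqrt h *\<^sub>R z" "s *\<^sub>R z'"] s t by simp
    also have "\<dots> \<le> 1 * norm z + 1 * norm z'" using s h1 by (intro add_mono mult_right_mono) auto
    finally have "L * norm (sqrt h *\<^sub>R z + s *\<^sub>R z') \<le> L * (norm z + norm z')" using L_nonneg by (intro mult_left_mono) auto
    then have "exp (L * norm (sqrt h *\<^sub>R z + s *\<^sub>R z')) \<le> exp (L * norm z) * exp (L * norm z')"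
      by (simp add: exp_add[symmetric] distrib_left)
    then have "exp (f y) * exp (L * norm (sqrt h *\<^sub>R z + s *\<^sub>R z')) \<le> exp (f y) * (exp (L * norm z) * exp (L * norm z'))"
      by (rule mult_left_mono) simp
    then show ?thesis using exp_f_shift_le[of y "sqrt h *\<^sub>R z + s *\<^sub>R z'"] unfolding add.assoc by linarith
  qed
  have le1: "exp (L * norm z) \<le> exp ((L + 1) * norm z + (norm z)\<^sup>2 / 8)" for z :: 'a
    by (simp add: algebra_simps)
  have le2: "norm z * exp (L * norm z) \<le> exp ((L + 1) * norm z + (norm z)\<^sup>2 / 8)" for z :: 'a
  proof -
    have "norm z * exp (L * norm z) \<le> exp (norm z) * exp (L * norm z)" by (intro mult_right_mono le_exp_self) simp
    also have "\<dots> \<le> exp ((L + 1) * norm z + (norm z)\<^sup>2 / 8)" by (simp add: exp_add[symmetric] algebra_simps)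
    finally show ?thesis .
  qed
  have i1: "integrable (std_gaussian \<Otimes>\<^sub>M std_gaussian) (\<lambda>(z, z'). exp (f (?w z z')) * (u \<bullet> z))"
  proof (rule integrable_std_gaussian_pair_exp_bound[of _ "exp (f y) * norm u" "L + 1"])
    fix z z' :: 'a
    have "\<bar>u \<bullet> z\<bar> \<le> norm u * norm z" by (rule Cauchy_Schwarz_ineq2)
    then have "exp (f (?w z z')) * \<bar>u \<bullet> z\<bar> \<le> (exp (f y) * (exp (L * norm z) * exp (L * norm z'))) * (norm u * norm z)"
      by (intro mult_mono wb) auto
    also have "\<dots> = exp (f y) * norm u * ((norm z * exp (L * norm z)) * exp (L * norm z'))" by simp
    also have "\<dots> \<le> exp (f y) * norm u * (exp ((L + 1) * norm z + (norm z)\<^sup>2 / 8) * exp ((L + 1) * norm z' + (norm z')\<^sup>2 / 8))"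
      by (intro mult_left_mono mult_mono le1 le2) auto
    finally show "norm (case (z, z') of (z, z') \<Rightarrow> exp (f (?w z z')) * (u \<bullet> z)) \<le> \<dots>" by (simp add: abs_mult)
  qed measurable
  have i2: "integrable (std_gaussian \<Otimes>\<^sub>M std_gaussian) (\<lambda>(z, z'). exp (f (?w z z')) * (df (?w z z') \<bullet> u))"
  proof (rule integrable_std_gaussian_pair_exp_bound[of _ "exp (f y) * (L * norm u)" "L + 1"])
    fix z z' :: 'a
    have "exp (f (?w z z')) * \<bar>df (?w z z') \<bullet> u\<bar> \<le> (exp (f y) * (exp (L * norm z) * exp (L * norm z'))) * (L * norm u)"
      using inner_df_le by (intro mult_mono wb) auto
    also have "\<dots> = exp (f y) * (L * norm u) * (exp (L * norm z) * exp (L * norm z'))" by simp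
    also have "\<dots> \<le> exp (f y) * (L * norm u) * (exp ((L + 1) * norm z + (norm z)\<^sup>2 / 8) * exp ((L + 1) * norm z' + (norm z')\<^sup>2 / 8))"
      using L_nonneg by (intro mult_left_mono mult_mono le1) auto
    finally show "norm (case (z, z') of (z, z') \<Rightarrow> exp (f (?w z z')) * (df (?w z z') \<bullet> u)) \<le> \<dots>" by (simp add: abs_mult)
  qed measurable
  have "g t y * (\<integral>z. rho t h y z * (u \<bullet> z) \<partial>std_gaussian) = (\<integral>z. g (t + h) (y + sqrt h *\<^sub>R z) * (u \<bullet> z) \<partial>std_gaussian)"
    unfolding rho_def by (subst integral_mult_right_zero[symmetric], rule Bochner_Integration.integral_cong) (use gt in simp_all)
  also have "\<dots> = (\<integral>z. \<integral>z'. exp (f (?w z z')) * (u \<bullet> z) \<partial>std_gaussian \<partial>std_gaussian)"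
    unfolding g_def s_def[symmetric] by simp
  also have "\<dots> = (\<integral>z'. \<integral>z. exp (f (?w z z')) * (u \<bullet> z) \<partial>std_gaussian \<partial>std_gaussian)"
    by (rule P.Fubini_integral[symmetric, OF i1])
  also have "\<dots> = (\<integral>z'. \<integral>z. sqrt h * (exp (f (?w z z')) * (df (?w z z') \<bullet> u)) \<partial>std_gaussian \<partial>std_gaussian)"
  proof (rule Bochner_Integration.integral_cong[OF refl])
    fix z'
    show "(\<integral>z. exp (f (?w z z')) * (u \<bullet> z) \<partial>std_gaussian) = (\<integral>z. sqrt h * (exp (f (?w z z')) * (df (?w z z') \<bullet> u)) \<partial>std_gaussian)"
      using V_stein[of "sqrt h" "y + s *\<^sub>R z'" u] t by (simp add: add_ac)
  qed
  also have "\<dots> = sqrt h * (\<integral>z'. \<integral>z. exp (f (?w z z')) * (df (?w z z') \<bullet> u) \<partial>std_gaussian \<partial>std_gaussian)" by simp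
  also have "(\<integral>z'. \<integral>z. exp (f (?w z z')) * (df (?w z z') \<bullet> u) \<partial>std_gaussian \<partial>std_gaussian)
      = (\<integral>z. \<integral>z'. exp (f (?w z z')) * (df (?w z z') \<bullet> u) \<partial>std_gaussian \<partial>std_gaussian)"
    by (rule P.Fubini_integral[OF i2])
  also have "\<dots> = (\<integral>z. V (t + h) (y + sqrt h *\<^sub>R z) \<bullet> u \<partial>std_gaussian)"
    unfolding V_def s_def[symmetric] using integrable_exp_f_df[of _ s]
    by (simp flip: integral_inner_left)
  also have "\<dots> = V t y \<bullet> u"
    using integral_V_shift[of h t y] t integrable_V_shift[of "t + h" y "sqrt h"] by (subst integral_inner_left) auto
  also have "\<dots> = g t y * (v t y \<bullet> u)" using V_eq[of t y] t by simp
  finally show ?thesis using gt by simp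
qed

text \<open>The transition density and the exponential tilt agree to first order in $z$ up to $O(a^2)$,
  $a^2=h/(1-t-h)$: in the Cameron--Martin expansion of the former the remainder has an explicit
  $L^2$ norm, and its mean and first moment identify the first two coefficients.\<close>

lemma chi_square_fine:
  obtains C where "C \<ge> 0"
    "\<And>t h y. 0 \<le> t \<Longrightarrow> 0 < h \<Longrightarrow> 16 * h \<le> 1 - t - h \<Longrightarrow>
       (\<integral>\<^sup>+z. ennreal ((wt t h y z)\<^sup>2) \<partial>std_gaussian) \<le> ennreal (1 + C * (h / (1 - t - h))\<^sup>2)"
proof -
  define F2 where "F2 = (\<integral>z. (exp (L * norm (z::'a)) / \<kappa>)\<^sup>2 \<partial>std_gaussian)"
  have e2: "(exp (L * norm z) / \<kappa>)\<^sup>2 = exp (2 * L * norm z) / \<kappa>\<^sup>2" for z :: 'a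
    by (simp add: power_divide exp_double[symmetric] mult.assoc)
  have F2i: "integrable std_gaussian (\<lambda>z. (exp (L * norm (z::'a)) / \<kappa>)\<^sup>2)"
    unfolding e2 using integrable_exp_norm[of "2 * L"] by simp
  have F2: "F2 \<ge> 0" unfolding F2_def by (rule integral_nonneg_AE) auto
  define K where "K = F2 + 24"
  define E where "E z = exp (norm z + (norm z)\<^sup>2 / 16)" for z :: 'a
  define E2 where "E2 z = exp (2 * norm z + (norm z)\<^sup>2 / 16)" for z :: 'a
  have Ei: "integrable std_gaussian E" unfolding E_def
    by (rule integrable_std_gaussian_exp_bound[of _ 1 1]) auto
  have E2i: "integrable std_gaussian E2" unfolding E2_def
    by (rule integrable_std_gaussian_exp_bound[of _ 1 2]) auto
  have EE2: "E z \<le> E2 z" "norm z * E z \<le> E2 z" for z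
  proof -
    show "E z \<le> E2 z" unfolding E_def E2_def by simp
    have "norm z * E z \<le> exp (norm z) * E z" by (intro mult_right_mono le_exp_self) (simp add: E_def)
    then show "norm z * E z \<le> E2 z" by (simp add: E_def E2_def exp_add[symmetric])
  qed
  define Kc where "Kc = K * (\<integral>z. E2 z \<partial>std_gaussian)"
  define K3 where "K3 = 2 * exp (2 * L\<^sup>2) + L\<^sup>2"
  have K: "K \<ge> 0" "Kc \<ge> 0" "K3 \<ge> 0"
    using F2 by (auto simp: K_def Kc_def K3_def E2_def intro!: mult_nonneg_nonneg integral_nonneg_AE)
  define B where "B = 2 * L + 1"
  define I where "I = exp (L\<^sup>2) * (\<integral>z. exp ((2 * B + L) * norm (z::'a) + (norm z)\<^sup>2 / 8) \<partial>std_gaussian)"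
  have I: "I \<ge> 0" unfolding I_def by (intro mult_nonneg_nonneg integral_nonneg_AE) auto
  \<comment> \<open>\<open>K\<close> for the second-order remainder, \<open>Kc\<close> twice for the
    errors of the zeroth and first coefficients of \<open>rho\<close>, \<open>K3\<close> for the
    remainder of \<open>tilt\<close>.\<close>
  define K4 where "K4 = K + 2 * Kc + K3"
  show ?thesis
  proof (rule that[of "K4\<^sup>2 * I"])
    show "0 \<le> K4\<^sup>2 * I" using I by simp
    fix t h :: real and y :: 'a
    assume t: "0 \<le> t" "0 < h" "16 * h \<le> 1 - t - h"
    define \<sigma> where "\<sigma> = 1 - t - h"
    have \<sigma>: "0 < \<sigma>" "\<sigma> \<le> 1" "16 * h \<le> \<sigma>" using t by (auto simp: \<sigma>_def)
    have th: "0 \<le> h" "h \<le> 1" "t + h \<le> 1" "t \<le> 1" using t by auto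
    define s where "s = sqrt \<sigma>"
    have s: "0 < s" "s \<le> 1" "sqrt (1 - (t + h)) = s" using \<sigma> by (auto simp: s_def \<sigma>_def algebra_simps)
    \<comment> \<open>A displacement \<open>sqrt h *\<^sub>R w\<close> of the point equals a
      displacement \<open>a *\<^sub>R w\<close> of the remaining standard noise, which is scaled by
      \<open>s\<close>; so \<open>a\<close> is the natural small parameter.\<close>
    define a where "a = sqrt (h / \<sigma>)"
    have a2: "a\<^sup>2 = h / \<sigma>" using \<sigma> t by (simp add: a_def)
    have a: "a > 0" "s * a = sqrt h" using \<sigma> t by (auto simp: a_def s_def real_sqrt_mult[symmetric])
    \<comment> \<open>This is where the factor 16 in the hypothesis is spent: it keeps
      \<open>exp A\<close> below \<open>exp ((norm w)\<^sup>2 / 16)\<close>, the growth that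
      \<open>nn_integral_wt_sq_le\<close> accepts.\<close>
    have a16: "a\<^sup>2 \<le> 1 / 16" using \<sigma> unfolding a2 by (simp add: field_simps)
    have ha: "h \<le> a\<^sup>2" unfolding a2 using \<sigma> t mult_left_mono[of \<sigma> 1 h] by (simp add: field_simps)
    have gt: "g t y > 0" using g_pos t th by simp
    define F where "F z = exp (f (y + s *\<^sub>R z)) / g t y" for z
    have [measurable]: "F \<in> borel_measurable borel" unfolding F_def by measurable
    have F0: "F z > 0" for z using gt by (simp add: F_def)
    have Fb: "F z \<le> exp (L * norm z) / \<kappa>" for z
    proof -
      have "s * norm z \<le> 1 * norm z" using s by (intro mult_right_mono) auto
      then have "L * norm (s *\<^sub>R z) \<le> L * norm z" using L_nonneg s by (intro mult_left_mono) auto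
      then have "exp (f y) * exp (L * norm (s *\<^sub>R z)) \<le> exp (f y) * exp (L * norm z)" by simp
      then have "exp (f (y + s *\<^sub>R z)) \<le> exp (f y) * exp (L * norm z)"
        by (rule order_trans[OF exp_f_shift_le])
      then have "exp (f (y + s *\<^sub>R z)) * \<kappa> \<le> (exp (f y) * exp (L * norm z)) * \<kappa>"
        using kappa_pos by (intro mult_right_mono) auto
      also have "\<dots> = (exp (f y) * \<kappa>) * exp (L * norm z)" by simp
      also have "\<dots> \<le> g t y * exp (L * norm z)" using g_ge t th by (intro mult_right_mono) auto
      finally show ?thesis using gt kappa_pos by (simp add: F_def field_simps)
    qed
    have Fi: "integrable std_gaussian F"
      unfolding F_def using integrable_exp_f by simp
    have Fsq: "(F z)\<^sup>2 \<le> (exp (L * norm z) / \<kappa>)\<^sup>2" for z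
      using F0[of z] Fb[of z] by (intro power_mono) auto
    have Fsqi: "integrable std_gaussian (\<lambda>z. (F z)\<^sup>2)"
      by (rule Bochner_Integration.integrable_bound[OF F2i]) (use Fsq in auto)
    have FzI: "integrable std_gaussian (\<lambda>z. F z *\<^sub>R z)"
    proof (rule integrable_std_gaussian_exp_bound'[of _ "1 / \<kappa>" "L + 1"])
      fix z
      have "F z * norm z \<le> (exp (L * norm z) / \<kappa>) * exp (norm z)"
        using F0[of z] Fb[of z] kappa_pos by (intro mult_mono le_exp_self) auto
      also have "\<dots> = 1 / \<kappa> * exp ((L + 1) * norm z)" by (simp add: exp_add[symmetric] distrib_right)
      finally show "norm (F z *\<^sub>R z) \<le> 1 / \<kappa> * exp ((L + 1) * norm z)" using F0[of z] by simp
    qed simp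
    have FzwI: "integrable std_gaussian (\<lambda>z. F z * (z \<bullet> w))" for w
      using integrable_inner_left[of w std_gaussian "\<lambda>z. F z *\<^sub>R z"] FzI by simp
    define m0 where "m0 = (\<integral>z. F z \<partial>std_gaussian)"
    define m1 where "m1 = (\<integral>z. F z *\<^sub>R z \<partial>std_gaussian)"
    \<comment> \<open>\<open>X\<close> is the Cameron-Martin exponential without its terms of order
      0 and 1. Integrating those two terms against \<open>F\<close> gives \<open>m0\<close> and
      \<open>a * (m1 \<bullet> w)\<close>, so \<open>R\<close> below is the integral of
      \<open>F * X\<close>.\<close>
    define X where "X w z = exp ((a *\<^sub>R w) \<bullet> z - (norm (a *\<^sub>R w))\<^sup>2 / 2) - 1 - (a *\<^sub>R w) \<bullet> z" for w z :: 'a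
    define R where "R z = rho t h y z - m0 - a * (m1 \<bullet> z)" for z
    have X2i: "integrable std_gaussian (\<lambda>z. (X w z)\<^sup>2)"
      and X2: "(\<integral>z. (X w z)\<^sup>2 \<partial>std_gaussian) = exp ((norm (a *\<^sub>R w))\<^sup>2) - 1 - (norm (a *\<^sub>R w))\<^sup>2" for w
      unfolding X_def by (rule integral_std_gaussian_exp_second_order)+
    have [measurable]: "X w \<in> borel_measurable borel" for w unfolding X_def by measurable
    \<comment> \<open>Young's inequality with weight \<open>a\<^sup>2\<close>: the squared norm of
      \<open>X\<close> is \<open>O(a^4)\<close>, so both halves come out as
      \<open>O(a^2)\<close>.\<close>
    have FXb: "\<bar>F z * X w z\<bar> \<le> (a\<^sup>2 * (F z)\<^sup>2 + (X w z)\<^sup>2 / a\<^sup>2) / 2" for w z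
    proof -
      have "0 \<le> (a * F z - \<bar>X w z\<bar> / a)\<^sup>2" by simp
      also have "\<dots> = a\<^sup>2 * (F z)\<^sup>2 + (X w z)\<^sup>2 / a\<^sup>2 - 2 * (F z * \<bar>X w z\<bar>)"
        using a by (simp add: power2_diff power_mult_distrib power_divide)
      finally show ?thesis using F0[of z] by (simp add: abs_mult)
    qed
    have bi: "integrable std_gaussian (\<lambda>z. (a\<^sup>2 * (F z)\<^sup>2 + (X w z)\<^sup>2 / a\<^sup>2) / 2)" for w
      using Fsqi X2i[of w] by simp
    have FXi: "integrable std_gaussian (\<lambda>z. F z * X w z)" for w
      by (rule Bochner_Integration.integrable_bound[OF bi[of w]])
        (use FXb in \<open>auto intro!: AE_I2 order_trans[OF _ abs_ge_self]\<close>)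
    have Req: "R w = (\<integral>z. F z * X w z \<partial>std_gaussian)" for w
    proof -
      have "exp (f (y + sqrt h *\<^sub>R w + s *\<^sub>R z)) = exp (f (y + s *\<^sub>R (z + a *\<^sub>R w)))" for z
        using a by (simp add: scaleR_add_right add_ac)
      then have "rho t h y w = (\<integral>z. F (z + a *\<^sub>R w) \<partial>std_gaussian)"
        unfolding rho_def g_def s F_def by simp
      also have "\<dots> = (\<integral>z. exp ((a *\<^sub>R w) \<bullet> z - (norm (a *\<^sub>R w))\<^sup>2 / 2) *\<^sub>R F z \<partial>std_gaussian)"
        by (rule integral_std_gaussian_shift) simp
      also have "\<dots> = (\<integral>z. F z * X w z + F z + a * ((F z *\<^sub>R z) \<bullet> w) \<partial>std_gaussian)"
        by (intro Bochner_Integration.integral_cong) (auto simp: X_def algebra_simps inner_commute)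
      also have "\<dots> = (\<integral>z. F z * X w z \<partial>std_gaussian) + m0 + a * (m1 \<bullet> w)"
        unfolding m0_def m1_def integral_inner_left[OF FzI, symmetric]
        by (intro has_bochner_integral_integral_eq has_bochner_integral_add has_bochner_integral_mult_right)
          (use FXi Fi FzwI in \<open>auto simp: has_bochner_integral_iff\<close>)
      finally show ?thesis by (simp add: R_def)
    qed
    have Rb: "\<bar>R w\<bar> \<le> a\<^sup>2 * (K * E w)" for w
    proof -
      define A where "A = (norm (a *\<^sub>R w))\<^sup>2"
      have A: "A = a\<^sup>2 * (norm w)\<^sup>2" "0 \<le> A" by (simp_all add: A_def power_mult_distrib)
      have A16: "A \<le> (norm w)\<^sup>2 / 16" unfolding A using mult_right_mono[OF a16, of "(norm w)\<^sup>2"] by simp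
      have w4: "norm w ^ 4 \<le> 24 * exp (norm w)" using norm_power_le_exp[of w 4] by (simp add: fact_numeral)
      have "\<bar>R w\<bar> \<le> (\<integral>z. \<bar>F z * X w z\<bar> \<partial>std_gaussian)" unfolding Req by (rule integral_abs_bound)
      also have "\<dots> \<le> (\<integral>z. (a\<^sup>2 * (F z)\<^sup>2 + (X w z)\<^sup>2 / a\<^sup>2) / 2 \<partial>std_gaussian)"
        using FXi bi FXb by (intro integral_mono integrable_abs)
      also have "\<dots> = (a\<^sup>2 * (\<integral>z. (F z)\<^sup>2 \<partial>std_gaussian) + (exp A - 1 - A) / a\<^sup>2) / 2"
        using Fsqi X2i[of w] X2[of w] by (simp add: A_def)
      also have "\<dots> \<le> (a\<^sup>2 * F2 + (a\<^sup>2 * (24 * E w))) / 2"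
      proof (intro divide_right_mono add_mono mult_left_mono)
        show "(\<integral>z. (F z)\<^sup>2 \<partial>std_gaussian) \<le> F2"
          unfolding F2_def using Fsqi F2i Fsq by (intro integral_mono)
        have "exp A - 1 - A \<le> A\<^sup>2 * exp A" using exp_second_order[of A] A by simp
        also have "\<dots> \<le> A\<^sup>2 * exp ((norm w)\<^sup>2 / 16)" using A16 by (intro mult_left_mono) auto
        also have "\<dots> = a\<^sup>2 * a\<^sup>2 * (norm w ^ 4 * exp ((norm w)\<^sup>2 / 16))" by (simp add: A power2_eq_square power4_eq_xxxx)
        also have "\<dots> \<le> a\<^sup>2 * a\<^sup>2 * ((24 * exp (norm w)) * exp ((norm w)\<^sup>2 / 16))"
          using w4 by (intro mult_left_mono mult_right_mono) auto
        also have "\<dots> = (a\<^sup>2 * (24 * E w)) * a\<^sup>2" by (simp add: E_def exp_add)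
        finally show "(exp A - 1 - A) / a\<^sup>2 \<le> a\<^sup>2 * (24 * E w)" using a by (simp add: pos_divide_le_eq)
      qed auto
      also have "\<dots> \<le> a\<^sup>2 * (K * E w)"
      proof -
        have "1 \<le> E w" by (simp add: E_def)
        then have 1: "F2 * 1 \<le> F2 * E w" using F2 by (intro mult_left_mono) auto
        have 2: "0 \<le> E w" by (simp add: E_def)
        have "(p + 24 * e) / 2 \<le> q + 24 * e" if "p \<le> q" "0 \<le> p" "0 \<le> e" for p q e :: real
          using that by simp
        from this[OF 1[unfolded mult_1_right] F2 2]
        have "(F2 + 24 * E w) / 2 \<le> F2 * E w + 24 * E w" .
        then have "(F2 + 24 * E w) / 2 \<le> K * E w" unfolding K_def distrib_right .
        then have "a\<^sup>2 * ((F2 + 24 * E w) / 2) \<le> a\<^sup>2 * (K * E w)" by (rule mult_left_mono) simp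
        then show ?thesis by (simp add: distrib_left)
      qed
      finally show ?thesis .
    qed
    have [measurable]: "R \<in> borel_measurable borel" unfolding R_def by measurable
    have RuI: "integrable std_gaussian (\<lambda>z. R z * (u \<bullet> z))" and Ru: "\<bar>\<integral>z. R z * (u \<bullet> z) \<partial>std_gaussian\<bar> \<le> a\<^sup>2 * (norm u * Kc)" for u
    proof -
      have b: "\<bar>R z * (u \<bullet> z)\<bar> \<le> a\<^sup>2 * (norm u * (K * E2 z))" for z
      proof -
        have "\<bar>R z * (u \<bullet> z)\<bar> \<le> (a\<^sup>2 * (K * E z)) * (norm u * norm z)"
          unfolding abs_mult using K by (intro mult_mono Rb Cauchy_Schwarz_ineq2) (auto simp: E_def)
        also have "\<dots> = a\<^sup>2 * (norm u * (K * (norm z * E z)))" by simp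
        also have "\<dots> \<le> a\<^sup>2 * (norm u * (K * E2 z))" using K by (intro mult_left_mono EE2) auto
        finally show ?thesis .
      qed
      have i: "integrable std_gaussian (\<lambda>z. a\<^sup>2 * (norm u * (K * E2 z)))" using E2i by simp
      show j: "integrable std_gaussian (\<lambda>z. R z * (u \<bullet> z))"
        by (rule Bochner_Integration.integrable_bound[OF i]) (use b in \<open>auto intro!: AE_I2 order_trans[OF _ abs_ge_self]\<close>)
      have "\<bar>\<integral>z. R z * (u \<bullet> z) \<partial>std_gaussian\<bar> \<le> (\<integral>z. \<bar>R z * (u \<bullet> z)\<bar> \<partial>std_gaussian)" by (rule integral_abs_bound)
      also have "\<dots> \<le> (\<integral>z. a\<^sup>2 * (norm u * (K * E2 z)) \<partial>std_gaussian)"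
        using j i b by (intro integral_mono integrable_abs)
      finally show "\<bar>\<integral>z. R z * (u \<bullet> z) \<partial>std_gaussian\<bar> \<le> a\<^sup>2 * (norm u * Kc)" by (simp add: Kc_def)
    qed
    have Ri: "integrable std_gaussian R" and R1: "\<bar>\<integral>z. R z \<partial>std_gaussian\<bar> \<le> a\<^sup>2 * Kc"
    proof -
      have b: "\<bar>R z\<bar> \<le> a\<^sup>2 * (K * E2 z)" for z
        using Rb[of z] mult_left_mono[OF mult_left_mono[OF EE2(1) K(1)], of "a\<^sup>2" z] by simp
      have i: "integrable std_gaussian (\<lambda>z. a\<^sup>2 * (K * E2 z))" using E2i by simp
      show j: "integrable std_gaussian R"
        by (rule Bochner_Integration.integrable_bound[OF i]) (use b in \<open>auto intro!: AE_I2 order_trans[OF _ abs_ge_self]\<close>)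
      have "\<bar>\<integral>z. R z \<partial>std_gaussian\<bar> \<le> (\<integral>z. \<bar>R z\<bar> \<partial>std_gaussian)" by (rule integral_abs_bound)
      also have "\<dots> \<le> (\<integral>z. a\<^sup>2 * (K * E2 z) \<partial>std_gaussian)"
        using j i b by (intro integral_mono integrable_abs)
      finally show "\<bar>\<integral>z. R z \<partial>std_gaussian\<bar> \<le> a\<^sup>2 * Kc" by (simp add: Kc_def)
    qed
    \<comment> \<open>\<open>rho\<close> has mass one and the linear term is centred, so the mean of
      \<open>R\<close> is \<open>1 - m0\<close>.\<close>
    have m0b: "\<bar>m0 - 1\<bar> \<le> a\<^sup>2 * Kc"
    proof -
      have "(\<integral>z. R z \<partial>std_gaussian) = 1 - m0 - a * 0"
        unfolding R_def
        by (intro has_bochner_integral_integral_eq has_bochner_integral_diff has_bochner_integral_mult_right)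
          (use integral_rho[OF t(1) th(1,3)] integrable_std_gaussian_inner integral_std_gaussian_inner in
            \<open>auto simp: has_bochner_integral_iff std_gaussian.prob_space[simplified]\<close>)
      then show ?thesis using R1 by (simp add: abs_minus_commute)
    qed
    \<comment> \<open>Pairing with \<open>u \<bullet> z\<close> isolates the linear coefficient, and
      \<open>integral_rho_inner\<close> identifies it with the Euler drift up to
      \<open>O(a^2)\<close>. This cancellation is what the crude bound lacks.\<close>
    have m1b: "\<bar>a * (m1 \<bullet> u) - sqrt h * (v t y \<bullet> u)\<bar> \<le> a\<^sup>2 * (norm u * Kc)" for u
    proof -
      have "rho t h y z * (u \<bullet> z) = R z * (u \<bullet> z) + m0 * (u \<bullet> z) + a * ((m1 \<bullet> z) * (u \<bullet> z))" for z
        by (simp add: R_def algebra_simps)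
      then have "(\<integral>z. rho t h y z * (u \<bullet> z) \<partial>std_gaussian) = (\<integral>z. R z * (u \<bullet> z) + m0 * (u \<bullet> z) + a * ((m1 \<bullet> z) * (u \<bullet> z)) \<partial>std_gaussian)"
        by simp
      also have "\<dots> = (\<integral>z. R z * (u \<bullet> z) \<partial>std_gaussian) + m0 * 0 + a * (m1 \<bullet> u)"
        by (intro has_bochner_integral_integral_eq has_bochner_integral_add has_bochner_integral_mult_right)
          (use RuI integrable_std_gaussian_inner integral_std_gaussian_inner integrable_std_gaussian_inner_inner
             integral_std_gaussian_inner_inner in \<open>auto simp: has_bochner_integral_iff\<close>)
      finally have "sqrt h * (v t y \<bullet> u) = (\<integral>z. R z * (u \<bullet> z) \<partial>std_gaussian) + a * (m1 \<bullet> u)"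
        using integral_rho_inner[OF t(1) th(1,3)] by simp
      then show ?thesis using Ru[of u] by linarith
    qed
    have qb: "\<bar>tilt t h y z - 1 - sqrt h * (v t y \<bullet> z)\<bar> \<le> h * (K3 * exp (2 * L * norm z))" for z
    proof -
      let ?w = "sqrt h * (v t y \<bullet> z) - h * (norm (v t y))\<^sup>2 / 2"
      define W where "W = L * norm z + L\<^sup>2"
      have W0: "0 \<le> W" using L_nonneg by (simp add: W_def)
      have w1: "\<bar>?w\<bar> \<le> sqrt h * W" unfolding W_def by (rule abs_log_tilt_le[OF th(1,2)])
      have w2: "\<bar>?w\<bar> \<le> W"
        using w1 mult_right_mono[of "sqrt h" 1 W] th W0 by simp
      have "?w\<^sup>2 = \<bar>?w\<bar>\<^sup>2" by simp
      also have "\<dots> \<le> (sqrt h * W)\<^sup>2" using w1 by (intro power_mono) auto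
      finally have w3: "?w\<^sup>2 \<le> h * W\<^sup>2" using th by (simp add: power_mult_distrib)
      have "\<bar>tilt t h y z - 1 - ?w\<bar> \<le> ?w\<^sup>2 * exp \<bar>?w\<bar>" unfolding tilt_def by (rule exp_second_order)
      also have "\<dots> \<le> (h * W\<^sup>2) * exp W" using w2 w3 th by (intro mult_mono) auto
      also have "W\<^sup>2 \<le> 2 * exp W" using norm_power_le_exp[of W 2] W0 by simp
      then have "(h * W\<^sup>2) * exp W \<le> (h * (2 * exp W)) * exp W" using th by (intro mult_right_mono mult_left_mono) auto
      also have "\<dots> = h * (2 * exp (2 * L\<^sup>2) * exp (2 * L * norm z))"
        by (simp add: W_def exp_add[symmetric] algebra_simps)
      finally have 1: "\<bar>tilt t h y z - 1 - ?w\<bar> \<le> h * (2 * exp (2 * L\<^sup>2) * exp (2 * L * norm z))" .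
      have "(norm (v t y))\<^sup>2 \<le> L\<^sup>2" by (intro power_mono norm_v_le) simp
      also have "L\<^sup>2 * 1 \<le> L\<^sup>2 * exp (2 * L * norm z)" using L_nonneg by (intro mult_left_mono) auto
      finally have "h * (norm (v t y))\<^sup>2 \<le> h * (L\<^sup>2 * exp (2 * L * norm z))" using th by (intro mult_left_mono) auto
      moreover have "0 \<le> h * (norm (v t y))\<^sup>2" using th by simp
      ultimately show ?thesis using 1 unfolding K3_def distrib_right distrib_left by linarith
    qed
    have "(\<integral>\<^sup>+z. ennreal ((wt t h y z)\<^sup>2) \<partial>std_gaussian) \<le> ennreal (1 + (a\<^sup>2 * K4)\<^sup>2 * I)"
      unfolding I_def
    proof (rule nn_integral_wt_sq_le[OF t(1) th(1-3)])
      fix z :: 'a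
      let ?x = "exp (B * norm z + (norm z)\<^sup>2 / 16)"
      have x1: "E z \<le> ?x" "1 \<le> ?x" "exp (2 * L * norm z) \<le> ?x"
        using L_nonneg by (auto simp: E_def B_def algebra_simps)
      have x2: "norm z \<le> ?x"
      proof -
        have "norm z \<le> exp (norm z)" by (rule le_exp_self)
        also have "\<dots> \<le> ?x" using L_nonneg by (auto simp: B_def algebra_simps)
        finally show ?thesis .
      qed
      have "rho t h y z - tilt t h y z = R z + (m0 - 1) + (a * (m1 \<bullet> z) - sqrt h * (v t y \<bullet> z)) - (tilt t h y z - 1 - sqrt h * (v t y \<bullet> z))"
        by (simp add: R_def)
      then have "\<bar>rho t h y z - tilt t h y z\<bar> \<le> a\<^sup>2 * (K * E z) + a\<^sup>2 * Kc + a\<^sup>2 * (norm z * Kc) + h * (K3 * exp (2 * L * norm z))"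
        using Rb[of z] m0b m1b[of z] qb[of z] by linarith
      also have "\<dots> \<le> a\<^sup>2 * (K * ?x) + a\<^sup>2 * (Kc * ?x) + a\<^sup>2 * (?x * Kc) + a\<^sup>2 * (K3 * ?x)"
      proof (intro add_mono)
        show "a\<^sup>2 * Kc \<le> a\<^sup>2 * (Kc * ?x)" using mult_left_mono[OF x1(2) K(2)] by (intro mult_left_mono) auto
        show "h * (K3 * exp (2 * L * norm z)) \<le> a\<^sup>2 * (K3 * ?x)" using x1 K ha by (intro mult_mono) auto
      qed (use x1 x2 K in \<open>auto intro!: mult_left_mono mult_right_mono\<close>)
      also have "\<dots> = a\<^sup>2 * K4 * ?x" by (simp add: K4_def algebra_simps)
      finally show "\<bar>rho t h y z - tilt t h y z\<bar> \<le> a\<^sup>2 * K4 * ?x" .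
    qed (use K in \<open>auto simp: K4_def\<close>)
    then show "(\<integral>\<^sup>+z. ennreal ((wt t h y z)\<^sup>2) \<partial>std_gaussian) \<le> ennreal (1 + K4\<^sup>2 * I * (h / (1 - t - h))\<^sup>2)"
      unfolding a2 \<sigma>_def power_mult_distrib by (simp only: mult_ac)
  qed
qed

end

section \<open>The tilted chain\<close>

locale normalized_potential = lipschitz_potential +
  assumes integral_exp_f: "(\<integral>x. exp (f x) \<partial>std_gaussian) = 1"
begin

text \<open>The law of the tilted process at time $t$, with density $g_t$ relative to $N(0,t)$; a chain state
  $(x,y,S,R)$ carries the starting point, the current point, the accumulated noise and the
  likelihood ratio.\<close>

definition law :: "real \<Rightarrow> 'a measure" where
  "law t = distr (density std_gaussian (\<lambda>z. ennreal (g t (sqrt t *\<^sub>R z)))) borel (\<lambda>z. sqrt t *\<^sub>R z)"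

type_synonym 'b state = "'b \<times> 'b \<times> 'b \<times> real"

definition stX :: "'a state \<Rightarrow> 'a" where "stX s = fst s"
definition stY :: "'a state \<Rightarrow> 'a" where "stY s = fst (snd s)"
definition stS :: "'a state \<Rightarrow> 'a" where "stS s = fst (snd (snd s))"
definition stR :: "'a state \<Rightarrow> real" where "stR s = snd (snd (snd s))"

definition step :: "real \<Rightarrow> real \<Rightarrow> 'a state \<Rightarrow> 'a \<Rightarrow> 'a state" where
  "step t h s z = (stX s, stY s + h *\<^sub>R v t (stY s) + sqrt h *\<^sub>R z, stS s + sqrt h *\<^sub>R z, stR s * wt t h (stY s) z)"

lemma step_simps [simp]:
  "stX (step t h s z) = stX s" "stY (step t h s z) = stY s + h *\<^sub>R v t (stY s) + sqrt h *\<^sub>R z"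
  "stS (step t h s z) = stS s + sqrt h *\<^sub>R z" "stR (step t h s z) = stR s * wt t h (stY s) z"
  by (simp_all add: step_def stX_def stY_def stS_def stR_def)

lemma measurable_st [measurable]:
  "stX \<in> borel_measurable borel" "stY \<in> borel_measurable borel" "stS \<in> borel_measurable borel" "stR \<in> borel_measurable borel"
  unfolding stX_def stY_def stS_def stR_def by (auto intro!: borel_measurable_continuous_onI continuous_intros)

lemma measurable_step [measurable]: "(\<lambda>p. step t h (fst p) (snd p)) \<in> borel_measurable (borel \<Otimes>\<^sub>M borel)"
  unfolding step_def by measurable

text \<open>This is the unweighted measure: the increments of \<open>stS\<close> are independent
  Gaussians under it, and the tilted process appears only after weighting with \<open>stR\<close>.
  The start is drawn from \<open>law t0\<close>, so the same chain serves for a start at 0 and at a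
  later time.\<close>

primrec chain :: "real \<Rightarrow> real \<Rightarrow> nat \<Rightarrow> 'a state measure" where
  "chain t0 h 0 = distr (law t0) borel (\<lambda>x. (x, x, 0, 1))"
| "chain t0 h (Suc k) = distr (chain t0 h k \<Otimes>\<^sub>M std_gaussian) borel (\<lambda>p. step (t0 + real k * h) h (fst p) (snd p))"

lemma sets_law [simp, measurable_cong]: "sets (law t) = sets borel" and space_law [simp]: "space (law t) = UNIV"
  by (simp_all add: law_def)

lemma sets_chain [simp, measurable_cong]: "sets (chain t0 h k) = sets borel"
  by (cases k) simp_all

lemma space_chain [simp]: "space (chain t0 h k) = UNIV"
  by (cases k) simp_all

lemma nn_integral_law:
  assumes [measurable]: "\<phi> \<in> borel_measurable borel"
  shows "(\<integral>\<^sup>+y. \<phi> y \<partial>law t) = (\<integral>\<^sup>+z. ennreal (g t (sqrt t *\<^sub>R z)) * \<phi> (sqrt t *\<^sub>R z) \<partial>std_gaussian)"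
  unfolding law_def by (simp add: nn_integral_distr nn_integral_density)

lemma integral_law:
  fixes \<phi> :: "'a \<Rightarrow> real"
  assumes [measurable]: "\<phi> \<in> borel_measurable borel"
  shows "(\<integral>y. \<phi> y \<partial>law t) = (\<integral>z. g t (sqrt t *\<^sub>R z) * \<phi> (sqrt t *\<^sub>R z) \<partial>std_gaussian)"
  unfolding law_def by (simp add: integral_distr integral_density g_nonneg)

lemma nn_integral_g:
  assumes "0 \<le> h" "t + h \<le> 1"
  shows "(\<integral>\<^sup>+z. ennreal (g (t + h) (y + sqrt h *\<^sub>R z)) \<partial>std_gaussian) = ennreal (g t y)"
  using integral_g_shift[OF assms] by (subst nn_integral_eq_integral) (auto simp: integrable_g_shift g_nonneg)

lemma prob_space_law:
  assumes "0 \<le> t" "t \<le> 1"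
  shows "prob_space (law t)"
proof
  have "emeasure (law t) (space (law t)) = (\<integral>\<^sup>+y. 1 \<partial>law t)" by simp
  also have "\<dots> = (\<integral>\<^sup>+z. ennreal (g (0 + t) (0 + sqrt t *\<^sub>R z)) \<partial>std_gaussian)" by (subst nn_integral_law) auto
  also have "\<dots> = ennreal (g 0 0)" using assms by (subst nn_integral_g) auto
  also have "g 0 0 = 1" by (simp add: g_def integral_exp_f)
  finally show "emeasure (law t) (space (law t)) = 1" by simp
qed

lemma prob_space_chain:
  assumes "0 \<le> t0" "t0 \<le> 1"
  shows "prob_space (chain t0 h k)"
proof (induction k)
  case 0
  then show ?case using prob_space_law[OF assms] by (auto intro!: prob_space.prob_space_distr)
next
  case (Suc k)
  interpret prob_space "chain t0 h k" by fact
  interpret P: pair_prob_space "chain t0 h k" "std_gaussian :: 'a measure" ..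
  have "(\<lambda>p. step (t0 + real k * h) h (fst p) (snd p)) \<in> borel_measurable (chain t0 h k \<Otimes>\<^sub>M std_gaussian)" by measurable
  then show ?case using P.prob_space_axioms by (auto intro!: prob_space.prob_space_distr)
qed

text \<open>The factor \<open>g t\<close> of the density of \<open>law t\<close> cancels the
  denominator of \<open>rho\<close>, and the Gaussian variances \<open>t\<close> and
  \<open>h\<close> add.\<close>

lemma nn_integral_law_step:
  assumes t: "0 \<le> t" "0 \<le> h" "t + h \<le> 1" and [measurable]: "\<phi> \<in> borel_measurable borel"
  shows "(\<integral>\<^sup>+y. (\<integral>\<^sup>+z. ennreal (rho t h y z) * \<phi> (y + sqrt h *\<^sub>R z) \<partial>std_gaussian) \<partial>law t) = (\<integral>\<^sup>+y. \<phi> y \<partial>law (t + h))"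
proof -
  have m: "(\<lambda>w. ennreal (g (t + h) w) * \<phi> w) \<in> borel_measurable borel" by measurable
  have "(\<integral>\<^sup>+y. (\<integral>\<^sup>+z. ennreal (rho t h y z) * \<phi> (y + sqrt h *\<^sub>R z) \<partial>std_gaussian) \<partial>law t)
    = (\<integral>\<^sup>+x. ennreal (g t (sqrt t *\<^sub>R x)) * (\<integral>\<^sup>+z. ennreal (rho t h (sqrt t *\<^sub>R x) z) * \<phi> (sqrt t *\<^sub>R x + sqrt h *\<^sub>R z) \<partial>std_gaussian) \<partial>std_gaussian)"
    by (rule nn_integral_law) measurable
  also have "\<dots> = (\<integral>\<^sup>+x. \<integral>\<^sup>+z. ennreal (g (t + h) (sqrt t *\<^sub>R x + sqrt h *\<^sub>R z)) * \<phi> (sqrt t *\<^sub>R x + sqrt h *\<^sub>R z) \<partial>std_gaussian \<partial>std_gaussian)"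
  proof (rule nn_integral_cong)
    fix x
    have "ennreal (g t (sqrt t *\<^sub>R x)) * ennreal (rho t h (sqrt t *\<^sub>R x) z) = ennreal (g (t + h) (sqrt t *\<^sub>R x + sqrt h *\<^sub>R z))" for z
      using g_pos[of t "sqrt t *\<^sub>R x"] t g_nonneg rho_nonneg by (subst ennreal_mult[symmetric]) (auto simp: rho_def)
    then show "ennreal (g t (sqrt t *\<^sub>R x)) * (\<integral>\<^sup>+z. ennreal (rho t h (sqrt t *\<^sub>R x) z) * \<phi> (sqrt t *\<^sub>R x + sqrt h *\<^sub>R z) \<partial>std_gaussian)
      = (\<integral>\<^sup>+z. ennreal (g (t + h) (sqrt t *\<^sub>R x + sqrt h *\<^sub>R z)) * \<phi> (sqrt t *\<^sub>R x + sqrt h *\<^sub>R z) \<partial>std_gaussian)"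
      by (subst nn_integral_cmult[symmetric]) (auto simp: mult.assoc[symmetric])
  qed
  also have "\<dots> = (\<integral>\<^sup>+y. \<phi> y \<partial>law (t + h))"
    using nn_integral_std_gaussian_add[OF m t(1,2)] by (subst nn_integral_law) auto
  finally show ?thesis .
qed

lemma nn_integral_chain_Suc:
  assumes t0: "0 \<le> t0" "t0 \<le> 1" and [measurable]: "\<Phi> \<in> borel_measurable borel"
  shows "(\<integral>\<^sup>+s. \<Phi> s \<partial>chain t0 h (Suc k)) = (\<integral>\<^sup>+s. \<integral>\<^sup>+z. \<Phi> (step (t0 + real k * h) h s z) \<partial>std_gaussian \<partial>chain t0 h k)"
proof -
  have m: "(\<lambda>p. \<Phi> (step (t0 + real k * h) h (fst p) (snd p))) \<in> borel_measurable (chain t0 h k \<Otimes>\<^sub>M std_gaussian)" by measurable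
  show ?thesis
    using std_gaussian.nn_integral_fst[OF m] by (simp add: nn_integral_distr)
qed

lemma integral_chain_Suc:
  fixes \<Phi> :: "'a state \<Rightarrow> real"
  assumes t0: "0 \<le> t0" "t0 \<le> 1" and i: "integrable (chain t0 h (Suc k)) \<Phi>"
  shows "(\<integral>s. \<Phi> s \<partial>chain t0 h (Suc k)) = (\<integral>s. \<integral>z. \<Phi> (step (t0 + real k * h) h s z) \<partial>std_gaussian \<partial>chain t0 h k)"
proof -
  interpret prob_space "chain t0 h k" by (rule prob_space_chain[OF t0])
  interpret P: pair_prob_space "chain t0 h k" "std_gaussian :: 'a measure" ..
  have [measurable]: "\<Phi> \<in> borel_measurable borel" using i by (simp add: measurable_def integrable_iff_bounded)
  have i': "integrable (chain t0 h k \<Otimes>\<^sub>M std_gaussian) (\<lambda>p. \<Phi> (step (t0 + real k * h) h (fst p) (snd p)))"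
    using i by (simp add: integrable_distr_eq)
  show ?thesis
    using P.integral_fst'[OF i'] by (simp add: integral_distr)
qed

lemma AE_chain_Suc:
  assumes t0: "0 \<le> t0" "t0 \<le> 1" and AE: "AE s in chain t0 h k. P s" and [measurable]: "Measurable.pred borel P" "Measurable.pred borel Q"
    and imp: "\<And>s z. P s \<Longrightarrow> Q (step (t0 + real k * h) h s z)"
  shows "AE s in chain t0 h (Suc k). Q s"
proof -
  interpret prob_space "chain t0 h k" by (rule prob_space_chain[OF t0])
  have "AE s in distr (chain t0 h k \<Otimes>\<^sub>M (std_gaussian :: 'a measure)) (chain t0 h k) fst. P s"
    using AE by (subst std_gaussian.distr_pair_fst)
  then have "AE p in chain t0 h k \<Otimes>\<^sub>M (std_gaussian :: 'a measure). P (fst p)"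
    by (subst (asm) AE_distr_iff) auto
  then have "AE p in chain t0 h k \<Otimes>\<^sub>M (std_gaussian :: 'a measure). Q (step (t0 + real k * h) h (fst p) (snd p))"
    by eventually_elim (rule imp)
  moreover have "(AE s in chain t0 h (Suc k). Q s) \<longleftrightarrow>
      (AE p in chain t0 h k \<Otimes>\<^sub>M (std_gaussian :: 'a measure). Q (step (t0 + real k * h) h (fst p) (snd p)))"
    unfolding chain.simps by (rule AE_distr_iff) measurable
  ultimately show ?thesis by simp
qed

text \<open>\<open>stY - stX - stS\<close> is the accumulated drift, whose increments have norm at
  most \<open>h * L\<close>. This deterministic bound supplies the integrability of the weighted
  drift terms.\<close>

lemma chain_bounds:
  assumes t0: "0 \<le> t0" "t0 \<le> 1" and h: "0 \<le> h"
  shows "AE s in chain t0 h k. stR s \<ge> 0 \<and> norm (stY s - stX s - stS s) \<le> real k * h * L"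
proof (induction k)
  case 0
  have "AE x in law t0. stR (x, x, 0, 1) \<ge> 0 \<and> norm (stY (x, x, 0, 1) - stX (x, x, 0, 1) - stS (x, x, 0, 1)) \<le> real 0 * h * L"
    by (simp add: stX_def stY_def stS_def stR_def)
  moreover have "(AE s in chain t0 h 0. stR s \<ge> 0 \<and> norm (stY s - stX s - stS s) \<le> real 0 * h * L) \<longleftrightarrow>
      (AE x in law t0. stR (x, x, 0, 1) \<ge> 0 \<and> norm (stY (x, x, 0, 1) - stX (x, x, 0, 1) - stS (x, x, 0, 1)) \<le> real 0 * h * L)"
    unfolding chain.simps by (rule AE_distr_iff) measurable
  ultimately show ?case by simp
next
  case (Suc k)
  show ?case
  proof (rule AE_chain_Suc[OF t0 Suc])
    fix s :: "'a state" and z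
    assume s: "stR s \<ge> 0 \<and> norm (stY s - stX s - stS s) \<le> real k * h * L"
    let ?t = "t0 + real k * h"
    have "stY s + h *\<^sub>R v ?t (stY s) + sqrt h *\<^sub>R z - stX s - (stS s + sqrt h *\<^sub>R z) = (stY s - stX s - stS s) + h *\<^sub>R v ?t (stY s)"
      by simp
    moreover have "norm ((stY s - stX s - stS s) + h *\<^sub>R v ?t (stY s)) \<le> real k * h * L + h * L"
      using s h norm_v_le[of ?t "stY s"]
      by (intro order_trans[OF norm_triangle_ineq] add_mono) (auto intro!: mult_left_mono)
    ultimately show "stR (step ?t h s z) \<ge> 0 \<and> norm (stY (step ?t h s z) - stX (step ?t h s z) - stS (step ?t h s z)) \<le> real (Suc k) * h * L"
      using s wt_nonneg by (simp add: algebra_simps)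
  qed measurable
qed

text \<open>The weights undo the discretisation exactly: each \<open>wt\<close> turns an Euler
  transition into \<open>rho\<close>, and \<open>rho\<close> carries one \<open>law\<close> to the
  next. No limit in the step size is involved.\<close>

lemma nn_integral_chain_law:
  assumes t0: "0 \<le> t0" and h: "0 \<le> h" and k: "t0 + real k * h \<le> 1" and [measurable]: "\<phi> \<in> borel_measurable borel"
  shows "(\<integral>\<^sup>+s. ennreal (stR s) * \<phi> (stY s) \<partial>chain t0 h k) = (\<integral>\<^sup>+y. \<phi> y \<partial>law (t0 + real k * h))"
  using k assms(4)
proof (induction k arbitrary: \<phi>)
  case 0
  have [measurable]: "\<phi> \<in> borel_measurable borel" by fact
  show ?case by (simp add: nn_integral_distr) (simp add: stY_def stR_def)
next
  case (Suc k)
  have [measurable]: "\<phi> \<in> borel_measurable borel" by fact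
  have k: "t0 + real k * h \<le> 1" and k': "t0 + real k * h + h \<le> 1" using Suc.prems h by (auto simp: algebra_simps)
  have t1: "t0 \<le> 1" using k h mult_nonneg_nonneg[of "real k" h] by linarith
  let ?t = "t0 + real k * h"
  have t: "0 \<le> ?t" using t0 h by simp
  let ?\<psi> = "\<lambda>y. \<integral>\<^sup>+z. ennreal (rho ?t h y z) * \<phi> (y + sqrt h *\<^sub>R z) \<partial>std_gaussian"
  have "(\<integral>\<^sup>+s. ennreal (stR s) * \<phi> (stY s) \<partial>chain t0 h (Suc k)) =
     (\<integral>\<^sup>+s. \<integral>\<^sup>+z. ennreal (stR s * wt ?t h (stY s) z) * \<phi> (stY s + h *\<^sub>R v ?t (stY s) + sqrt h *\<^sub>R z) \<partial>std_gaussian \<partial>chain t0 h k)"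
    by (subst nn_integral_chain_Suc[OF t0 t1]) auto
  also have "\<dots> = (\<integral>\<^sup>+s. ennreal (stR s) * ?\<psi> (stY s) \<partial>chain t0 h k)"
  proof (rule nn_integral_cong_AE)
    show "AE s in chain t0 h k. (\<integral>\<^sup>+z. ennreal (stR s * wt ?t h (stY s) z) * \<phi> (stY s + h *\<^sub>R v ?t (stY s) + sqrt h *\<^sub>R z) \<partial>std_gaussian)
        = ennreal (stR s) * ?\<psi> (stY s)"
      using chain_bounds[OF t0 t1 h, of k]
    proof eventually_elim
      fix s :: "'a state" assume "stR s \<ge> 0 \<and> norm (stY s - stX s - stS s) \<le> real k * h * L"
      then have "(\<integral>\<^sup>+z. ennreal (stR s * wt ?t h (stY s) z) * \<phi> (stY s + h *\<^sub>R v ?t (stY s) + sqrt h *\<^sub>R z) \<partial>std_gaussian)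
         = (\<integral>\<^sup>+z. ennreal (stR s) * (ennreal (wt ?t h (stY s) z) * \<phi> (stY s + h *\<^sub>R v ?t (stY s) + sqrt h *\<^sub>R z)) \<partial>std_gaussian)"
        using wt_nonneg by (simp add: ennreal_mult mult.assoc)
      also have "\<dots> = ennreal (stR s) * ?\<psi> (stY s)"
        by (subst nn_integral_cmult) (auto simp: nn_integral_wt[OF h])
      finally show "(\<integral>\<^sup>+z. ennreal (stR s * wt ?t h (stY s) z) * \<phi> (stY s + h *\<^sub>R v ?t (stY s) + sqrt h *\<^sub>R z) \<partial>std_gaussian)
        = ennreal (stR s) * ?\<psi> (stY s)" .
    qed
  qed
  also have "\<dots> = (\<integral>\<^sup>+y. ?\<psi> y \<partial>law ?t)" by (rule Suc.IH[OF k]) measurable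
  also have "\<dots> = (\<integral>\<^sup>+y. \<phi> y \<partial>law (?t + h))" by (rule nn_integral_law_step[OF t h k']) measurable
  finally show ?case by (simp add: algebra_simps)
qed

text \<open>Without weights the noise never sees the drift, so the start and the noise are
  independent and the Gaussian increments add up.\<close>

lemma nn_integral_chain_noise:
  assumes t0: "0 \<le> t0" "t0 \<le> 1" and h: "0 \<le> h" and [measurable]: "\<psi> \<in> borel_measurable (borel \<Otimes>\<^sub>M borel)"
  shows "(\<integral>\<^sup>+s. \<psi> (stX s, stS s) \<partial>chain t0 h k) = (\<integral>\<^sup>+x. \<integral>\<^sup>+z. \<psi> (x, sqrt (real k * h) *\<^sub>R z) \<partial>std_gaussian \<partial>law t0)"
  using assms(4)
proof (induction k arbitrary: \<psi>)
  case 0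
  have [measurable]: "\<psi> \<in> borel_measurable (borel \<Otimes>\<^sub>M borel)" by fact
  show ?case by (simp add: nn_integral_distr emeasure_std_gaussian_UNIV) (simp add: stX_def stS_def)
next
  case (Suc k)
  have [measurable]: "\<psi> \<in> borel_measurable (borel \<Otimes>\<^sub>M borel)" by fact
  have "(\<integral>\<^sup>+s. \<psi> (stX s, stS s) \<partial>chain t0 h (Suc k)) = (\<integral>\<^sup>+s. \<integral>\<^sup>+z. \<psi> (stX s, stS s + sqrt h *\<^sub>R z) \<partial>std_gaussian \<partial>chain t0 h k)"
    by (subst nn_integral_chain_Suc[OF t0]) auto
  also have "\<dots> = (\<integral>\<^sup>+x. \<integral>\<^sup>+z. \<integral>\<^sup>+z'. \<psi> (x, sqrt (real k * h) *\<^sub>R z + sqrt h *\<^sub>R z') \<partial>std_gaussian \<partial>std_gaussian \<partial>law t0)"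
    using Suc.IH[of "\<lambda>p. \<integral>\<^sup>+z. \<psi> (fst p, snd p + sqrt h *\<^sub>R z) \<partial>std_gaussian"] by simp
  also have "\<dots> = (\<integral>\<^sup>+x. \<integral>\<^sup>+z. \<psi> (x, sqrt (real (Suc k) * h) *\<^sub>R z) \<partial>std_gaussian \<partial>law t0)"
  proof (rule nn_integral_cong)
    fix x
    have m: "(\<lambda>w. \<psi> (x, w)) \<in> borel_measurable borel" by measurable
    show "(\<integral>\<^sup>+z. \<integral>\<^sup>+z'. \<psi> (x, sqrt (real k * h) *\<^sub>R z + sqrt h *\<^sub>R z') \<partial>std_gaussian \<partial>std_gaussian) =
        (\<integral>\<^sup>+z. \<psi> (x, sqrt (real (Suc k) * h) *\<^sub>R z) \<partial>std_gaussian)"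
      using nn_integral_std_gaussian_add[OF m, of "real k * h" h] h by (simp add: algebra_simps)
  qed
  finally show ?case .
qed

text \<open>The one-step bounds are uniform in the current point, so second moments multiply along
  the chain; \<open>1 + c <= exp c\<close> turns the product into a sum.\<close>

lemma nn_integral_chain_sq_le:
  assumes t0: "0 \<le> t0" "t0 \<le> 1" and h: "0 \<le> h" and c: "\<And>j. c j \<ge> 0"
    and le: "\<And>j y. j < k \<Longrightarrow> (\<integral>\<^sup>+z. ennreal ((wt (t0 + real j * h) h y z)\<^sup>2) \<partial>std_gaussian) \<le> ennreal (1 + c j)"
  shows "(\<integral>\<^sup>+s. ennreal ((stR s)\<^sup>2) \<partial>chain t0 h k) \<le> ennreal (exp (\<Sum>j<k. c j))"
  using le
proof (induction k)
  case 0
  interpret prob_space "law t0" by (rule prob_space_law[OF t0])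
  show ?case using emeasure_space_1 by (simp add: nn_integral_distr) (simp add: stR_def)
next
  case (Suc k)
  have "(\<integral>\<^sup>+s. ennreal ((stR s)\<^sup>2) \<partial>chain t0 h (Suc k)) =
      (\<integral>\<^sup>+s. \<integral>\<^sup>+z. ennreal ((stR s)\<^sup>2) * ennreal ((wt (t0 + real k * h) h (stY s) z)\<^sup>2) \<partial>std_gaussian \<partial>chain t0 h k)"
    by (subst nn_integral_chain_Suc[OF t0]) (auto simp: power_mult_distrib ennreal_mult)
  also have "\<dots> = (\<integral>\<^sup>+s. ennreal ((stR s)\<^sup>2) * (\<integral>\<^sup>+z. ennreal ((wt (t0 + real k * h) h (stY s) z)\<^sup>2) \<partial>std_gaussian) \<partial>chain t0 h k)"
    by (intro nn_integral_cong nn_integral_cmult) measurable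
  also have "\<dots> \<le> (\<integral>\<^sup>+s. ennreal ((stR s)\<^sup>2) * ennreal (1 + c k) \<partial>chain t0 h k)"
    using Suc.prems by (intro nn_integral_mono mult_left_mono) auto
  also have "\<dots> = (\<integral>\<^sup>+s. ennreal ((stR s)\<^sup>2) \<partial>chain t0 h k) * ennreal (1 + c k)"
    by (rule nn_integral_multc) measurable
  also have "\<dots> \<le> ennreal (exp (\<Sum>j<k. c j)) * ennreal (exp (c k))"
    using Suc.prems by (intro mult_mono Suc.IH ennreal_leI exp_ge_add_one_self) auto
  finally show ?case by (simp add: ennreal_mult[symmetric] exp_add)
qed

end

section \<open>The energy of the drift and its monotonicity\<close>

context normalized_potential
begin

definition m :: "real \<Rightarrow> real" where
  "m t = (\<integral>y. (norm (v t y))\<^sup>2 \<partial>law t)"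

lemma norm_v_sq_le: "(norm (v t y))\<^sup>2 \<le> L\<^sup>2"
  by (intro power_mono norm_v_le) simp

lemma integrable_norm_v_sq:
  assumes "0 \<le> t" "t \<le> 1"
  shows "integrable (law t) (\<lambda>y. (norm (v t y))\<^sup>2)"
proof -
  interpret prob_space "law t" by (rule prob_space_law[OF assms])
  show ?thesis by (rule integrable_const_bound[where B="L\<^sup>2"]) (auto simp: norm_v_sq_le)
qed

lemma m_nonneg: "m t \<ge> 0"
  unfolding m_def by (rule integral_nonneg_AE) auto

lemma nn_integral_m:
  assumes "0 \<le> t" "t \<le> 1"
  shows "(\<integral>\<^sup>+y. ennreal ((norm (v t y))\<^sup>2) \<partial>law t) = ennreal (m t)"
  unfolding m_def by (rule nn_integral_eq_integral[OF integrable_norm_v_sq[OF assms]]) auto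

lemma integral_rho_v:
  assumes t: "0 \<le> t" "0 \<le> h" "t + h \<le> 1"
  shows "has_bochner_integral std_gaussian (\<lambda>z. rho t h y z *\<^sub>R v (t + h) (y + sqrt h *\<^sub>R z)) (v t y)"
  using integral_wt_v[OF t, of y] integral_wt[OF t(2) borel_measurable_v, of t y "t + h"]
    integrable_wt[OF t(2) borel_measurable_v, of t y "t + h"]
  by (simp add: has_bochner_integral_iff)

text \<open>Jensen's inequality for the martingale \<open>v\<close>. The conditional form is
  obtained by integrating \<open>2 * (a \<bullet> w) - |a|^2 <= |w|^2\<close> against
  \<open>rho\<close>, with \<open>a\<close> the drift at the current point.\<close>

lemma m_mono:
  assumes t: "0 \<le> t" "t \<le> t'" "t' \<le> 1"
  shows "m t \<le> m t'"
proof -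
  define h where "h = t' - t"
  have h: "0 \<le> h" "t + h \<le> 1" "t' = t + h" "t \<le> 1" using t by (auto simp: h_def)
  have pt: "ennreal ((norm (v t y))\<^sup>2) \<le> (\<integral>\<^sup>+z. ennreal (rho t h y z) * ennreal ((norm (v (t + h) (y + sqrt h *\<^sub>R z)))\<^sup>2) \<partial>std_gaussian)" for y
  proof -
    let ?a = "v t y" and ?w = "\<lambda>z. v (t + h) (y + sqrt h *\<^sub>R z)"
    have r: "integrable std_gaussian (rho t h y)" "(\<integral>z. rho t h y z \<partial>std_gaussian) = 1" using integral_rho[OF t(1) h(1,2)] by auto
    have i: "integrable std_gaussian (\<lambda>z. rho t h y z * (norm (?w z))\<^sup>2)"
    proof (rule Bochner_Integration.integrable_bound)
      show "integrable std_gaussian (\<lambda>z. rho t h y z * L\<^sup>2)" using r by simp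
      show "AE z in std_gaussian. norm (rho t h y z * (norm (?w z))\<^sup>2) \<le> norm (rho t h y z * L\<^sup>2)"
        using rho_nonneg norm_v_sq_le by (auto simp: abs_mult intro!: mult_left_mono)
    qed measurable
    have hb: "has_bochner_integral std_gaussian (\<lambda>z. 2 * (?a \<bullet> (rho t h y z *\<^sub>R ?w z)) - (norm ?a)\<^sup>2 * rho t h y z) (2 * (?a \<bullet> ?a) - (norm ?a)\<^sup>2 * 1)"
      by (intro has_bochner_integral_diff has_bochner_integral_mult_right has_bochner_integral_inner_right integral_rho_v[OF t(1) h(1,2)])
        (use r in \<open>simp_all add: has_bochner_integral_iff\<close>)
    have "(norm ?a)\<^sup>2 = (\<integral>z. 2 * (?a \<bullet> (rho t h y z *\<^sub>R ?w z)) - (norm ?a)\<^sup>2 * rho t h y z \<partial>std_gaussian)"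
      using has_bochner_integral_integral_eq[OF hb] by (simp add: power2_norm_eq_inner)
    also have "\<dots> \<le> (\<integral>z. rho t h y z * (norm (?w z))\<^sup>2 \<partial>std_gaussian)"
    proof (rule integral_mono[OF _ i])
      show "integrable std_gaussian (\<lambda>z. 2 * (?a \<bullet> (rho t h y z *\<^sub>R ?w z)) - (norm ?a)\<^sup>2 * rho t h y z)"
        using hb by (simp add: has_bochner_integral_iff)
      fix z
      have "0 \<le> (norm (?w z - ?a))\<^sup>2" by simp
      then have "2 * (?a \<bullet> ?w z) - (norm ?a)\<^sup>2 \<le> (norm (?w z))\<^sup>2"
        by (simp add: power2_norm_eq_inner inner_diff inner_commute)
      then have "rho t h y z * (2 * (?a \<bullet> ?w z) - (norm ?a)\<^sup>2) \<le> rho t h y z * (norm (?w z))\<^sup>2"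
        by (rule mult_left_mono) (rule rho_nonneg)
      then show "2 * (?a \<bullet> (rho t h y z *\<^sub>R ?w z)) - (norm ?a)\<^sup>2 * rho t h y z \<le> rho t h y z * (norm (?w z))\<^sup>2"
        by (simp add: algebra_simps)
    qed
    finally have "ennreal ((norm ?a)\<^sup>2) \<le> ennreal (\<integral>z. rho t h y z * (norm (?w z))\<^sup>2 \<partial>std_gaussian)" by (rule ennreal_leI)
    also have "\<dots> = (\<integral>\<^sup>+z. ennreal (rho t h y z * (norm (?w z))\<^sup>2) \<partial>std_gaussian)"
      using i rho_nonneg by (intro nn_integral_eq_integral[symmetric]) auto
    finally show ?thesis using rho_nonneg by (simp add: ennreal_mult)
  qed
  have "ennreal (m t) \<le> (\<integral>\<^sup>+y. (\<integral>\<^sup>+z. ennreal (rho t h y z) * ennreal ((norm (v (t + h) (y + sqrt h *\<^sub>R z)))\<^sup>2) \<partial>std_gaussian) \<partial>law t)"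
    unfolding nn_integral_m[OF t(1) h(4), symmetric] by (intro nn_integral_mono pt)
  also have "\<dots> = (\<integral>\<^sup>+y. ennreal ((norm (v (t + h) y))\<^sup>2) \<partial>law (t + h))"
    by (rule nn_integral_law_step[OF t(1) h(1,2)]) measurable
  also have "\<dots> = ennreal (m (t + h))" using t h by (intro nn_integral_m) auto
  finally show ?thesis using m_nonneg h by simp
qed

end

section \<open>Exact identities under the weights of a fixed chain\<close>

locale tilted_chain = normalized_potential +
  fixes t0 h :: real and N :: nat
  assumes t0: "0 \<le> t0" and h: "0 \<le> h" and horizon: "t0 + real N * h \<le> 1"
begin

abbreviation "tk k \<equiv> t0 + real k * h"
abbreviation "Q k \<equiv> chain t0 h k"

lemma t0_le: "t0 \<le> 1"
  using horizon h mult_nonneg_nonneg[of "real N" h] by linarith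

lemma tk: "k \<le> N \<Longrightarrow> 0 \<le> tk k" "k \<le> N \<Longrightarrow> tk k \<le> 1"
proof -
  assume "k \<le> N"
  then have "real k * h \<le> real N * h" using h by (intro mult_right_mono) auto
  then show "tk k \<le> 1" using horizon by linarith
  show "0 \<le> tk k" using t0 h by simp
qed

lemma tk_Suc: "Suc k \<le> N \<Longrightarrow> tk k + h \<le> 1" "tk (Suc k) = tk k + h"
  using tk[of "Suc k"] by (auto simp: algebra_simps)

sublocale Q: prob_space "Q k" for k by (rule prob_space_chain[OF t0 t0_le])

lemma AE_R: "AE s in Q k. 0 \<le> stR s"
  using chain_bounds[OF t0 t0_le h, of k] by eventually_elim simp

lemma has_integral_R: assumes "k \<le> N" shows "integrable (Q k) stR" "(\<integral>s. stR s \<partial>Q k) = 1"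
proof -
  interpret l: prob_space "law (tk k)" using tk[OF assms] by (intro prob_space_law)
  have e: "(\<integral>\<^sup>+s. ennreal (stR s) \<partial>Q k) = ennreal 1"
    using nn_integral_chain_law[OF t0 h, of k "\<lambda>_. 1"] tk[OF assms] l.emeasure_space_1 by simp
  show i: "integrable (Q k) stR"
    using e AE_R by (intro integrableI_nn_integral_finite[where x=1]) auto
  show "(\<integral>s. stR s \<partial>Q k) = 1"
    using e AE_R by (intro integral_eq_nn_integral[THEN trans]) auto
qed

lemma integrable_R_mult:
  fixes \<theta> :: "'a state \<Rightarrow> real"
  assumes k: "k \<le> N" and [measurable]: "\<theta> \<in> borel_measurable borel" and b: "AE s in Q k. \<bar>\<theta> s\<bar> \<le> C"
  shows "integrable (Q k) (\<lambda>s. stR s * \<theta> s)"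
proof (rule Bochner_Integration.integrable_bound)
  show "integrable (Q k) (\<lambda>s. stR s * C)" using has_integral_R[OF k] by simp
  show "AE s in Q k. norm (stR s * \<theta> s) \<le> norm (stR s * C)"
    using b by eventually_elim (auto simp: abs_mult intro!: mult_left_mono)
qed measurable

lemma distr_tilted_Y:
  assumes k: "k \<le> N"
  shows "distr (density (Q k) (\<lambda>s. ennreal (stR s))) borel stY = law (tk k)"
proof (rule measure_eqI)
  fix A assume "A \<in> sets (distr (density (Q k) (\<lambda>s. ennreal (stR s))) borel stY)"
  then have [measurable]: "A \<in> sets borel" by simp
  have "emeasure (distr (density (Q k) (\<lambda>s. ennreal (stR s))) borel stY) A = (\<integral>\<^sup>+s. ennreal (stR s) * indicator A (stY s) \<partial>Q k)"
    by (simp add: nn_integral_indicator[symmetric] nn_integral_distr nn_integral_density del: nn_integral_indicator)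
  also have "\<dots> = (\<integral>\<^sup>+y. indicator A y \<partial>law (tk k))"
    using tk[OF k] by (intro nn_integral_chain_law[OF t0 h]) auto
  finally show "emeasure (distr (density (Q k) (\<lambda>s. ennreal (stR s))) borel stY) A = emeasure (law (tk k)) A" by simp
qed simp

lemma integral_R_Y:
  fixes \<phi> :: "'a \<Rightarrow> real"
  assumes k: "k \<le> N" and [measurable]: "\<phi> \<in> borel_measurable borel"
  shows "(\<integral>s. stR s * \<phi> (stY s) \<partial>Q k) = (\<integral>y. \<phi> y \<partial>law (tk k))"
  unfolding distr_tilted_Y[OF k, symmetric] by (simp add: integral_distr integral_density AE_R)

text \<open>The last weight has conditional mean one, so it drops out for quantities already
  determined one step earlier. \<open>\<theta>'\<close> is such a quantity written in the new state,
  for example the accumulated drift, from which the new noise cancels.\<close>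

lemma integral_R_pull:
  fixes \<theta> \<theta>' :: "'a state \<Rightarrow> real"
  assumes k: "Suc k \<le> N" and [measurable]: "\<theta> \<in> borel_measurable borel" "\<theta>' \<in> borel_measurable borel"
    and b: "AE s in Q k. \<bar>\<theta> s\<bar> \<le> C" and eq: "\<And>s z. \<theta>' (step (tk k) h s z) = \<theta> s"
  shows "(\<integral>s. stR s * \<theta>' s \<partial>Q (Suc k)) = (\<integral>s. stR s * \<theta> s \<partial>Q k)"
proof -
  have "AE s in Q (Suc k). \<bar>\<theta>' s\<bar> \<le> C"
    by (rule AE_chain_Suc[OF t0 t0_le b]) (use eq in auto)
  then have "integrable (Q (Suc k)) (\<lambda>s. stR s * \<theta>' s)" by (rule integrable_R_mult[OF k, rotated]) measurable
  from integral_chain_Suc[OF t0 t0_le this]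
  have "(\<integral>s. stR s * \<theta>' s \<partial>Q (Suc k)) = (\<integral>s. \<integral>z. stR s * wt (tk k) h (stY s) z * \<theta> s \<partial>std_gaussian \<partial>Q k)"
    by (simp add: eq)
  also have "\<dots> = (\<integral>s. stR s * \<theta> s \<partial>Q k)"
    using integral_wt_1[OF tk(1) h tk_Suc(1)[OF k]] k by (intro Bochner_Integration.integral_cong) auto
  finally show ?thesis .
qed

text \<open>Under the weights \<open>v\<close> is a martingale, so its pairing with a quantity known
  one step earlier may be evaluated one step earlier.\<close>

lemma integral_R_martingale:
  fixes \<Theta> \<Theta>' :: "'a state \<Rightarrow> 'a"
  assumes k: "Suc k \<le> N" and [measurable]: "\<Theta> \<in> borel_measurable borel" "\<Theta>' \<in> borel_measurable borel"
    and b: "AE s in Q k. norm (\<Theta> s) \<le> C" and eq: "\<And>s z. \<Theta>' (step (tk k) h s z) = \<Theta> s"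
  shows "(\<integral>s. stR s * (v (tk (Suc k)) (stY s) \<bullet> \<Theta>' s) \<partial>Q (Suc k)) = (\<integral>s. stR s * (v (tk k) (stY s) \<bullet> \<Theta> s) \<partial>Q k)"
proof -
  let ?y = "\<lambda>s z. stY s + h *\<^sub>R v (tk k) (stY s) + sqrt h *\<^sub>R z"
  have "AE s in Q (Suc k). norm (\<Theta>' s) \<le> C"
    by (rule AE_chain_Suc[OF t0 t0_le b]) (use eq in auto)
  then have "AE s in Q (Suc k). \<bar>v (tk (Suc k)) (stY s) \<bullet> \<Theta>' s\<bar> \<le> L * C"
  proof eventually_elim
    fix s assume "norm (\<Theta>' s) \<le> C"
    then have "norm (v (tk (Suc k)) (stY s)) * norm (\<Theta>' s) \<le> L * C"
      using norm_v_le L_nonneg by (intro mult_mono) auto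
    then show "\<bar>v (tk (Suc k)) (stY s) \<bullet> \<Theta>' s\<bar> \<le> L * C"
      using Cauchy_Schwarz_ineq2 order_trans by blast
  qed
  then have "integrable (Q (Suc k)) (\<lambda>s. stR s * (v (tk (Suc k)) (stY s) \<bullet> \<Theta>' s))"
    by (rule integrable_R_mult[OF k, rotated]) measurable
  from integral_chain_Suc[OF t0 t0_le this]
  have "(\<integral>s. stR s * (v (tk (Suc k)) (stY s) \<bullet> \<Theta>' s) \<partial>Q (Suc k)) =
      (\<integral>s. \<integral>z. stR s * ((wt (tk k) h (stY s) z *\<^sub>R v (tk k + h) (?y s z)) \<bullet> \<Theta> s) \<partial>std_gaussian \<partial>Q k)"
    by (simp add: eq tk_Suc(2)[symmetric] mult.assoc del: of_nat_Suc)
  also have "\<dots> = (\<integral>s. stR s * (v (tk k) (stY s) \<bullet> \<Theta> s) \<partial>Q k)"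
  proof (rule Bochner_Integration.integral_cong[OF refl])
    fix s
    have "has_bochner_integral std_gaussian (\<lambda>z. (wt (tk k) h (stY s) z *\<^sub>R v (tk k + h) (?y s z)) \<bullet> \<Theta> s) (v (tk k) (stY s) \<bullet> \<Theta> s)"
      using integral_wt_v[OF tk(1) h tk_Suc(1)[OF k], of "stY s"] k
      by (intro has_bochner_integral_inner_left) (simp add: has_bochner_integral_iff)
    then show "(\<integral>z. stR s * ((wt (tk k) h (stY s) z *\<^sub>R v (tk k + h) (?y s z)) \<bullet> \<Theta> s) \<partial>std_gaussian) = stR s * (v (tk k) (stY s) \<bullet> \<Theta> s)"
      by (simp add: has_bochner_integral_iff)
  qed
  finally show ?thesis .
qed

lemma integral_R_v_sq: "k \<le> N \<Longrightarrow> (\<integral>s. stR s * (norm (v (tk k) (stY s)))\<^sup>2 \<partial>Q k) = m (tk k)"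
  unfolding m_def by (rule integral_R_Y) auto

lemma integral_R_v_v0:
  assumes "k \<le> N"
  shows "(\<integral>s. stR s * (v (tk k) (stY s) \<bullet> v t0 (stX s)) \<partial>Q k) = m t0"
  using assms
proof (induction k)
  case 0
  show ?case unfolding m_def by (simp add: integral_distr) (simp add: stR_def stX_def stY_def power2_norm_eq_inner)
next
  case (Suc k)
  have "(\<integral>s. stR s * (v (tk (Suc k)) (stY s) \<bullet> v t0 (stX s)) \<partial>Q (Suc k)) = (\<integral>s. stR s * (v (tk k) (stY s) \<bullet> v t0 (stX s)) \<partial>Q k)"
    by (rule integral_R_martingale[OF Suc.prems, where C=L]) (auto simp: norm_v_le)
  then show ?case using Suc by simp
qed

text \<open>The drift increment of a step is known before its noise, so the martingale property
  pulls the final \<open>v\<close> back to that step and leaves \<open>h\<close> times the energy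
  there. The sum is the discrete form of the integral of \<open>m\<close>.\<close>

lemma integral_R_v_drift:
  assumes "k \<le> N"
  shows "(\<integral>s. stR s * (v (tk k) (stY s) \<bullet> (stY s - stX s - stS s)) \<partial>Q k) = h * (\<Sum>j<k. m (tk j))"
  using assms
proof (induction k)
  case 0
  show ?case by (simp add: integral_distr) (simp add: stR_def stX_def stY_def stS_def)
next
  case (Suc k)
  have k: "k \<le> N" using Suc.prems by simp
  have b: "AE s in Q k. norm (stY s - stX s - stS s) \<le> real k * h * L"
    using chain_bounds[OF t0 t0_le h, of k] by eventually_elim simp
  have i1: "integrable (Q k) (\<lambda>s. stR s * (v (tk k) (stY s) \<bullet> (stY s - stX s - stS s)))"
  proof (rule integrable_R_mult[OF k])
    show "AE s in Q k. \<bar>v (tk k) (stY s) \<bullet> (stY s - stX s - stS s)\<bar> \<le> L * (real k * h * L)"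
      using b
    proof eventually_elim
      fix s :: "'a state" assume "norm (stY s - stX s - stS s) \<le> real k * h * L"
      then have "norm (v (tk k) (stY s)) * norm (stY s - stX s - stS s) \<le> L * (real k * h * L)"
        using norm_v_le L_nonneg by (intro mult_mono) auto
      then show "\<bar>v (tk k) (stY s) \<bullet> (stY s - stX s - stS s)\<bar> \<le> L * (real k * h * L)"
        using Cauchy_Schwarz_ineq2 order_trans by blast
    qed
  qed measurable
  have i2: "integrable (Q k) (\<lambda>s. stR s * (norm (v (tk k) (stY s)))\<^sup>2)"
    by (rule integrable_R_mult[OF k, where C="L\<^sup>2"]) (auto simp: norm_v_sq_le)
  have "(\<integral>s. stR s * (v (tk (Suc k)) (stY s) \<bullet> (stY s - stX s - stS s)) \<partial>Q (Suc k)) =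
      (\<integral>s. stR s * (v (tk k) (stY s) \<bullet> ((stY s - stX s - stS s) + h *\<^sub>R v (tk k) (stY s))) \<partial>Q k)"
  proof (rule integral_R_martingale[OF Suc.prems])
    show "AE s in Q k. norm ((stY s - stX s - stS s) + h *\<^sub>R v (tk k) (stY s)) \<le> real k * h * L + h * L"
      using b
    proof eventually_elim
      fix s :: "'a state" assume "norm (stY s - stX s - stS s) \<le> real k * h * L"
      then show "norm ((stY s - stX s - stS s) + h *\<^sub>R v (tk k) (stY s)) \<le> real k * h * L + h * L"
        using h norm_v_le[of "tk k" "stY s"]
        by (intro order_trans[OF norm_triangle_ineq] add_mono) (auto intro!: mult_left_mono)
    qed
  qed (auto simp: algebra_simps)
  also have "\<dots> = (\<integral>s. stR s * (v (tk k) (stY s) \<bullet> (stY s - stX s - stS s)) + h * (stR s * (norm (v (tk k) (stY s)))\<^sup>2) \<partial>Q k)"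
    by (intro Bochner_Integration.integral_cong) (auto simp: inner_add_right power2_norm_eq_inner algebra_simps)
  also have "\<dots> = h * (\<Sum>j<k. m (tk j)) + h * m (tk k)"
    using i1 i2 Suc.IH[OF k] integral_R_v_sq[OF k] by simp
  finally show ?case by (simp add: distrib_left)
qed

text \<open>Orthogonality of martingale increments: the cross term equals the initial
  energy.\<close>

lemma integral_R_v_diff_sq:
  assumes k: "k \<le> N"
  shows "(\<integral>s. stR s * (norm (v (tk k) (stY s) - v t0 (stX s)))\<^sup>2 \<partial>Q k) = m (tk k) - m t0"
proof -
  have i1: "integrable (Q k) (\<lambda>s. stR s * (norm (v (tk k) (stY s)))\<^sup>2)"
    by (rule integrable_R_mult[OF k, where C="L\<^sup>2"]) (auto simp: norm_v_sq_le)
  have i3: "integrable (Q k) (\<lambda>s. stR s * (norm (v t0 (stX s)))\<^sup>2)"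
    by (rule integrable_R_mult[OF k, where C="L\<^sup>2"]) (auto simp: norm_v_sq_le)
  have i2: "integrable (Q k) (\<lambda>s. stR s * (v (tk k) (stY s) \<bullet> v t0 (stX s)))"
  proof (rule integrable_R_mult[OF k, where C="L * L"])
    show "AE s in Q k. \<bar>v (tk k) (stY s) \<bullet> v t0 (stX s)\<bar> \<le> L * L"
      using norm_v_le L_nonneg by (intro AE_I2 order_trans[OF Cauchy_Schwarz_ineq2] mult_mono) auto
  qed measurable
  have x: "(\<integral>s. stR s * (norm (v t0 (stX s)))\<^sup>2 \<partial>Q k) = m t0"
    using k
  proof (induction k)
    case 0
    show ?case unfolding m_def by (simp add: integral_distr) (simp add: stR_def stX_def)
  next
    case (Suc k)
    have "(\<integral>s. stR s * (norm (v t0 (stX s)))\<^sup>2 \<partial>Q (Suc k)) = (\<integral>s. stR s * (norm (v t0 (stX s)))\<^sup>2 \<partial>Q k)"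
      by (rule integral_R_pull[OF Suc.prems, where C="L\<^sup>2"]) (auto simp: norm_v_sq_le)
    then show ?case using Suc by simp
  qed
  have "(\<integral>s. stR s * (norm (v (tk k) (stY s) - v t0 (stX s)))\<^sup>2 \<partial>Q k) =
     (\<integral>s. stR s * (norm (v (tk k) (stY s)))\<^sup>2 - 2 * (stR s * (v (tk k) (stY s) \<bullet> v t0 (stX s))) + stR s * (norm (v t0 (stX s)))\<^sup>2 \<partial>Q k)"
    by (intro Bochner_Integration.integral_cong) (auto simp: power2_norm_eq_inner inner_diff inner_commute algebra_simps)
  also have "\<dots> = m (tk k) - 2 * m t0 + m t0"
    using i1 i2 i3 x integral_R_v_sq[OF k] integral_R_v_v0[OF k] by simp
  finally show ?thesis by simp
qed

lemma norm_add_sq_weighted: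
  fixes p q :: 'a
  assumes "c > 0"
  shows "(norm (p + q))\<^sup>2 \<le> (1 + 1 / c) * (norm p)\<^sup>2 + (1 + c) * (norm q)\<^sup>2"
proof -
  have "0 \<le> (norm ((1 / sqrt c) *\<^sub>R p - sqrt c *\<^sub>R q))\<^sup>2" by simp
  also have "\<dots> = (norm p)\<^sup>2 / c - 2 * (p \<bullet> q) + c * (norm q)\<^sup>2"
    using assms unfolding power2_norm_eq_inner
    by (simp add: inner_diff inner_commute power2_eq_square[symmetric] field_simps)
  finally have "2 * (p \<bullet> q) \<le> (norm p)\<^sup>2 / c + c * (norm q)\<^sup>2" by simp
  moreover have "(norm (p + q))\<^sup>2 = (norm p)\<^sup>2 + 2 * (p \<bullet> q) + (norm q)\<^sup>2"
    by (simp add: power2_norm_eq_inner inner_add inner_commute)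
  ultimately show ?thesis by (simp add: distrib_right)
qed

text \<open>Minkowski's inequality for the accumulated drift error, by induction with the weights
  $1+1/k$ and $1+k$.\<close>

lemma integral_R_drift_error:
  assumes "k \<le> N"
  shows "(\<integral>s. stR s * (norm (stY s - stX s - stS s - (real k * h) *\<^sub>R v t0 (stX s)))\<^sup>2 \<partial>Q k) \<le> (real k * h)\<^sup>2 * (m (tk N) - m t0)"
  using assms
proof (induction k)
  case 0
  show ?case by (simp add: integral_distr) (simp add: stR_def stX_def stY_def stS_def)
next
  case (Suc k)
  have k: "k \<le> N" using Suc.prems by simp
  let ?p = "\<lambda>s. stY s - stX s - stS s - (real k * h) *\<^sub>R v t0 (stX s)"
  let ?q = "\<lambda>s. h *\<^sub>R (v (tk k) (stY s) - v t0 (stX s))"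
  let ?B = "m (tk N) - m t0"
  have dm: "m (tk k) - m t0 \<le> ?B"
  proof -
    have "real k * h \<le> real N * h" using k h by (intro mult_right_mono) auto
    then show ?thesis using m_mono[of "tk k" "tk N"] tk[OF k] horizon by simp
  qed
  have pb: "AE s in Q k. norm (?p s) \<le> real k * h * L + real k * h * L"
    using chain_bounds[OF t0 t0_le h, of k]
  proof eventually_elim
    fix s :: "'a state" assume s: "stR s \<ge> 0 \<and> norm (stY s - stX s - stS s) \<le> real k * h * L"
    have "norm ((real k * h) *\<^sub>R v t0 (stX s)) \<le> real k * h * L" using h norm_v_le by (auto intro!: mult_left_mono)
    then show "norm (?p s) \<le> real k * h * L + real k * h * L"
      using s norm_triangle_ineq4[of "stY s - stX s - stS s" "(real k * h) *\<^sub>R v t0 (stX s)"] by linarith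
  qed
  have qb: "norm (?q s) \<le> h * (L + L)" for s
    using h norm_v_le[of "tk k" "stY s"] norm_v_le[of t0 "stX s"] norm_triangle_ineq4[of "v (tk k) (stY s)" "v t0 (stX s)"]
    by (auto intro!: mult_left_mono)
  let ?C = "real k * h * L + real k * h * L + h * (L + L)"
  have pqb: "AE s in Q k. \<bar>(norm (?p s + ?q s))\<^sup>2\<bar> \<le> ?C\<^sup>2"
    using pb
  proof eventually_elim
    fix s assume "norm (?p s) \<le> real k * h * L + real k * h * L"
    then have "norm (?p s + ?q s) \<le> ?C" using qb[of s] by (intro order_trans[OF norm_triangle_ineq] add_mono)
    then show "\<bar>(norm (?p s + ?q s))\<^sup>2\<bar> \<le> ?C\<^sup>2" by (simp add: power_mono)
  qed
  have ip: "integrable (Q k) (\<lambda>s. stR s * (norm (?p s))\<^sup>2)"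
  proof (rule integrable_R_mult[OF k])
    show "AE s in Q k. \<bar>(norm (?p s))\<^sup>2\<bar> \<le> (real k * h * L + real k * h * L)\<^sup>2"
      using pb
    proof eventually_elim
      fix s assume "norm (?p s) \<le> real k * h * L + real k * h * L"
      from power_mono[OF this norm_ge_zero, of 2]
      show "\<bar>(norm (?p s))\<^sup>2\<bar> \<le> (real k * h * L + real k * h * L)\<^sup>2" by (simp only: abs_power2 abs_norm_cancel power2_abs)
    qed
  qed measurable
  have iq: "integrable (Q k) (\<lambda>s. stR s * (norm (?q s))\<^sup>2)"
  proof (rule integrable_R_mult[OF k])
    show "AE s in Q k. \<bar>(norm (?q s))\<^sup>2\<bar> \<le> (h * (L + L))\<^sup>2"
    proof (rule AE_I2)
      fix s show "\<bar>(norm (?q s))\<^sup>2\<bar> \<le> (h * (L + L))\<^sup>2" using power_mono[OF qb[of s], of 2] by simp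
    qed
  qed measurable
  have iq2: "(\<integral>s. stR s * (norm (?q s))\<^sup>2 \<partial>Q k) \<le> h\<^sup>2 * ?B"
  proof -
    have "(\<integral>s. stR s * (norm (?q s))\<^sup>2 \<partial>Q k) = (\<integral>s. h\<^sup>2 * (stR s * (norm (v (tk k) (stY s) - v t0 (stX s)))\<^sup>2) \<partial>Q k)"
      by (intro Bochner_Integration.integral_cong) (auto simp: power_mult_distrib mult_ac)
    also have "\<dots> = h\<^sup>2 * (m (tk k) - m t0)" using integral_R_v_diff_sq[OF k] by simp
    also have "\<dots> \<le> h\<^sup>2 * ?B" using dm by (intro mult_left_mono) auto
    finally show ?thesis .
  qed
  have "(\<integral>s. stR s * (norm (stY s - stX s - stS s - (real (Suc k) * h) *\<^sub>R v t0 (stX s)))\<^sup>2 \<partial>Q (Suc k)) =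
    (\<integral>s. stR s * (norm (?p s + ?q s))\<^sup>2 \<partial>Q k)"
  proof (rule integral_R_pull[OF Suc.prems _ _ pqb])
    fix s z
    have "stY (step (tk k) h s z) - stX (step (tk k) h s z) - stS (step (tk k) h s z) - (real (Suc k) * h) *\<^sub>R v t0 (stX (step (tk k) h s z)) = ?p s + ?q s"
      by (simp add: algebra_simps)
    then show "(norm (stY (step (tk k) h s z) - stX (step (tk k) h s z) - stS (step (tk k) h s z) - (real (Suc k) * h) *\<^sub>R v t0 (stX (step (tk k) h s z))))\<^sup>2 = (norm (?p s + ?q s))\<^sup>2"
      by (simp only:)
  qed measurable
  also have "\<dots> \<le> (real (Suc k) * h)\<^sup>2 * ?B"
  \<comment> \<open>The weight \<open>1 / k\<close> makes no sense at the first step, where the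
    accumulated error vanishes almost everywhere.\<close>
  proof (cases "k = 0")
    case True
    have "(\<integral>s. stR s * (norm (?p s + ?q s))\<^sup>2 \<partial>Q k) = (\<integral>s. stR s * (norm (?q s))\<^sup>2 \<partial>Q k)"
    proof (rule integral_cong_AE)
      show "AE s in Q k. stR s * (norm (?p s + ?q s))\<^sup>2 = stR s * (norm (?q s))\<^sup>2"
        using pb by eventually_elim (simp add: True)
    qed measurable
    then show ?thesis using iq2 True by simp
  next
    case False
    then have c: "real k > 0" by simp
    have ii: "integrable (Q k) (\<lambda>s. (1 + 1 / real k) * (stR s * (norm (?p s))\<^sup>2) + (1 + real k) * (stR s * (norm (?q s))\<^sup>2))"
      using ip iq by simp
    have "(\<integral>s. stR s * (norm (?p s + ?q s))\<^sup>2 \<partial>Q k) \<le> (\<integral>s. (1 + 1 / real k) * (stR s * (norm (?p s))\<^sup>2) + (1 + real k) * (stR s * (norm (?q s))\<^sup>2) \<partial>Q k)"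
    proof (rule integral_mono_AE[OF integrable_R_mult[OF k _ pqb] ii])
      show "AE s in Q k. stR s * (norm (?p s + ?q s))\<^sup>2 \<le> (1 + 1 / real k) * (stR s * (norm (?p s))\<^sup>2) + (1 + real k) * (stR s * (norm (?q s))\<^sup>2)"
        using AE_R[of k]
      proof eventually_elim
        fix s assume "0 \<le> stR s"
        from mult_left_mono[OF norm_add_sq_weighted[OF c] this, of "?p s" "?q s"]
        show "stR s * (norm (?p s + ?q s))\<^sup>2 \<le> (1 + 1 / real k) * (stR s * (norm (?p s))\<^sup>2) + (1 + real k) * (stR s * (norm (?q s))\<^sup>2)"
          by (simp only: distrib_left mult_ac)
      qed
    qed measurable
    also have "\<dots> = (1 + 1 / real k) * (\<integral>s. stR s * (norm (?p s))\<^sup>2 \<partial>Q k) + (1 + real k) * (\<integral>s. stR s * (norm (?q s))\<^sup>2 \<partial>Q k)"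
      using ip iq by (simp only: Bochner_Integration.integral_add integral_mult_right_zero integrable_mult_right)
    also have "\<dots> \<le> (1 + 1 / real k) * ((real k * h)\<^sup>2 * ?B) + (1 + real k) * (h\<^sup>2 * ?B)"
      using Suc.IH[OF k] iq2 c by (intro add_mono mult_left_mono) auto
    \<comment> \<open>\<open>(1 + 1/k) * k^2 + (1 + k) = (k + 1)^2\<close>: these weights reproduce
      the triangle inequality in L^2 without loss.\<close>
    also have "\<dots> = (real (Suc k) * h)\<^sup>2 * ?B"
      using c by (simp add: field_simps power2_eq_square)
    finally show ?thesis .
  qed
  finally show ?case .
qed

text \<open>The ratio has mean one, so its variance is its second moment minus 1.\<close>

lemma integral_R_minus_1_sq:
  assumes c: "\<And>j. c j \<ge> 0"
    and le: "\<And>j y. j < N \<Longrightarrow> (\<integral>\<^sup>+z. ennreal ((wt (tk j) h y z)\<^sup>2) \<partial>std_gaussian) \<le> ennreal (1 + c j)"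
  shows "integrable (Q N) (\<lambda>s. (stR s - 1)\<^sup>2)" "(\<integral>s. (stR s - 1)\<^sup>2 \<partial>Q N) \<le> exp (\<Sum>j<N. c j) - 1"
proof -
  have le2: "(\<integral>\<^sup>+s. ennreal ((stR s)\<^sup>2) \<partial>Q N) \<le> ennreal (exp (\<Sum>j<N. c j))"
    by (rule nn_integral_chain_sq_le[OF t0 t0_le h c le])
  have i: "integrable (Q N) (\<lambda>s. (stR s)\<^sup>2)"
    using le2 by (intro integrableI_bounded) (auto simp: less_top[symmetric] top_unique)
  have l: "(\<integral>s. (stR s)\<^sup>2 \<partial>Q N) \<le> exp (\<Sum>j<N. c j)"
    using le2 by (subst (asm) nn_integral_eq_integral[OF i]) auto
  have e: "(stR s - 1)\<^sup>2 = (stR s)\<^sup>2 - 2 * stR s + 1" for s by (simp add: power2_diff)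
  show "integrable (Q N) (\<lambda>s. (stR s - 1)\<^sup>2)"
    unfolding e using i has_integral_R[of N] by simp
  have "(\<integral>s. (stR s - 1)\<^sup>2 \<partial>Q N) = (\<integral>s. (stR s)\<^sup>2 \<partial>Q N) - 2 * 1 + 1"
    unfolding e using i has_integral_R[of N] Q.prob_space[of N] by simp
  then show "(\<integral>s. (stR s - 1)\<^sup>2 \<partial>Q N) \<le> exp (\<Sum>j<N. c j) - 1" using l by simp
qed

end

text \<open>With $N=q^3$ steps the crude bound on the last $q^2$ steps and the fine bound on the others
  give a total of order $1/q$.\<close>

lemma (in normalized_potential) chain_approximation:
  assumes t00: "0 \<le> t0" "t0 < 1" and \<eta>: "\<eta> > 0"
  obtains N where "N > 0" "integrable (chain t0 ((1 - t0) / real N) N) (\<lambda>s. (stR s - 1)\<^sup>2)"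
    "(\<integral>s. (stR s - 1)\<^sup>2 \<partial>chain t0 ((1 - t0) / real N) N) \<le> \<eta>"
proof -
  obtain Cc where Cc: "Cc \<ge> 0" "\<And>t h y. 0 \<le> t \<Longrightarrow> 0 \<le> h \<Longrightarrow> t + h \<le> 1 \<Longrightarrow>
      (\<integral>\<^sup>+z. ennreal ((wt t h y z)\<^sup>2) \<partial>std_gaussian) \<le> ennreal (1 + Cc * h)"
    using chi_square_crude by blast
  obtain Cf where Cf: "Cf \<ge> 0" "\<And>t h y. 0 \<le> t \<Longrightarrow> 0 < h \<Longrightarrow> 16 * h \<le> 1 - t - h \<Longrightarrow>
      (\<integral>\<^sup>+z. ennreal ((wt t h y z)\<^sup>2) \<partial>std_gaussian) \<le> ennreal (1 + Cf * (h / (1 - t - h))\<^sup>2)"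
    using chi_square_fine by blast
  have ln: "ln (1 + \<eta>) > 0" using \<eta> by simp
  obtain q0 :: nat where q0: "(Cc + Cf) / ln (1 + \<eta>) < real q0" using reals_Archimedean2 by blast
  \<comment> \<open>\<open>q >= 4\<close> gives \<open>q^2 >= 16\<close>, which the condition
    \<open>16 * h <= 1 - t - h\<close> of the fine bound requires.\<close>
  define q where "q = max q0 4"
  have q: "q \<ge> 4" "(Cc + Cf) / ln (1 + \<eta>) < real q" using q0 by (auto simp: q_def)
  have q0': "real q > 0" using q by simp
  have qb: "(Cc + Cf) / real q \<le> ln (1 + \<eta>)"
    using q(2) ln q0' by (simp add: field_simps)
  define N where "N = q ^ 3"
  have N: "N > 0" "real N = real q ^ 3" using q by (auto simp: N_def)
  define h where "h = (1 - t0) / real N"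
  have hN: "h > 0" "real N * h = 1 - t0" using t00 N by (auto simp: h_def)
  interpret tilted_chain f df L t0 h N
    by unfold_locales (use t00 hN in auto)
  \<comment> \<open>The index \<open>i\<close> counts the steps left after the current one, so
    \<open>h / (1 - t - h) = 1 / i\<close>, and the last step has \<open>i = 0\<close>. For
    \<open>i < q^2\<close> there are at most \<open>q^2\<close> crude terms of size
    \<open>Cc / q^3\<close>; the others are at most \<open>Cf / q^4\<close> and number at most
    \<open>q^3\<close>.\<close>
  define d where "d i = (if i < q ^ 2 then Cc / real q ^ 3 else Cf / real q ^ 4)" for i
  define c where "c j = d (N - Suc j)" for j
  have d0: "d i \<ge> 0" for i using Cc Cf by (simp add: d_def)
  have le: "(\<integral>\<^sup>+z. ennreal ((wt (tk j) h y z)\<^sup>2) \<partial>std_gaussian) \<le> ennreal (1 + c j)" if j: "j < N" for j y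
  proof (cases "N - Suc j < q ^ 2")
    case True
    have "Cc * h \<le> Cc * (1 / real N)" using t00 Cc N by (intro mult_left_mono) (auto simp: h_def divide_right_mono)
    then have "Cc * h \<le> c j" using True N by (simp add: c_def d_def)
    moreover have "(\<integral>\<^sup>+z. ennreal ((wt (tk j) h y z)\<^sup>2) \<partial>std_gaussian) \<le> ennreal (1 + Cc * h)"
      using j hN tk[of j] tk_Suc[of j] by (intro Cc(2)) auto
    ultimately show ?thesis by (meson add_left_mono ennreal_leI order_trans)
  next
    case False
    define i where "i = N - Suc j"
    have i: "q ^ 2 \<le> i" using False by (simp add: i_def)
    have ri: "real i = real N - real j - 1" using j by (simp add: i_def of_nat_diff)
    have "16 \<le> q ^ 2" using power_mono[OF q(1), of 2] by simp
    then have i16: "16 \<le> i" using i by simp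
    have \<sigma>: "1 - tk j - h = real i * h" using hN(2) unfolding ri by (simp add: algebra_simps)
    have "h / (1 - tk j - h) = 1 / real i" unfolding \<sigma> using hN i16 by simp
    moreover have "16 * h \<le> 1 - tk j - h" unfolding \<sigma> using i16 hN by (intro mult_right_mono) auto
    ultimately have 1: "(\<integral>\<^sup>+z. ennreal ((wt (tk j) h y z)\<^sup>2) \<partial>std_gaussian) \<le> ennreal (1 + Cf * (1 / real i)\<^sup>2)"
      using Cf(2)[of "tk j" h y] tk[of j] hN j by simp
    have "real q ^ 2 \<le> real i" using i by (metis of_nat_le_iff of_nat_power)
    then have "1 / real i \<le> 1 / real q ^ 2" using q0' i16 by (intro divide_left_mono) auto
    then have "(1 / real i)\<^sup>2 \<le> (1 / real q ^ 2)\<^sup>2" by (intro power_mono) auto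
    also have "\<dots> = 1 / real q ^ 4" by (simp add: power_divide)
    finally have "Cf * (1 / real i)\<^sup>2 \<le> Cf * (1 / real q ^ 4)" using Cf by (intro mult_left_mono) auto
    also have "\<dots> = c j" using False by (simp add: c_def d_def)
    finally show ?thesis using 1 by (meson add_left_mono ennreal_leI order_trans)
  qed
  have "(\<Sum>j<N. c j) = (\<Sum>i<N. d i)"
    unfolding c_def by (rule sum.nat_diff_reindex)
  also have "\<dots> \<le> (\<Sum>i<N. (if i < q ^ 2 then Cc / real q ^ 3 else 0) + Cf / real q ^ 4)"
    using Cf Cc by (intro sum_mono) (auto simp: d_def)
  also have "\<dots> = (\<Sum>i<N. if i < q ^ 2 then Cc / real q ^ 3 else 0) + real N * (Cf / real q ^ 4)"
    by (simp add: sum.distrib)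
  also have "(\<Sum>i<N. if i < q ^ 2 then Cc / real q ^ 3 else 0) \<le> (\<Sum>i<q ^ 2. Cc / real q ^ 3)"
  proof -
    have "(\<Sum>i<N. if i < q ^ 2 then Cc / real q ^ 3 else 0) = (\<Sum>i\<in>{..<N} \<inter> {i. i < q ^ 2}. Cc / real q ^ 3)"
      by (simp add: sum.If_cases)
    also have "\<dots> \<le> (\<Sum>i<q ^ 2. Cc / real q ^ 3)" using Cc by (intro sum_mono2) auto
    finally show ?thesis .
  qed
  also have "(\<Sum>i<q ^ 2. Cc / real q ^ 3) = Cc / real q"
    using q0' by (simp add: power2_eq_square power3_eq_cube)
  also have "real N * (Cf / real q ^ 4) = Cf / real q"
    using q0' unfolding N by (simp add: power3_eq_cube power4_eq_xxxx)
  finally have "(\<Sum>j<N. c j) \<le> ln (1 + \<eta>)" using qb by (simp add: add_divide_distrib)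
  then have "exp (\<Sum>j<N. c j) \<le> exp (ln (1 + \<eta>))" by simp
  then have ex: "exp (\<Sum>j<N. c j) - 1 \<le> \<eta>" using \<eta> by simp
  show ?thesis
    using that[of N] N integral_R_minus_1_sq[of c, OF _ le] d0 ex
    unfolding h_def c_def by fastforce
qed

section \<open>Coupling\<close>

lemma measurable_fst_snd_borel [measurable]:
  "fst \<in> borel_measurable (borel :: ('a::second_countable_topology \<times> 'b::second_countable_topology) measure)"
  "snd \<in> borel_measurable (borel :: ('a \<times> 'b) measure)"
  by (simp_all add: borel_prod[symmetric])

lemma norm_diff_sq_le:
  fixes x y :: "'a::real_inner"
  shows "(norm (x - y))\<^sup>2 \<le> 2 * (norm x)\<^sup>2 + 2 * (norm y)\<^sup>2"
proof -
  have "0 \<le> (norm (x + y))\<^sup>2" by simp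
  then show ?thesis by (simp add: power2_norm_eq_inner inner_add inner_diff inner_commute)
qed

lemma W2_squared_le:
  assumes "\<pi> \<in> couplings \<alpha> \<beta>"
  shows "W2_squared \<alpha> \<beta> \<le> (\<integral>\<^sup>+p. ennreal ((norm (fst p - snd p))\<^sup>2) \<partial>\<pi>)"
  unfolding W2_squared_def using INF_lower[OF assms, of "\<lambda>\<pi>. \<integral>\<^sup>+(x, y). ennreal ((norm (x - y))\<^sup>2) \<partial>\<pi>"]
  by (simp add: case_prod_beta')

text \<open>Couple on the common part of the two laws, and independently on the rest; the Boolean
  coordinate says which of the two happens.\<close>

lemma W2_squared_density_le:
  fixes Q :: "'s measure" and R :: "'s \<Rightarrow> real" and X Y :: "'s \<Rightarrow> 'a::euclidean_space"
  assumes Q: "prob_space Q" and [measurable]: "R \<in> borel_measurable Q" "X \<in> borel_measurable Q" "Y \<in> borel_measurable Q"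
    and R0: "\<And>s. 0 \<le> R s" and R1: "(\<integral>\<^sup>+s. ennreal (R s) \<partial>Q) = 1"
  shows "W2_squared (distr (density Q (\<lambda>s. ennreal (R s))) borel X) (distr Q borel Y)
    \<le> (\<integral>\<^sup>+s. ennreal (min 1 (R s)) * ennreal ((norm (X s - Y s))\<^sup>2) \<partial>Q)
      + ((\<integral>\<^sup>+s. ennreal (2 * (\<bar>R s - 1\<bar> * (norm (X s))\<^sup>2)) \<partial>Q) + (\<integral>\<^sup>+s. ennreal (2 * (\<bar>R s - 1\<bar> * (norm (Y s))\<^sup>2)) \<partial>Q))"
    (is "W2_squared ?\<alpha> ?\<beta> \<le> ?T1 + ?T2")
proof -
  interpret Q: prob_space Q by fact
  \<comment> \<open>\<open>U\<close> is the density of the common part, \<open>P\<close> the excess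
    of the weighted law and \<open>N\<close> the excess of the unweighted one. The two excesses have
    the same mass \<open>e\<close>.\<close>
  define U P N where "U s = ennreal (min 1 (R s))" and "P s = ennreal (R s - 1)" and "N s = ennreal (1 - R s)" for s
  have [measurable]: "U \<in> borel_measurable Q" "P \<in> borel_measurable Q" "N \<in> borel_measurable Q"
    unfolding U_def P_def N_def by measurable
  have UP: "U s + P s = ennreal (R s)" for s
  proof (cases "R s \<le> 1")
    case True then show ?thesis by (simp add: U_def P_def ennreal_neg)
  next
    case False then show ?thesis unfolding U_def P_def by (subst ennreal_plus[symmetric]) auto
  qed
  have UN: "U s + N s = 1" for s
  proof (cases "R s \<le> 1")
    case True then show ?thesis unfolding U_def N_def using R0[of s] by (subst ennreal_plus[symmetric]) auto
  next
    case False then show ?thesis by (simp add: U_def N_def ennreal_neg)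
  qed
  define e where "e = (\<integral>\<^sup>+s. P s \<partial>Q)"
  have sP: "(\<integral>\<^sup>+s. U s \<partial>Q) + e = 1"
    unfolding e_def using R1 by (subst nn_integral_add[symmetric]) (auto simp: UP)
  have sN: "(\<integral>\<^sup>+s. U s \<partial>Q) + (\<integral>\<^sup>+s. N s \<partial>Q) = 1"
    by (subst nn_integral_add[symmetric]) (auto simp: UN Q.emeasure_space_1)
  have Ufin: "(\<integral>\<^sup>+s. U s \<partial>Q) \<noteq> \<infinity>" using sP by (metis ennreal_add_eq_top ennreal_one_neq_top infinity_ennreal_def)
  have Ne: "(\<integral>\<^sup>+s. N s \<partial>Q) = e"
    using sP sN Ufin by (metis ennreal_add_left_cancel infinity_ennreal_def)
  have efin: "e \<noteq> \<infinity>" using sP by (metis ennreal_add_eq_top ennreal_one_neq_top infinity_ennreal_def)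
  show ?thesis
  \<comment> \<open>The construction divides by \<open>e\<close>, and \<open>inverse 0\<close> is
    infinite here. If \<open>e = 0\<close> the weight is 1 almost everywhere and the joint law of
    \<open>X\<close> and \<open>Y\<close> is already a coupling.\<close>
  proof (cases "e = 0")
    case True
    have "AE s in Q. P s = 0" using True unfolding e_def by (subst (asm) nn_integral_0_iff_AE) auto
    moreover have "AE s in Q. N s = 0" using True unfolding Ne[symmetric] by (subst (asm) nn_integral_0_iff_AE) auto
    ultimately have one: "AE s in Q. R s = 1"
      by eventually_elim (auto simp: P_def N_def ennreal_eq_0_iff)
    have dQ: "density Q (\<lambda>s. ennreal (R s)) = Q"
      using one by (subst density_cong[where f'="\<lambda>_. 1"]) (auto simp: density_1)
    let ?\<pi> = "distr Q borel (\<lambda>s. (X s, Y s))"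
    have "?\<pi> \<in> couplings ?\<alpha> ?\<beta>"
      unfolding couplings_def dQ by (auto simp: distr_distr comp_def intro!: Q.prob_space_distr)
    then have "W2_squared ?\<alpha> ?\<beta> \<le> (\<integral>\<^sup>+p. ennreal ((norm (fst p - snd p))\<^sup>2) \<partial>?\<pi>)" by (rule W2_squared_le)
    also have "\<dots> = (\<integral>\<^sup>+s. ennreal ((norm (X s - Y s))\<^sup>2) \<partial>Q)" by (simp add: nn_integral_distr)
    also have "\<dots> = ?T1"
      by (rule nn_integral_cong_AE) (use one in \<open>eventually_elim, simp\<close>)
    finally show ?thesis by (simp add: add_increasing2)
  next
    case False
    have ei: "e * inverse e = 1" 
      using ennreal_divide_self[of e] False efin by (simp add: divide_ennreal_def top.not_eq_extremum)
    interpret B: sigma_finite_measure "count_space (UNIV :: bool set)" by (rule sigma_finite_measure_count_space_finite) simp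
    interpret QQ: pair_prob_space Q Q ..
    \<comment> \<open>The product of the two excesses has mass \<open>e * e\<close>, and its
      marginals carry an extra factor \<open>e\<close>, which \<open>inverse e\<close>
      removes.\<close>
    define w where "w p = (if snd p then U (fst (fst p)) else P (fst (fst p)) * N (snd (fst p)) * inverse e)" for p
    define Z where "Z p = (X (fst (fst p)), if snd p then Y (fst (fst p)) else Y (snd (fst p)))" for p
    let ?B = "(Q \<Otimes>\<^sub>M Q) \<Otimes>\<^sub>M count_space (UNIV :: bool set)"
    have [measurable]: "Measurable.pred ?B snd" by (rule measurable_snd)
    have [measurable]: "w \<in> borel_measurable ?B" unfolding w_def by measurable
    have [measurable]: "Z \<in> borel_measurable ?B" unfolding Z_def by measurable
    define \<pi> where "\<pi> = distr (density ?B w) borel Z"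
    have nn: "(\<integral>\<^sup>+p. F p \<partial>\<pi>) = (\<integral>\<^sup>+s. U s * F (X s, Y s) \<partial>Q) + (\<integral>\<^sup>+s. \<integral>\<^sup>+s'. P s * N s' * inverse e * F (X s, Y s') \<partial>Q \<partial>Q)"
      if [measurable]: "F \<in> borel_measurable borel" for F
    proof -
      have "(\<integral>\<^sup>+p. F p \<partial>\<pi>) = (\<integral>\<^sup>+p. w p * F (Z p) \<partial>?B)"
        unfolding \<pi>_def by (simp add: nn_integral_distr nn_integral_density)
      also have "\<dots> = (\<integral>\<^sup>+q. \<integral>\<^sup>+b. w (q, b) * F (Z (q, b)) \<partial>count_space UNIV \<partial>(Q \<Otimes>\<^sub>M Q))"
        by (rule B.nn_integral_fst[symmetric]) measurable
      also have "\<dots> = (\<integral>\<^sup>+s. \<integral>\<^sup>+s'. \<integral>\<^sup>+b. w ((s, s'), b) * F (Z ((s, s'), b)) \<partial>count_space UNIV \<partial>Q \<partial>Q)"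
        by (rule Q.nn_integral_fst[symmetric]) measurable
      also have "\<dots> = (\<integral>\<^sup>+s. \<integral>\<^sup>+s'. U s * F (X s, Y s) + P s * N s' * inverse e * F (X s, Y s') \<partial>Q \<partial>Q)"
        by (simp add: nn_integral_count_space_finite UNIV_bool w_def Z_def add.commute)
      also have "\<dots> = (\<integral>\<^sup>+s. U s * F (X s, Y s) + (\<integral>\<^sup>+s'. P s * N s' * inverse e * F (X s, Y s') \<partial>Q) \<partial>Q)"
        by (intro nn_integral_cong) (subst nn_integral_add, auto simp: Q.emeasure_space_1)
      also have "\<dots> = (\<integral>\<^sup>+s. U s * F (X s, Y s) \<partial>Q) + (\<integral>\<^sup>+s. \<integral>\<^sup>+s'. P s * N s' * inverse e * F (X s, Y s') \<partial>Q \<partial>Q)"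
        by (rule nn_integral_add) measurable
      finally show ?thesis .
    qed
    have nnX: "(\<integral>\<^sup>+s. \<integral>\<^sup>+s'. P s * N s' * inverse e * \<phi> s \<partial>Q \<partial>Q) = (\<integral>\<^sup>+s. P s * \<phi> s \<partial>Q)"
      if [measurable]: "\<phi> \<in> borel_measurable Q" for \<phi>
    proof (rule nn_integral_cong)
      fix s
      have "(\<integral>\<^sup>+s'. P s * N s' * inverse e * \<phi> s \<partial>Q) = (\<integral>\<^sup>+s'. (P s * inverse e * \<phi> s) * N s' \<partial>Q)"
        by (simp add: mult_ac)
      also have "\<dots> = (P s * inverse e * \<phi> s) * e" by (subst nn_integral_cmult) (auto simp: Ne)
      also have "\<dots> = (P s * \<phi> s) * (e * inverse e)" by (simp add: mult_ac)
      finally show "(\<integral>\<^sup>+s'. P s * N s' * inverse e * \<phi> s \<partial>Q) = P s * \<phi> s" by (simp add: ei)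
    qed
    have nnY: "(\<integral>\<^sup>+s. \<integral>\<^sup>+s'. P s * N s' * inverse e * \<phi> s' \<partial>Q \<partial>Q) = (\<integral>\<^sup>+s. N s * \<phi> s \<partial>Q)"
      if [measurable]: "\<phi> \<in> borel_measurable Q" for \<phi>
    proof -
      have "(\<integral>\<^sup>+s. \<integral>\<^sup>+s'. P s * N s' * inverse e * \<phi> s' \<partial>Q \<partial>Q) = (\<integral>\<^sup>+s. P s * (inverse e * (\<integral>\<^sup>+s'. N s' * \<phi> s' \<partial>Q)) \<partial>Q)"
        by (intro nn_integral_cong) (simp add: nn_integral_cmult[symmetric] mult_ac)
      also have "\<dots> = e * (inverse e * (\<integral>\<^sup>+s'. N s' * \<phi> s' \<partial>Q))"
        unfolding e_def by (rule nn_integral_multc) measurable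
      also have "\<dots> = (\<integral>\<^sup>+s'. N s' * \<phi> s' \<partial>Q)" by (simp add: mult.assoc[symmetric] ei)
      finally show ?thesis .
    qed
    have fstm: "distr \<pi> borel fst = ?\<alpha>"
    proof (rule measure_eqI)
      fix A assume "A \<in> sets (distr \<pi> borel fst)"
      then have [measurable]: "A \<in> sets borel" by simp
      have "emeasure (distr \<pi> borel fst) A = (\<integral>\<^sup>+p. indicator A (fst p) \<partial>\<pi>)"
        by (simp add: nn_integral_indicator[symmetric] nn_integral_distr \<pi>_def del: nn_integral_indicator)
      also have "\<dots> = (\<integral>\<^sup>+s. U s * indicator A (X s) \<partial>Q) + (\<integral>\<^sup>+s. P s * indicator A (X s) \<partial>Q)"
        by (subst nn) (auto simp: nnX)
      also have "\<dots> = (\<integral>\<^sup>+s. ennreal (R s) * indicator A (X s) \<partial>Q)"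
        by (subst nn_integral_add[symmetric]) (auto simp: UP[symmetric] distrib_right)
      also have "\<dots> = emeasure ?\<alpha> A"
        by (simp add: nn_integral_indicator[symmetric] nn_integral_distr nn_integral_density del: nn_integral_indicator)
      finally show "emeasure (distr \<pi> borel fst) A = emeasure ?\<alpha> A" .
    qed simp
    have sndm: "distr \<pi> borel snd = ?\<beta>"
    proof (rule measure_eqI)
      fix A assume "A \<in> sets (distr \<pi> borel snd)"
      then have [measurable]: "A \<in> sets borel" by simp
      have "emeasure (distr \<pi> borel snd) A = (\<integral>\<^sup>+p. indicator A (snd p) \<partial>\<pi>)"
        by (simp add: nn_integral_indicator[symmetric] nn_integral_distr \<pi>_def del: nn_integral_indicator)
      also have "\<dots> = (\<integral>\<^sup>+s. U s * indicator A (Y s) \<partial>Q) + (\<integral>\<^sup>+s. N s * indicator A (Y s) \<partial>Q)"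
        by (subst nn) (auto simp: nnY)
      also have "\<dots> = (\<integral>\<^sup>+s. indicator A (Y s) \<partial>Q)"
        by (subst nn_integral_add[symmetric]) (auto simp: UN distrib_right[symmetric])
      also have "\<dots> = emeasure ?\<beta> A"
        by (simp add: nn_integral_indicator[symmetric] nn_integral_distr del: nn_integral_indicator)
      finally show "emeasure (distr \<pi> borel snd) A = emeasure ?\<beta> A" .
    qed simp
    have "prob_space ?\<beta>" by (rule Q.prob_space_distr) simp
    then have "prob_space \<pi>"
      unfolding sndm[symmetric] by (rule prob_space_distrD[rotated]) (simp add: \<pi>_def)
    then have "\<pi> \<in> couplings ?\<alpha> ?\<beta>"
      unfolding couplings_def using fstm sndm by (simp add: \<pi>_def)
    then have "W2_squared ?\<alpha> ?\<beta> \<le> (\<integral>\<^sup>+p. ennreal ((norm (fst p - snd p))\<^sup>2) \<partial>\<pi>)" by (rule W2_squared_le)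
    also have "\<dots> = ?T1 + (\<integral>\<^sup>+s. \<integral>\<^sup>+s'. P s * N s' * inverse e * ennreal ((norm (X s - Y s'))\<^sup>2) \<partial>Q \<partial>Q)"
      by (subst nn) (auto simp: U_def)
    also have "(\<integral>\<^sup>+s. \<integral>\<^sup>+s'. P s * N s' * inverse e * ennreal ((norm (X s - Y s'))\<^sup>2) \<partial>Q \<partial>Q)
       \<le> (\<integral>\<^sup>+s. \<integral>\<^sup>+s'. P s * N s' * inverse e * ennreal (2 * (norm (X s))\<^sup>2) + P s * N s' * inverse e * ennreal (2 * (norm (Y s'))\<^sup>2) \<partial>Q \<partial>Q)"
    proof (intro nn_integral_mono)
      fix s s'
      have "ennreal ((norm (X s - Y s'))\<^sup>2) \<le> ennreal (2 * (norm (X s))\<^sup>2 + 2 * (norm (Y s'))\<^sup>2)"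
        by (intro ennreal_leI norm_diff_sq_le)
      also have "\<dots> = ennreal (2 * (norm (X s))\<^sup>2) + ennreal (2 * (norm (Y s'))\<^sup>2)"
        by (rule ennreal_plus) auto
      finally show "P s * N s' * inverse e * ennreal ((norm (X s - Y s'))\<^sup>2) \<le>
          P s * N s' * inverse e * ennreal (2 * (norm (X s))\<^sup>2) + P s * N s' * inverse e * ennreal (2 * (norm (Y s'))\<^sup>2)"
        unfolding distrib_left[symmetric] by (rule mult_left_mono) simp
    qed
    also have "\<dots> = (\<integral>\<^sup>+s. (\<integral>\<^sup>+s'. P s * N s' * inverse e * ennreal (2 * (norm (X s))\<^sup>2) \<partial>Q) + (\<integral>\<^sup>+s'. P s * N s' * inverse e * ennreal (2 * (norm (Y s'))\<^sup>2) \<partial>Q) \<partial>Q)"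
      by (intro nn_integral_cong nn_integral_add) measurable
    also have "\<dots> = (\<integral>\<^sup>+s. P s * ennreal (2 * (norm (X s))\<^sup>2) \<partial>Q) + (\<integral>\<^sup>+s. N s * ennreal (2 * (norm (Y s))\<^sup>2) \<partial>Q)"
      by (subst nn_integral_add) (auto simp: nnX nnY)
    also have "\<dots> \<le> ?T2"
    proof (intro add_mono nn_integral_mono)
      fix s
      show "P s * ennreal (2 * (norm (X s))\<^sup>2) \<le> ennreal (2 * (\<bar>R s - 1\<bar> * (norm (X s))\<^sup>2))"
      proof (cases "R s \<le> 1")
        case True then show ?thesis by (simp add: P_def ennreal_neg)
      next
        case False then show ?thesis unfolding P_def by (subst ennreal_mult[symmetric]) (auto intro!: ennreal_leI)
      qed
      show "N s * ennreal (2 * (norm (Y s))\<^sup>2) \<le> ennreal (2 * (\<bar>R s - 1\<bar> * (norm (Y s))\<^sup>2))"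
      proof (cases "R s \<le> 1")
        case True then show ?thesis unfolding N_def by (subst ennreal_mult[symmetric]) (auto intro!: ennreal_leI)
      next
        case False then show ?thesis by (simp add: N_def ennreal_neg)
      qed
    qed
    finally show ?thesis by (simp add: add_left_mono)
  qed
qed

text \<open>Couple a point with itself plus independent noise; the cost is the second moment of the
  noise. This settles the case where the claimed bound is at least the dimension.\<close>

lemma W2_squared_convolution_le:
  fixes \<nu> :: "'a::euclidean_space measure"
  assumes "prob_space \<nu>" and [simp, measurable_cong]: "sets \<nu> = sets borel"
  shows "W2_squared \<nu> (distr (std_gaussian \<Otimes>\<^sub>M \<nu>) borel (\<lambda>(x, y). x + y)) \<le> ennreal (real DIM('a))"
proof -
  interpret \<nu>: prob_space \<nu> by fact
  interpret P: pair_prob_space "std_gaussian :: 'a measure" \<nu> ..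
  let ?\<pi> = "distr (std_gaussian \<Otimes>\<^sub>M \<nu>) borel (\<lambda>p. (snd p, fst p + snd p))"
  have "distr ?\<pi> borel fst = \<nu>"
  proof (rule measure_eqI)
    fix A assume "A \<in> sets (distr ?\<pi> borel fst)"
    then have [measurable]: "A \<in> sets borel" by simp
    have "emeasure (distr ?\<pi> borel fst) A = (\<integral>\<^sup>+p. indicator A (fst p) \<partial>?\<pi>)"
      by (simp add: nn_integral_indicator[symmetric] nn_integral_distr del: nn_integral_indicator)
    also have "\<dots> = (\<integral>\<^sup>+q. indicator A (snd q) \<partial>((std_gaussian :: 'a measure) \<Otimes>\<^sub>M \<nu>))"
      by (subst nn_integral_distr) auto
    also have "\<dots> = (\<integral>\<^sup>+x. \<integral>\<^sup>+y. indicator A y \<partial>\<nu> \<partial>(std_gaussian :: 'a measure))"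
      by (subst \<nu>.nn_integral_fst[symmetric]) auto
    finally show "emeasure (distr ?\<pi> borel fst) A = emeasure \<nu> A"
      by (simp add: emeasure_std_gaussian_UNIV)
  qed simp
  then have "?\<pi> \<in> couplings \<nu> (distr (std_gaussian \<Otimes>\<^sub>M \<nu>) borel (\<lambda>(x, y). x + y))"
    unfolding couplings_def
    by (auto simp: distr_distr comp_def case_prod_beta' intro!: P.prob_space_distr)
  then have "W2_squared \<nu> (distr (std_gaussian \<Otimes>\<^sub>M \<nu>) borel (\<lambda>(x, y). x + y)) \<le> (\<integral>\<^sup>+p. ennreal ((norm (fst p - snd p))\<^sup>2) \<partial>?\<pi>)" by (rule W2_squared_le)
  also have "\<dots> = (\<integral>\<^sup>+p. ennreal ((norm (fst p))\<^sup>2) \<partial>((std_gaussian :: 'a measure) \<Otimes>\<^sub>M \<nu>))"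
    by (subst nn_integral_distr) auto
  also have "\<dots> = (\<integral>\<^sup>+x. ennreal ((norm x)\<^sup>2) \<partial>(std_gaussian :: 'a measure))"
    by (subst \<nu>.nn_integral_fst[symmetric]) (auto simp: \<nu>.emeasure_space_1)
  also have "\<dots> = ennreal (real DIM('a))"
    using integrable_std_gaussian_norm_power[of 2, where 'a='a] integral_std_gaussian_norm_sq[where 'a='a]
    by (subst nn_integral_eq_integral) auto
  finally show ?thesis .
qed

section \<open>Support functions of bounded sets\<close>

lemma support_fun_ge:
  fixes K :: "'a::euclidean_space set"
  assumes K: "\<And>t. t \<in> K \<Longrightarrow> norm t \<le> L" and t: "t \<in> K"
  shows "y \<bullet> t \<le> support_fun K y"
  unfolding support_fun_def
proof (rule cSUP_upper[OF t])
  show "bdd_above ((\<bullet>) y ` K)"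
  proof (rule bdd_aboveI2)
    fix t assume "t \<in> K"
    have "y \<bullet> t \<le> norm y * norm t" by (rule norm_cauchy_schwarz)
    also have "\<dots> \<le> norm y * L" using K[OF \<open>t \<in> K\<close>] by (rule mult_left_mono) simp
    finally show "y \<bullet> t \<le> norm y * L" .
  qed
qed

lemma support_fun_lipschitz:
  fixes K :: "'a::euclidean_space set"
  assumes K: "\<And>t. t \<in> K \<Longrightarrow> norm t \<le> L" "K \<noteq> {}"
  shows "\<bar>support_fun K y - support_fun K y'\<bar> \<le> L * norm (y - y')"
proof -
  have *: "support_fun K y \<le> support_fun K y' + L * norm (y - y')" for y y'
    unfolding support_fun_def[of K y]
  proof (rule cSUP_least[OF K(2)])
    fix t assume t: "t \<in> K"
    have "y \<bullet> t = y' \<bullet> t + (y - y') \<bullet> t" by (simp add: inner_diff)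
    also have "(y - y') \<bullet> t \<le> norm (y - y') * norm t" by (rule norm_cauchy_schwarz)
    also have "norm (y - y') * norm t \<le> norm (y - y') * L" using K(1)[OF t] by (rule mult_left_mono) simp
    finally show "y \<bullet> t \<le> support_fun K y' + L * norm (y - y')"
      using support_fun_ge[OF K(1) t, of y'] by (simp add: mult.commute)
  qed
  show ?thesis using *[of y y'] *[of y' y] by (simp add: norm_minus_commute abs_le_iff)
qed

lemma abs_support_fun_le:
  fixes K :: "'a::euclidean_space set"
  assumes "\<And>t. t \<in> K \<Longrightarrow> norm t \<le> L" "K \<noteq> {}"
  shows "\<bar>support_fun K y\<bar> \<le> L * norm y"
  using support_fun_lipschitz[OF assms, of y 0] assms(2) by (simp add: support_fun_def)

text \<open>An uncountable supremum needs an argument for measurability: boundedness of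
  \<open>K\<close> makes it Lipschitz.\<close>

lemma borel_measurable_support_fun:
  fixes K :: "'a::euclidean_space set"
  assumes "\<And>t. t \<in> K \<Longrightarrow> norm t \<le> L" "K \<noteq> {}"
  shows "support_fun K \<in> borel_measurable borel"
proof (rule borel_measurable_continuous_onI, rule continuous_at_imp_continuous_on, rule ballI)
  fix y :: 'a
  have "((\<lambda>y'. L * norm (y' - y)) \<longlongrightarrow> L * norm (y - y)) (at y)" by (intro tendsto_intros)
  then have "((\<lambda>y'. L * norm (y' - y)) \<longlongrightarrow> 0) (at y)" by simp
  then have "((\<lambda>y'. support_fun K y' - support_fun K y) \<longlongrightarrow> 0) (at y)"
    by (rule Lim_null_comparison[rotated]) (use support_fun_lipschitz[OF assms] in auto)
  then show "isCont (support_fun K) y" unfolding isCont_def by (rule LIM_zero_cancel)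
qed

section \<open>Law of the accumulated noise\<close>

context tilted_chain
begin

lemma distr_noise:
  "distr (Q k) borel stS = distr std_gaussian borel (\<lambda>z::'a. sqrt (real k * h) *\<^sub>R z)"
proof (rule measure_eqI)
  fix A assume "A \<in> sets (distr (Q k) borel stS)"
  then have [measurable]: "A \<in> sets borel" by simp
  interpret l: prob_space "law t0" by (rule prob_space_law[OF t0 t0_le])
  have "emeasure (distr (Q k) borel stS) A = (\<integral>\<^sup>+s. indicator A (snd (stX s, stS s)) \<partial>Q k)"
    by (simp add: nn_integral_indicator[symmetric] nn_integral_distr del: nn_integral_indicator)
  also have "\<dots> = (\<integral>\<^sup>+x. \<integral>\<^sup>+z. indicator A (snd (x, sqrt (real k * h) *\<^sub>R z)) \<partial>std_gaussian \<partial>law t0)"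
    by (rule nn_integral_chain_noise[OF t0 t0_le h, of "\<lambda>p. indicator A (snd p)"]) measurable
  also have "\<dots> = (\<integral>\<^sup>+z. indicator A (sqrt (real k * h) *\<^sub>R z) \<partial>std_gaussian)"
    using l.emeasure_space_1 by simp
  also have "\<dots> = emeasure (distr std_gaussian borel (\<lambda>z::'a. sqrt (real k * h) *\<^sub>R z)) A"
    by (simp add: nn_integral_indicator[symmetric] nn_integral_distr del: nn_integral_indicator)
  finally show "emeasure (distr (Q k) borel stS) A = emeasure (distr std_gaussian borel (\<lambda>z::'a. sqrt (real k * h) *\<^sub>R z)) A" .
qed simp

lemma integral_noise:
  fixes \<phi> :: "'a \<Rightarrow> real"
  assumes [measurable]: "\<phi> \<in> borel_measurable borel"
  shows "(\<integral>s. \<phi> (stS s) \<partial>Q k) = (\<integral>z. \<phi> (sqrt (real k * h) *\<^sub>R z) \<partial>std_gaussian)"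
    and "integrable (Q k) (\<lambda>s. \<phi> (stS s)) \<longleftrightarrow> integrable std_gaussian (\<lambda>z. \<phi> (sqrt (real k * h) *\<^sub>R z))"
proof -
  have "(\<integral>s. \<phi> (stS s) \<partial>Q k) = (\<integral>x. \<phi> x \<partial>distr (Q k) borel stS)" by (simp add: integral_distr)
  then show "(\<integral>s. \<phi> (stS s) \<partial>Q k) = (\<integral>z. \<phi> (sqrt (real k * h) *\<^sub>R z) \<partial>std_gaussian)"
    unfolding distr_noise by (simp add: integral_distr)
  have "integrable (Q k) (\<lambda>s. \<phi> (stS s)) \<longleftrightarrow> integrable (distr (Q k) borel stS) \<phi>" by (simp add: integrable_distr_eq)
  then show "integrable (Q k) (\<lambda>s. \<phi> (stS s)) \<longleftrightarrow> integrable std_gaussian (\<lambda>z. \<phi> (sqrt (real k * h) *\<^sub>R z))"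
    unfolding distr_noise by (simp add: integrable_distr_eq)
qed

end

section \<open>Gaussian width and the energy gap\<close>

context normalized_potential
begin

lemma law_1: "law 1 = density std_gaussian (\<lambda>x. ennreal (exp (f x)))"
proof -
  have "law 1 = distr (density std_gaussian (\<lambda>x. ennreal (exp (f x)))) (density std_gaussian (\<lambda>x. ennreal (exp (f x)))) (\<lambda>x. x)"
    unfolding law_def by (intro distr_cong) (simp_all add: g_1)
  then show ?thesis by simp
qed

lemma range_df: "t \<in> range df \<Longrightarrow> norm t \<le> L" "range df \<noteq> {}"
  using norm_df_le by auto

text \<open>At time $1$ the point of the chain started at $0$ is noise plus accumulated drift. Pairing
  with $\nabla f$, the noise contributes at most the Gaussian width, and the drift $\int_0^1 m$.\<close>

lemma integral_inner_df_le:
  assumes \<epsilon>: "\<epsilon> > 0" "\<epsilon> \<le> 1" and t: "0 \<le> t" "t \<le> 1"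
  shows "(\<integral>y. df y \<bullet> y \<partial>law 1) \<le> gaussian_width (range df) + (t * m t + (1 - t) * m 1) + \<epsilon> * (L * (1 + real DIM('a)) / 2)"
proof -
  let ?K = "range df"
  let ?n = "real DIM('a)"
  have [measurable]: "support_fun ?K \<in> borel_measurable borel" by (rule borel_measurable_support_fun[OF range_df])
  \<comment> \<open>The variance of the ratio is asked to be at most
    \<open>\<epsilon>\<^sup>2\<close> because Young's inequality below, with weight
    \<open>\<epsilon>\<close>, divides it by \<open>\<epsilon>\<close>.\<close>
  have "\<epsilon>\<^sup>2 > 0" using \<epsilon> by simp
  then obtain N where N: "N > 0" "integrable (chain 0 ((1 - 0) / real N) N) (\<lambda>s. (stR s - 1)\<^sup>2)"
    "(\<integral>s. (stR s - 1)\<^sup>2 \<partial>chain 0 ((1 - 0) / real N) N) \<le> \<epsilon>\<^sup>2"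
    using chain_approximation[of 0 "\<epsilon>\<^sup>2"] by auto
  define h where "h = 1 / real N"
  have hN: "real N * h = 1" "h > 0" using N by (auto simp: h_def)
  interpret C: tilted_chain f df L 0 h N by unfold_locales (use hN in auto)
  have R2: "integrable (C.Q N) (\<lambda>s. (stR s - 1)\<^sup>2)" "(\<integral>s. (stR s - 1)\<^sup>2 \<partial>C.Q N) \<le> \<epsilon>\<^sup>2"
    using N by (simp_all add: h_def)
  have t1: "0 + real N * h = 1" using hN by simp
  have S2: "integrable (C.Q N) (\<lambda>s. (norm (stS s))\<^sup>2)" "(\<integral>s. (norm (stS s))\<^sup>2 \<partial>C.Q N) = ?n"
    using C.integral_noise[of "\<lambda>x. (norm x)\<^sup>2" N] integrable_std_gaussian_norm_power[of 2, where 'a='a]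
      integral_std_gaussian_norm_sq[where 'a='a] by (simp_all add: hN)
  have supi: "integrable (C.Q N) (\<lambda>s. support_fun ?K (stS s))" "(\<integral>s. support_fun ?K (stS s) \<partial>C.Q N) = gaussian_width ?K"
  proof -
    have "integrable std_gaussian (support_fun ?K)"
    proof (rule Bochner_Integration.integrable_bound)
      show "integrable std_gaussian (\<lambda>z::'a. L * norm z ^ 1)" by (intro integrable_mult_right integrable_std_gaussian_norm_power)
      show "AE z in std_gaussian. norm (support_fun ?K z) \<le> norm (L * norm z ^ 1)"
        using abs_support_fun_le[OF range_df] L_nonneg by (simp add: abs_mult)
    qed simp
    then show "integrable (C.Q N) (\<lambda>s. support_fun ?K (stS s))" "(\<integral>s. support_fun ?K (stS s) \<partial>C.Q N) = gaussian_width ?K"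
      using C.integral_noise[of "support_fun ?K" N] by (simp_all add: hN gaussian_width_def)
  qed
  have err_b: "\<bar>(stR s - 1) * support_fun ?K (stS s)\<bar> \<le> L / 2 * ((stR s - 1)\<^sup>2 / \<epsilon> + \<epsilon> * (norm (stS s))\<^sup>2)" for s
  proof -
    have "0 \<le> (\<bar>stR s - 1\<bar> / sqrt \<epsilon> - sqrt \<epsilon> * norm (stS s))\<^sup>2" by simp
    also have "\<dots> = (stR s - 1)\<^sup>2 / \<epsilon> + \<epsilon> * (norm (stS s))\<^sup>2 - 2 * (\<bar>stR s - 1\<bar> * norm (stS s))"
      using \<epsilon> by (simp add: power2_diff power_mult_distrib power_divide)
    finally have 1: "\<bar>stR s - 1\<bar> * norm (stS s) \<le> ((stR s - 1)\<^sup>2 / \<epsilon> + \<epsilon> * (norm (stS s))\<^sup>2) / 2" by simp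
    have "\<bar>(stR s - 1) * support_fun ?K (stS s)\<bar> \<le> \<bar>stR s - 1\<bar> * (L * norm (stS s))"
      unfolding abs_mult by (intro mult_left_mono abs_support_fun_le[OF range_df]) auto
    also have "\<dots> = L * (\<bar>stR s - 1\<bar> * norm (stS s))" by simp
    also have "\<dots> \<le> L * (((stR s - 1)\<^sup>2 / \<epsilon> + \<epsilon> * (norm (stS s))\<^sup>2) / 2)" using 1 L_nonneg by (rule mult_left_mono)
    finally show ?thesis by simp
  qed
  have bi: "integrable (C.Q N) (\<lambda>s. L / 2 * ((stR s - 1)\<^sup>2 / \<epsilon> + \<epsilon> * (norm (stS s))\<^sup>2))" using R2 S2 by simp
  have erri: "integrable (C.Q N) (\<lambda>s. (stR s - 1) * support_fun ?K (stS s))"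
    by (rule Bochner_Integration.integrable_bound[OF bi]) (use err_b in \<open>auto intro!: AE_I2 order_trans[OF _ abs_ge_self]\<close>)
  have err: "(\<integral>s. (stR s - 1) * support_fun ?K (stS s) \<partial>C.Q N) \<le> \<epsilon> * (L * (1 + ?n) / 2)"
  proof -
    have "(\<integral>s. (stR s - 1) * support_fun ?K (stS s) \<partial>C.Q N) \<le> (\<integral>s. L / 2 * ((stR s - 1)\<^sup>2 / \<epsilon> + \<epsilon> * (norm (stS s))\<^sup>2) \<partial>C.Q N)"
      by (rule integral_mono[OF erri bi order_trans[OF abs_ge_self err_b]])
    also have "\<dots> = L / 2 * ((\<integral>s. (stR s - 1)\<^sup>2 \<partial>C.Q N) / \<epsilon> + \<epsilon> * ?n)" using R2 S2 by simp
    also have "\<dots> \<le> L / 2 * (\<epsilon>\<^sup>2 / \<epsilon> + \<epsilon> * ?n)"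
      using R2(2) L_nonneg \<epsilon> by (intro mult_left_mono add_right_mono divide_right_mono) auto
    also have "\<dots> = \<epsilon> * (L * (1 + ?n) / 2)" using \<epsilon> by (simp add: power2_eq_square field_simps)
    finally show ?thesis .
  qed
  have RS: "(\<integral>s. stR s * support_fun ?K (stS s) \<partial>C.Q N) \<le> gaussian_width ?K + \<epsilon> * (L * (1 + ?n) / 2)"
    and RSi: "integrable (C.Q N) (\<lambda>s. stR s * support_fun ?K (stS s))"
  proof -
    have e: "stR s * support_fun ?K (stS s) = support_fun ?K (stS s) + (stR s - 1) * support_fun ?K (stS s)" for s
      by (simp add: algebra_simps)
    show "(\<integral>s. stR s * support_fun ?K (stS s) \<partial>C.Q N) \<le> gaussian_width ?K + \<epsilon> * (L * (1 + ?n) / 2)"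
      unfolding e using supi erri err by simp
    show "integrable (C.Q N) (\<lambda>s. stR s * support_fun ?K (stS s))"
      unfolding e using supi erri by simp
  qed
  \<comment> \<open>\<open>law 0\<close> is the point mass at the origin, since it is the image
    under scaling by \<open>sqrt 0\<close>.\<close>
  have X0: "AE s in C.Q N. stX s = 0"
  proof -
    have "(\<integral>\<^sup>+s. indicator (- {0}) (fst (stX s, stS s)) \<partial>C.Q N) =
        (\<integral>\<^sup>+x. \<integral>\<^sup>+z. indicator (- {0}) (fst (x, sqrt (real N * h) *\<^sub>R (z::'a))) \<partial>std_gaussian \<partial>law 0)"
      using hN by (intro nn_integral_chain_noise[of 0 h "\<lambda>p. indicator (- {0}) (fst p)"]) auto
    also have "\<dots> = 0"
      using nn_integral_law[of "indicator (- {0})" 0] by (simp add: emeasure_std_gaussian_UNIV)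
    finally have "AE s in C.Q N. indicator (- {0}) (stX s) = (0 :: ennreal)"
      by (subst (asm) nn_integral_0_iff_AE) auto
    then show ?thesis by eventually_elim (simp add: indicator_def split: if_splits)
  qed
  let ?A = "\<lambda>s. stY s - stX s - stS s"
  have ai: "integrable (C.Q N) (\<lambda>s. stR s * (v 1 (stY s) \<bullet> ?A s))"
  proof (rule C.integrable_R_mult)
    show "AE s in C.Q N. \<bar>v 1 (stY s) \<bullet> ?A s\<bar> \<le> L * (real N * h * L)"
      using chain_bounds[OF order_refl zero_le_one less_imp_le[OF hN(2)], of N]
    proof eventually_elim
      fix s :: "'a state" assume "stR s \<ge> 0 \<and> norm (?A s) \<le> real N * h * L"
      then have "norm (v 1 (stY s)) * norm (?A s) \<le> L * (real N * h * L)"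
        using norm_v_le L_nonneg by (intro mult_mono) auto
      then show "\<bar>v 1 (stY s) \<bullet> ?A s\<bar> \<le> L * (real N * h * L)"
        using Cauchy_Schwarz_ineq2 order_trans by blast
    qed
  qed auto
  have av: "(\<integral>s. stR s * (v 1 (stY s) \<bullet> ?A s) \<partial>C.Q N) = h * (\<Sum>j<N. m (real j * h))"
    using C.integral_R_v_drift[of N] by (simp add: hN)
  have "(\<integral>y. df y \<bullet> y \<partial>law 1) = (\<integral>s. stR s * (v 1 (stY s) \<bullet> stY s) \<partial>C.Q N)"
    using C.integral_R_Y[of N "\<lambda>y. v 1 y \<bullet> y"] by (simp add: hN(1) v_1)
  also have "\<dots> \<le> (\<integral>s. stR s * (v 1 (stY s) \<bullet> ?A s) + stR s * support_fun ?K (stS s) \<partial>C.Q N)"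
  \<comment> \<open>Monotonicity of the integral needs the left side integrable. The second case
    derives exactly that and is therefore contradictory.\<close>
  proof (cases "integrable (C.Q N) (\<lambda>s. stR s * (v 1 (stY s) \<bullet> stY s))")
    case True
    show ?thesis
    proof (rule integral_mono_AE[OF True])
      show "integrable (C.Q N) (\<lambda>s. stR s * (v 1 (stY s) \<bullet> ?A s) + stR s * support_fun ?K (stS s))"
        using ai RSi by simp
      show "AE s in C.Q N. stR s * (v 1 (stY s) \<bullet> stY s) \<le> stR s * (v 1 (stY s) \<bullet> ?A s) + stR s * support_fun ?K (stS s)"
        using X0 C.AE_R
      proof eventually_elim
        fix s :: "'a state" assume s: "stX s = 0" "0 \<le> stR s"
        have "v 1 (stY s) \<bullet> stY s = v 1 (stY s) \<bullet> ?A s + stS s \<bullet> df (stY s)"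
          using s by (simp add: v_1 inner_diff inner_commute)
        also have "\<dots> \<le> v 1 (stY s) \<bullet> ?A s + support_fun ?K (stS s)"
          by (intro add_left_mono support_fun_ge[OF range_df(1)]) auto
        finally show "stR s * (v 1 (stY s) \<bullet> stY s) \<le> stR s * (v 1 (stY s) \<bullet> ?A s) + stR s * support_fun ?K (stS s)"
          using s(2) by (simp add: distrib_left[symmetric] mult_left_mono)
      qed
    qed
  next
    case False
    have "AE s in C.Q N. stR s * (v 1 (stY s) \<bullet> stY s) = stR s * (v 1 (stY s) \<bullet> ?A s) + stR s * (df (stY s) \<bullet> stS s)"
      using X0 by eventually_elim (simp add: v_1 inner_diff algebra_simps)
    moreover have "integrable (C.Q N) (\<lambda>s. stR s * (df (stY s) \<bullet> stS s))"
    proof (rule Bochner_Integration.integrable_bound)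
      show "integrable (C.Q N) (\<lambda>s. L * ((stR s - 1)\<^sup>2 + (norm (stS s))\<^sup>2 + 1 + (norm (stS s))\<^sup>2))" using R2 S2 by simp
      show "AE s in C.Q N. norm (stR s * (df (stY s) \<bullet> stS s)) \<le> norm (L * ((stR s - 1)\<^sup>2 + (norm (stS s))\<^sup>2 + 1 + (norm (stS s))\<^sup>2))"
      proof (rule AE_I2)
        fix s :: "'a state"
        have key: "p * q + q \<le> p\<^sup>2 + q\<^sup>2 + 1 + q\<^sup>2" for p q :: real
        proof -
          have "2 * (p * q) \<le> p\<^sup>2 + q\<^sup>2" "2 * q \<le> 1 + q\<^sup>2"
            using sum_squares_bound[of p q] sum_squares_bound[of 1 q] by simp_all
          moreover have "0 \<le> p\<^sup>2" "0 \<le> q\<^sup>2" by auto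
          ultimately show ?thesis by linarith
        qed
        have "\<bar>stR s - 1\<bar> * norm (stS s) + norm (stS s) \<le> (stR s - 1)\<^sup>2 + (norm (stS s))\<^sup>2 + 1 + (norm (stS s))\<^sup>2"
          using key[of "\<bar>stR s - 1\<bar>" "norm (stS s)"] by (simp only: power2_abs)
        moreover have "\<bar>stR s\<bar> * norm (stS s) \<le> (\<bar>stR s - 1\<bar> + 1) * norm (stS s)" by (intro mult_right_mono) auto
        ultimately have "\<bar>stR s\<bar> * norm (stS s) \<le> (stR s - 1)\<^sup>2 + (norm (stS s))\<^sup>2 + 1 + (norm (stS s))\<^sup>2"
          by (simp add: distrib_right)
        then have "L * (\<bar>stR s\<bar> * norm (stS s)) \<le> L * ((stR s - 1)\<^sup>2 + (norm (stS s))\<^sup>2 + 1 + (norm (stS s))\<^sup>2)"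
          using L_nonneg by (rule mult_left_mono)
        moreover have "\<bar>stR s * (df (stY s) \<bullet> stS s)\<bar> \<le> \<bar>stR s\<bar> * (L * norm (stS s))"
          unfolding abs_mult by (intro mult_left_mono inner_df_le) auto
        ultimately show "norm (stR s * (df (stY s) \<bullet> stS s)) \<le> norm (L * ((stR s - 1)\<^sup>2 + (norm (stS s))\<^sup>2 + 1 + (norm (stS s))\<^sup>2))"
          by (simp add: mult_ac)
      qed
    qed measurable
    ultimately have "integrable (C.Q N) (\<lambda>s. stR s * (v 1 (stY s) \<bullet> stY s))"
      using ai by (subst integrable_cong_AE[where g="\<lambda>s. stR s * (v 1 (stY s) \<bullet> ?A s) + stR s * (df (stY s) \<bullet> stS s)"]) auto
    with False show ?thesis by simp
  qed
  also have "\<dots> = h * (\<Sum>j<N. m (real j * h)) + (\<integral>s. stR s * support_fun ?K (stS s) \<partial>C.Q N)"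
    using ai RSi av by simp
  also have "\<dots> \<le> h * (\<Sum>j<N. m (real j * h)) + (gaussian_width ?K + \<epsilon> * (L * (1 + ?n) / 2))"
    using RS by simp
  also have "h * (\<Sum>j<N. m (real j * h)) \<le> t * m t + (1 - t) * m 1"
  proof -
    \<comment> \<open>\<open>J\<close> collects the grid times below \<open>t\<close>, where
      \<open>m\<close> is at most \<open>m t\<close>; the other terms are at most
      \<open>m 1\<close>. Rounding up makes \<open>card J >= t * N\<close>, which goes in the
      favourable direction because \<open>m t <= m 1\<close>.\<close>
    define J where "J = {..< nat \<lceil>t * real N\<rceil>}"
    have tN: "t * real N \<le> real N" using t by (intro mult_left_le_one_le) auto
    have cJ: "t * real N \<le> real (card J)" unfolding J_def by (simp add: real_nat_ceiling_ge)
    have JN: "J \<subseteq> {..<N}" using tN unfolding J_def by (auto simp: ceiling_le_iff nat_le_iff less_le_trans)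
    have jh: "real j * h \<le> 1" if "j < N" for j
      using that N by (simp add: h_def field_simps)
    have "(\<Sum>j<N. m (real j * h)) = (\<Sum>j\<in>J. m (real j * h)) + (\<Sum>j\<in>{..<N} - J. m (real j * h))"
      using JN by (subst sum.subset_diff[of J]) auto
    also have "\<dots> \<le> (\<Sum>j\<in>J. m t) + (\<Sum>j\<in>{..<N} - J. m 1)"
    proof (intro add_mono sum_mono)
      fix j assume "j \<in> J"
      then have "int j < \<lceil>t * real N\<rceil>" by (auto simp: J_def)
      then have "real j < t * real N" by (simp add: less_ceiling_iff)
      then have "real j * h \<le> t" using N by (simp add: h_def field_simps)
      then show "m (real j * h) \<le> m t" using t hN by (intro m_mono) auto
    next
      fix j assume "j \<in> {..<N} - J"
      then show "m (real j * h) \<le> m 1" using jh hN by (intro m_mono) auto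
    qed
    also have "\<dots> = real N * m 1 - real (card J) * (m 1 - m t)"
    proof -
      have e: "real (card ({..<N} - J)) = real N - real (card J)"
        using JN card_mono[OF _ JN] by (simp add: card_Diff_subset finite_subset of_nat_diff)
      show ?thesis unfolding sum_constant e by (simp add: algebra_simps)
    qed
    also have "\<dots> \<le> real N * m 1 - t * real N * (m 1 - m t)"
      using cJ m_mono[of t 1] t by (intro diff_left_mono mult_right_mono) auto
    finally have "h * (\<Sum>j<N. m (real j * h)) \<le> h * (real N * m 1 - t * real N * (m 1 - m t))"
      using hN by (intro mult_left_mono) auto
    also have "\<dots> = (real N * h) * m 1 - t * (real N * h) * (m 1 - m t)" by (simp add: algebra_simps)
    also have "\<dots> = t * m t + (1 - t) * m 1" unfolding hN by (simp add: algebra_simps)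
    finally show ?thesis .
  qed
  finally show ?thesis by simp
qed

text \<open>The drift contributes at most \<open>t * m t + (1 - t) * m 1\<close>; moving the second
  summand to the left of \<open>m 1 <= M + ...\<close> leaves the gap. The error of the finite chain
  disappears because \<open>\<epsilon>\<close> is arbitrary.\<close>

lemma m_gap:
  assumes H: "\<And>x. (df has_derivative H x) (at x)"
    and M: "\<And>x. - M \<le> (\<Sum>b\<in>Basis. H x b \<bullet> b)"
    and t: "0 \<le> t" "t \<le> 1"
  shows "t * (m 1 - m t) \<le> M + gaussian_width (range df)"
proof (rule field_le_epsilon)
  fix e :: real assume e: "e > 0"
  define c where "c = L * (1 + real DIM('a)) / 2"
  have c: "c \<ge> 0" using L_nonneg by (simp add: c_def)
  define \<epsilon> where "\<epsilon> = min 1 (e / (c + 1))"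
  have \<epsilon>: "\<epsilon> > 0" "\<epsilon> \<le> 1" using e c by (auto simp: \<epsilon>_def)
  have "\<epsilon> * c \<le> e / (c + 1) * c" using c by (intro mult_right_mono) (auto simp: \<epsilon>_def)
  also have "\<dots> \<le> e" using e c by (simp add: field_simps)
  finally have ec: "\<epsilon> * c \<le> e" .
  have m1: "m 1 = (\<integral>x. exp (f x) * (df x \<bullet> df x) \<partial>std_gaussian)"
    unfolding m_def by (subst integral_law) (auto simp: g_1 v_1 power2_norm_eq_inner)
  have dx: "(\<integral>y. df y \<bullet> y \<partial>law 1) = (\<integral>x. exp (f x) * (df x \<bullet> x) \<partial>std_gaussian)"
    by (subst integral_law) (auto simp: g_1)
  have i1: "integrable std_gaussian (\<lambda>x. exp (f x) * (df x \<bullet> df x))"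
  proof (rule Bochner_Integration.integrable_bound)
    show "integrable std_gaussian (\<lambda>x. exp (f (0 + 1 *\<^sub>R x)) * L\<^sup>2)" using integrable_exp_f[of 0 1] by simp
    show "AE x in std_gaussian. norm (exp (f x) * (df x \<bullet> df x)) \<le> norm (exp (f (0 + 1 *\<^sub>R x)) * L\<^sup>2)"
      using norm_df_le by (auto simp: abs_mult power2_norm_eq_inner[symmetric] intro!: power_mono)
  qed measurable
  have i2: "integrable std_gaussian (\<lambda>x. exp (f x) * (df x \<bullet> x))"
  proof (rule integrable_std_gaussian_exp_bound'[of _ "exp (f 0) * L" "L + 1"])
    fix x :: 'a
    have "\<bar>exp (f x) * (df x \<bullet> x)\<bar> \<le> (exp (f 0) * exp (L * norm x)) * (L * exp (norm x))"
      unfolding abs_mult using exp_f_shift_le[of 0 x] L_nonneg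
      by (intro mult_mono order_trans[OF inner_df_le] mult_left_mono le_exp_self) auto
    also have "\<dots> = exp (f 0) * L * exp ((L + 1) * norm x)"
      by (simp add: exp_add[symmetric] distrib_right add.commute)
    finally show "norm (exp (f x) * (df x \<bullet> x)) \<le> exp (f 0) * L * exp ((L + 1) * norm x)" by simp
  qed measurable
  have "m 1 - (\<integral>y. df y \<bullet> y \<partial>law 1) = (\<integral>x. exp (f x) * (df x \<bullet> (df x - x)) \<partial>std_gaussian)"
    unfolding m1 dx using i1 i2 by (simp add: inner_diff_right right_diff_distrib)
  also have "\<dots> \<le> M" by (rule integral_norm_df_sq_le[OF H M integral_exp_f])
  finally have "m 1 \<le> M + (\<integral>y. df y \<bullet> y \<partial>law 1)" by simp
  also have "\<dots> \<le> M + (gaussian_width (range df) + (t * m t + (1 - t) * m 1) + \<epsilon> * c)"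
    using integral_inner_df_le[OF \<epsilon> t, folded c_def] by simp
  finally have "m 1 \<le> M + (gaussian_width (range df) + (t * m t + (1 - t) * m 1) + \<epsilon> * c)" .
  moreover have "t * (a - b) \<le> M + G + e" if "a \<le> M + (G + (t * b + (1 - t) * a) + x)" "x \<le> e" for a b G x :: real
    using that by (simp add: algebra_simps)
  ultimately show "t * (m 1 - m t) \<le> M + gaussian_width (range df) + e"
    using ec by blast
qed

end

section \<open>Transport from the law at time 1 to a Gaussian convolution\<close>

context normalized_potential
begin

text \<open>Outside the common part of the two laws the cost is weighted by \<open>|R - 1|\<close>,
  which is small only in L^2. Pairing it with squared norms requires fourth moments that do not
  depend on the number of steps.\<close>

lemma fourth_moment_finite:
  assumes t: "0 \<le> t" "t \<le> 1"
  shows "(\<integral>\<^sup>+x. \<integral>\<^sup>+z. ennreal ((norm x + L + norm (z::'a)) ^ 4) \<partial>std_gaussian \<partial>law t) < \<infinity>"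
proof -
  define I where "I = (\<integral>z. exp (norm (z::'a)) \<partial>std_gaussian)"
  have Ii: "integrable std_gaussian (\<lambda>z::'a. exp (norm z))" using integrable_exp_norm[of 1] by simp
  have I0: "I \<ge> 0" unfolding I_def by (rule integral_nonneg_AE) auto
  have "(\<integral>\<^sup>+x. \<integral>\<^sup>+z. ennreal ((norm x + L + norm (z::'a)) ^ 4) \<partial>std_gaussian \<partial>law t) \<le>
      (\<integral>\<^sup>+x. ennreal (24 * exp L * I * exp (norm x)) \<partial>law t)"
  proof (rule nn_integral_mono)
    fix x :: 'a
    have "(\<integral>\<^sup>+z. ennreal ((norm x + L + norm (z::'a)) ^ 4) \<partial>std_gaussian) \<le> (\<integral>\<^sup>+z. ennreal ((24 * exp L * exp (norm x)) * exp (norm (z::'a))) \<partial>std_gaussian)"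
    proof (intro nn_integral_mono ennreal_leI)
      fix z :: 'a
      have "norm (norm x + L + norm z) ^ 4 \<le> fact 4 * exp (norm (norm x + L + norm z))" by (rule norm_power_le_exp)
      then show "(norm x + L + norm z) ^ 4 \<le> (24 * exp L * exp (norm x)) * exp (norm z)"
        using L_nonneg by (simp add: fact_numeral exp_add mult_ac)
    qed
    also have "\<dots> = ennreal ((24 * exp L * exp (norm x)) * I)"
      unfolding I_def using Ii by (subst nn_integral_eq_integral) auto
    finally show "(\<integral>\<^sup>+z. ennreal ((norm x + L + norm (z::'a)) ^ 4) \<partial>std_gaussian) \<le> ennreal (24 * exp L * I * exp (norm x))"
      by (simp add: mult_ac)
  qed
  also have "\<dots> = (\<integral>\<^sup>+z. ennreal (g t (sqrt t *\<^sub>R z)) * ennreal (24 * exp L * I * exp (norm (sqrt t *\<^sub>R z))) \<partial>std_gaussian)"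
    by (rule nn_integral_law) measurable
  also have "\<dots> \<le> (\<integral>\<^sup>+z. ennreal ((g t 0 * (24 * exp L * I)) * exp ((L + 1) * norm (z::'a))) \<partial>std_gaussian)"
  proof (rule nn_integral_mono)
    fix z :: 'a
    have n: "norm (sqrt t *\<^sub>R z) \<le> norm z" using t mult_right_mono[of "sqrt t" 1 "norm z"] by simp
    have "g t (sqrt t *\<^sub>R z) \<le> g t 0 * exp (L * norm z)"
      using g_shift_le[of t 0 "sqrt t *\<^sub>R z"] n L_nonneg g_nonneg[of t 0]
      by (auto intro: order_trans mult_left_mono)
    then have "g t (sqrt t *\<^sub>R z) * (24 * exp L * I * exp (norm (sqrt t *\<^sub>R z))) \<le> (g t 0 * exp (L * norm z)) * (24 * exp L * I * exp (norm z))"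
      using n I0 g_nonneg by (intro mult_mono mult_left_mono) auto
    also have "\<dots> = (g t 0 * (24 * exp L * I)) * exp ((L + 1) * norm z)" by (simp add: distrib_right exp_add)
    finally show "ennreal (g t (sqrt t *\<^sub>R z)) * ennreal (24 * exp L * I * exp (norm (sqrt t *\<^sub>R z))) \<le> ennreal ((g t 0 * (24 * exp L * I)) * exp ((L + 1) * norm z))"
      using g_nonneg I0 by (subst ennreal_mult[symmetric]) (auto intro!: ennreal_leI)
  qed
  also have "\<dots> < \<infinity>"
    using integrable_exp_norm[of "L + 1"] g_nonneg I0 by (subst nn_integral_eq_integral) auto
  finally show ?thesis .
qed

text \<open>The law of $X_t+(1-t)\,v_t(X_t)$, the conditional mean of $X_1$ given $X_t$.\<close>

definition mixing :: "real \<Rightarrow> 'a measure" where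
  "mixing t = distr (law t) borel (\<lambda>x. x + (1 - t) *\<^sub>R v t x)"

lemma prob_space_mixing: "0 \<le> t \<Longrightarrow> t \<le> 1 \<Longrightarrow> prob_space (mixing t)"
  unfolding mixing_def by (rule prob_space.prob_space_distr[OF prob_space_law]) auto

lemma sets_mixing [simp, measurable_cong]: "sets (mixing t) = sets borel"
  by (simp add: mixing_def)

text \<open>One chain carries both laws: weighted, \<open>stY\<close> has law \<open>law 1\<close>;
  unweighted, \<open>Y\<close> has the law of the convolution. On the common part their difference
  is the drift error minus a rescaling of the noise, and the remaining part is arbitrarily
  small.\<close>

lemma W2_law_le:
  assumes t: "0 \<le> t" "t < 1"
  shows "W2_squared (law 1) (distr (std_gaussian \<Otimes>\<^sub>M mixing t) borel (\<lambda>(x, y). x + y))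
    \<le> ennreal (2 * (1 - t)\<^sup>2 * (m 1 - m t) + 2 * (1 - sqrt (1 - t))\<^sup>2 * real DIM('a))"
proof (rule ennreal_le_epsilon)
  fix e :: real assume e: "e > 0"
  define s where "s = 1 - t"
  have s: "0 < s" "s \<le> 1" "sqrt s > 0" "sqrt s \<le> 1" using t by (auto simp: s_def)
  define C4 where "C4 = enn2real (\<integral>\<^sup>+x. \<integral>\<^sup>+z. ennreal ((norm x + L + norm (z::'a)) ^ 4) \<partial>std_gaussian \<partial>law t)"
  have C4: "C4 \<ge> 0" "(\<integral>\<^sup>+x. \<integral>\<^sup>+z. ennreal ((norm x + L + norm (z::'a)) ^ 4) \<partial>std_gaussian \<partial>law t) = ennreal C4"
    using fourth_moment_finite[of t] t by (auto simp: C4_def less_top)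
  \<comment> \<open>Chosen so that each of the two terms off the common part, bounded by
    \<open>\<epsilon> + \<epsilon> * C4\<close>, is exactly \<open>e / 2\<close>.\<close>
  define \<epsilon> where "\<epsilon> = e / (2 * (C4 + 1))"
  have "\<epsilon> * (2 * (C4 + 1)) = e" unfolding \<epsilon>_def using C4(1) by simp
  then have "2 * (\<epsilon> * C4 + \<epsilon>) = e" by (simp add: algebra_simps)
  moreover have "\<epsilon> > 0" using e C4(1) by (simp add: \<epsilon>_def)
  ultimately have \<epsilon>: "\<epsilon> > 0" "2 * (\<epsilon> * C4 + \<epsilon>) = e" by auto
  have "\<epsilon>\<^sup>2 > 0" using \<epsilon> by simp
  then obtain N where N: "N > 0" "integrable (chain t ((1 - t) / real N) N) (\<lambda>s. (stR s - 1)\<^sup>2)"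
    "(\<integral>s. (stR s - 1)\<^sup>2 \<partial>chain t ((1 - t) / real N) N) \<le> \<epsilon>\<^sup>2"
    using chain_approximation[of t "\<epsilon>\<^sup>2"] t by auto
  define h where "h = (1 - t) / real N"
  have hN: "real N * h = s" "h > 0" using N t by (auto simp: h_def s_def)
  interpret C: tilted_chain f df L t h N by unfold_locales (use hN t s_def in auto)
  have R2: "integrable (C.Q N) (\<lambda>s. (stR s - 1)\<^sup>2)" "(\<integral>s. (stR s - 1)\<^sup>2 \<partial>C.Q N) \<le> \<epsilon>\<^sup>2"
    using N by (simp_all add: h_def)
  have t1: "t + real N * h = 1" using hN by (simp add: s_def)
  have bounds: "AE q in C.Q N. 0 \<le> stR q \<and> norm (stY q - stX q - stS q) \<le> s * L"
    using chain_bounds[of t h N] t hN by auto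
  \<comment> \<open>The noise \<open>stS\<close> has variance \<open>s\<close>; dividing by
    \<open>sqrt s\<close> gives the unit variance of \<open>\<gamma>\<close>. The price is
    \<open>(1 / sqrt s - 1)^2 * s * n = (1 - sqrt s)^2 * n\<close>.\<close>
  define Y where "Y q = stX q + s *\<^sub>R v t (stX q) + (1 / sqrt s) *\<^sub>R stS q" for q
  have [measurable]: "Y \<in> borel_measurable borel" unfolding Y_def by measurable
  define Z where "Z q = stY q - stX q - stS q - s *\<^sub>R v t (stX q)" for q
  have [measurable]: "Z \<in> borel_measurable borel" unfolding Z_def by measurable
  \<comment> \<open>A common bound for both end points in terms of the start and the noise alone,
    whose joint law is explicit and the same for every step size.\<close>
  define w where "w q = norm (stX q) + L + norm (stS q) / sqrt s" for q
  have [measurable]: "w \<in> borel_measurable borel" unfolding w_def by measurable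
  have wY: "norm (Y q) \<le> w q" for q
  proof -
    have "norm (Y q) \<le> norm (stX q) + norm (s *\<^sub>R v t (stX q)) + norm ((1 / sqrt s) *\<^sub>R stS q)"
      unfolding Y_def by (intro order_trans[OF norm_triangle_ineq] add_right_mono norm_triangle_ineq)
    moreover have "norm (s *\<^sub>R v t (stX q)) \<le> 1 * L"
      unfolding norm_scaleR using s norm_v_le L_nonneg by (intro mult_mono) auto
    ultimately show ?thesis using s by (simp add: w_def)
  qed
  have wX: "AE q in C.Q N. norm (stY q) \<le> w q"
    using bounds
  proof eventually_elim
    fix q :: "'a state" assume q: "0 \<le> stR q \<and> norm (stY q - stX q - stS q) \<le> s * L"
    have "stY q = stX q + (stY q - stX q - stS q) + stS q" by simp
    then have "norm (stY q) \<le> norm (stX q) + norm (stY q - stX q - stS q) + norm (stS q)"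
      by (metis (no_types, opaque_lifting) add_mono_thms_linordered_semiring(3) norm_triangle_ineq order_trans)
    moreover have "s * L \<le> 1 * L" using s L_nonneg by (intro mult_right_mono) auto
    moreover have "norm (stS q) \<le> norm (stS q) / sqrt s"
      using s by (simp add: pos_le_divide_eq mult_left_le)
    ultimately show "norm (stY q) \<le> w q" using q by (simp add: w_def)
  qed
  have nnw: "(\<integral>\<^sup>+q. ennreal (w q ^ 4) \<partial>C.Q N) = ennreal C4"
  proof -
    have "(\<integral>\<^sup>+q. ennreal (w q ^ 4) \<partial>C.Q N) = (\<integral>\<^sup>+q. (\<lambda>p. ennreal ((norm (fst p) + L + norm (snd p) / sqrt s) ^ 4)) (stX q, stS q) \<partial>C.Q N)"
      by (simp add: w_def)
    also have "\<dots> = (\<integral>\<^sup>+x. \<integral>\<^sup>+z. (\<lambda>p. ennreal ((norm (fst p) + L + norm (snd p) / sqrt s) ^ 4)) (x, sqrt (real N * h) *\<^sub>R (z::'a)) \<partial>std_gaussian \<partial>law t)"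
      by (rule nn_integral_chain_noise[where \<psi>="\<lambda>p. ennreal ((norm (fst p) + L + norm (snd p) / sqrt s) ^ 4)",
            OF t(1) less_imp_le[OF t(2)] less_imp_le[OF hN(2)]]) measurable
    also have "\<dots> = ennreal C4" unfolding C4(2)[symmetric] using s by (simp add: hN)
    finally show ?thesis .
  qed
  have nnR: "(\<integral>\<^sup>+q. ennreal ((stR q - 1)\<^sup>2) \<partial>C.Q N) \<le> ennreal (\<epsilon>\<^sup>2)"
    using R2 by (subst nn_integral_eq_integral) (auto intro: ennreal_leI)
  \<comment> \<open>The coupling lemma asks for a weight nonnegative at every state, while
    \<open>stR\<close> is so only almost everywhere; hence the absolute value.\<close>
  have off: "(\<integral>\<^sup>+q. ennreal (2 * (\<bar>\<bar>stR q\<bar> - 1\<bar> * (norm (U q))\<^sup>2)) \<partial>C.Q N) \<le> ennreal (e / 2)"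
    if U: "AE q in C.Q N. norm (U q) \<le> w q" for U :: "'a state \<Rightarrow> 'a"
  proof -
    have "(\<integral>\<^sup>+q. ennreal (2 * (\<bar>\<bar>stR q\<bar> - 1\<bar> * (norm (U q))\<^sup>2)) \<partial>C.Q N) \<le>
      (\<integral>\<^sup>+q. ennreal (1 / \<epsilon>) * ennreal ((stR q - 1)\<^sup>2) + ennreal \<epsilon> * ennreal (w q ^ 4) \<partial>C.Q N)"
    proof (rule nn_integral_mono_AE)
      show "AE q in C.Q N. ennreal (2 * (\<bar>\<bar>stR q\<bar> - 1\<bar> * (norm (U q))\<^sup>2)) \<le> ennreal (1 / \<epsilon>) * ennreal ((stR q - 1)\<^sup>2) + ennreal \<epsilon> * ennreal (w q ^ 4)"
        using U bounds
      proof eventually_elim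
        fix q :: "'a state" assume q: "norm (U q) \<le> w q" "0 \<le> stR q \<and> norm (stY q - stX q - stS q) \<le> s * L"
        have "0 \<le> (\<bar>stR q - 1\<bar> / sqrt \<epsilon> - sqrt \<epsilon> * (w q)\<^sup>2)\<^sup>2" by simp
        also have "\<dots> = 1 / \<epsilon> * (stR q - 1)\<^sup>2 + \<epsilon> * w q ^ 4 - 2 * (\<bar>stR q - 1\<bar> * (w q)\<^sup>2)"
          using \<epsilon>(1) by (simp add: power2_diff power_mult_distrib power_divide)
        finally have 1: "2 * (\<bar>stR q - 1\<bar> * (w q)\<^sup>2) \<le> 1 / \<epsilon> * (stR q - 1)\<^sup>2 + \<epsilon> * w q ^ 4" by simp
        have "(norm (U q))\<^sup>2 \<le> (w q)\<^sup>2" using q(1) by (intro power_mono) auto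
        then have "2 * (\<bar>stR q - 1\<bar> * (norm (U q))\<^sup>2) \<le> 2 * (\<bar>stR q - 1\<bar> * (w q)\<^sup>2)" by (intro mult_left_mono) auto
        with 1 have "2 * (\<bar>stR q - 1\<bar> * (norm (U q))\<^sup>2) \<le> 1 / \<epsilon> * (stR q - 1)\<^sup>2 + \<epsilon> * w q ^ 4" by linarith
        then have "ennreal (2 * (\<bar>\<bar>stR q\<bar> - 1\<bar> * (norm (U q))\<^sup>2)) \<le> ennreal (1 / \<epsilon> * (stR q - 1)\<^sup>2 + \<epsilon> * w q ^ 4)"
          using q(2) by (intro ennreal_leI) simp
        also have "\<dots> = ennreal (1 / \<epsilon> * (stR q - 1)\<^sup>2) + ennreal (\<epsilon> * w q ^ 4)"
          using \<epsilon>(1) by (intro ennreal_plus) auto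
        also have "\<dots> = ennreal (1 / \<epsilon>) * ennreal ((stR q - 1)\<^sup>2) + ennreal \<epsilon> * ennreal (w q ^ 4)"
          using \<epsilon>(1) by (simp only: ennreal_mult' less_imp_le zero_le_divide_1_iff)
        finally show "ennreal (2 * (\<bar>\<bar>stR q\<bar> - 1\<bar> * (norm (U q))\<^sup>2)) \<le> ennreal (1 / \<epsilon>) * ennreal ((stR q - 1)\<^sup>2) + ennreal \<epsilon> * ennreal (w q ^ 4)" .
      qed
    qed
    also have "\<dots> = ennreal (1 / \<epsilon>) * (\<integral>\<^sup>+q. ennreal ((stR q - 1)\<^sup>2) \<partial>C.Q N) + ennreal \<epsilon> * (\<integral>\<^sup>+q. ennreal (w q ^ 4) \<partial>C.Q N)"
      by (subst nn_integral_add, measurable, subst (1 2) nn_integral_cmult) auto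
    also have "\<dots> \<le> ennreal (1 / \<epsilon>) * ennreal (\<epsilon>\<^sup>2) + ennreal \<epsilon> * ennreal C4"
      unfolding nnw by (intro add_right_mono mult_left_mono nnR) auto
    also have "\<dots> = ennreal (\<epsilon> + \<epsilon> * C4)"
      using \<epsilon>(1) C4 by (simp add: ennreal_mult[symmetric] ennreal_plus[symmetric] power2_eq_square del: ennreal_plus)
    also have "\<epsilon> + \<epsilon> * C4 = e / 2" using \<epsilon>(2) by simp
    finally show ?thesis .
  qed
  have on: "(\<integral>\<^sup>+q. ennreal (min 1 \<bar>stR q\<bar>) * ennreal ((norm (stY q - Y q))\<^sup>2) \<partial>C.Q N)
     \<le> ennreal (2 * s\<^sup>2 * (m 1 - m t) + 2 * (1 - sqrt s)\<^sup>2 * real DIM('a))"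
  proof -
    let ?a = "1 / sqrt s - 1"
    have Z2: "integrable (C.Q N) (\<lambda>q. stR q * (norm (Z q))\<^sup>2)"
    proof (rule C.integrable_R_mult)
      show "AE q in C.Q N. \<bar>(norm (Z q))\<^sup>2\<bar> \<le> (s * L + s * L)\<^sup>2"
        using bounds
      proof eventually_elim
        fix q :: "'a state" assume q: "0 \<le> stR q \<and> norm (stY q - stX q - stS q) \<le> s * L"
        have "norm (s *\<^sub>R v t (stX q)) \<le> s * L" using s norm_v_le by (auto intro!: mult_left_mono)
        then have "norm (Z q) \<le> s * L + s * L"
          using q norm_triangle_ineq4[of "stY q - stX q - stS q" "s *\<^sub>R v t (stX q)"] unfolding Z_def by linarith
        from power_mono[OF this norm_ge_zero, of 2] show "\<bar>(norm (Z q))\<^sup>2\<bar> \<le> (s * L + s * L)\<^sup>2" by (simp only: abs_power2 abs_norm_cancel power2_abs)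
      qed
    qed auto
    have Zle: "(\<integral>q. stR q * (norm (Z q))\<^sup>2 \<partial>C.Q N) \<le> s\<^sup>2 * (m 1 - m t)"
      using C.integral_R_drift_error[of N, unfolded t1] unfolding Z_def hN by simp
    have S2: "integrable (C.Q N) (\<lambda>q. (norm (stS q))\<^sup>2)" "(\<integral>q. (norm (stS q))\<^sup>2 \<partial>C.Q N) = s * real DIM('a)"
      using C.integral_noise[of "\<lambda>x. (norm x)\<^sup>2" N] integrable_std_gaussian_norm_power[of 2, where 'a='a]
        integral_std_gaussian_norm_sq[where 'a='a] s by (simp_all add: hN power_mult_distrib)
    have bi: "integrable (C.Q N) (\<lambda>q. 2 * (stR q * (norm (Z q))\<^sup>2) + 2 * ?a\<^sup>2 * (norm (stS q))\<^sup>2)"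
      using Z2 S2 by simp
    have "(\<integral>\<^sup>+q. ennreal (min 1 \<bar>stR q\<bar>) * ennreal ((norm (stY q - Y q))\<^sup>2) \<partial>C.Q N)
      \<le> (\<integral>\<^sup>+q. ennreal (2 * (stR q * (norm (Z q))\<^sup>2) + 2 * ?a\<^sup>2 * (norm (stS q))\<^sup>2) \<partial>C.Q N)"
    proof (rule nn_integral_mono_AE)
      show "AE q in C.Q N. ennreal (min 1 \<bar>stR q\<bar>) * ennreal ((norm (stY q - Y q))\<^sup>2) \<le> ennreal (2 * (stR q * (norm (Z q))\<^sup>2) + 2 * ?a\<^sup>2 * (norm (stS q))\<^sup>2)"
        using C.AE_R
      proof eventually_elim
        fix q :: "'a state" assume q: "0 \<le> stR q"
        let ?mn = "min 1 (stR q)"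
        have "stY q - Y q = Z q - ?a *\<^sub>R stS q" by (simp add: Y_def Z_def algebra_simps)
        then have "(norm (stY q - Y q))\<^sup>2 \<le> 2 * (norm (Z q))\<^sup>2 + 2 * (norm (?a *\<^sub>R stS q))\<^sup>2"
          using norm_diff_sq_le[of "Z q" "?a *\<^sub>R stS q"] by simp
        also have "(norm (?a *\<^sub>R stS q))\<^sup>2 = ?a\<^sup>2 * (norm (stS q))\<^sup>2" by (simp add: power_mult_distrib)
        finally have "?mn * (norm (stY q - Y q))\<^sup>2 \<le> ?mn * (2 * (norm (Z q))\<^sup>2 + 2 * (?a\<^sup>2 * (norm (stS q))\<^sup>2))"
          using q by (intro mult_left_mono) auto
        also have "\<dots> = 2 * (?mn * (norm (Z q))\<^sup>2) + 2 * ?a\<^sup>2 * (?mn * (norm (stS q))\<^sup>2)" by (simp add: algebra_simps)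
        \<comment> \<open>\<open>min 1 R\<close> is bounded by \<open>R\<close> in the drift term,
          where the weighted identities hold, and by 1 in the noise term, where the unweighted
          Gaussian law holds.\<close>
        also have "\<dots> \<le> 2 * (stR q * (norm (Z q))\<^sup>2) + 2 * ?a\<^sup>2 * (1 * (norm (stS q))\<^sup>2)"
          using q by (intro add_mono mult_left_mono mult_right_mono) auto
        finally show "ennreal (min 1 \<bar>stR q\<bar>) * ennreal ((norm (stY q - Y q))\<^sup>2) \<le> ennreal (2 * (stR q * (norm (Z q))\<^sup>2) + 2 * ?a\<^sup>2 * (norm (stS q))\<^sup>2)"
          using q by (subst ennreal_mult[symmetric]) (auto intro!: ennreal_leI simp del: ennreal_plus)
      qed
    qed
    also have "\<dots> = ennreal (\<integral>q. 2 * (stR q * (norm (Z q))\<^sup>2) + 2 * ?a\<^sup>2 * (norm (stS q))\<^sup>2 \<partial>C.Q N)"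
    proof (rule nn_integral_eq_integral[OF bi])
      show "AE q in C.Q N. 0 \<le> 2 * (stR q * (norm (Z q))\<^sup>2) + 2 * ?a\<^sup>2 * (norm (stS q))\<^sup>2"
        using C.AE_R[of N] by eventually_elim (intro add_nonneg_nonneg mult_nonneg_nonneg, auto)
    qed
    also have "(\<integral>q. 2 * (stR q * (norm (Z q))\<^sup>2) + 2 * ?a\<^sup>2 * (norm (stS q))\<^sup>2 \<partial>C.Q N)
        = 2 * (\<integral>q. stR q * (norm (Z q))\<^sup>2 \<partial>C.Q N) + 2 * ?a\<^sup>2 * (s * real DIM('a))"
      using Z2 S2 by simp
    also have "\<dots> \<le> 2 * (s\<^sup>2 * (m 1 - m t)) + 2 * ?a\<^sup>2 * (s * real DIM('a))" using Zle by simp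
    also have "?a\<^sup>2 * s = (1 - sqrt s)\<^sup>2"
    proof -
      have "?a\<^sup>2 * s = (?a * sqrt s)\<^sup>2" using s by (simp add: power_mult_distrib)
      also have "?a * sqrt s = 1 - sqrt s" using s by (simp add: left_diff_distrib)
      finally show ?thesis .
    qed
    then have "2 * (s\<^sup>2 * (m 1 - m t)) + 2 * ?a\<^sup>2 * (s * real DIM('a)) = 2 * s\<^sup>2 * (m 1 - m t) + 2 * (1 - sqrt s)\<^sup>2 * real DIM('a)"
      by (simp only: mult.assoc[symmetric]) (simp add: mult.assoc)
    finally show ?thesis by (simp add: ennreal_leI)
  qed
  have lawX: "distr (density (C.Q N) (\<lambda>q. ennreal \<bar>stR q\<bar>)) borel stY = law 1"
  proof -
    have "density (C.Q N) (\<lambda>q. ennreal \<bar>stR q\<bar>) = density (C.Q N) (\<lambda>q. ennreal (stR q))"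
      using C.AE_R[of N] by (intro density_cong) auto
    then show ?thesis using C.distr_tilted_Y[of N] by (simp add: t1)
  qed
  have lawY: "distr (C.Q N) borel Y = distr (std_gaussian \<Otimes>\<^sub>M mixing t) borel (\<lambda>(x, y). x + y)"
  proof (rule measure_eqI)
    fix A assume "A \<in> sets (distr (C.Q N) borel Y)"
    then have [measurable]: "A \<in> sets borel" by simp
    interpret mu: prob_space "mixing t" using t by (intro prob_space_mixing) auto
    interpret l: prob_space "law t" using t by (intro prob_space_law) auto
    interpret P: pair_sigma_finite "law t" "std_gaussian :: 'a measure" ..
    let ?F = "\<lambda>p. indicator A (fst p + s *\<^sub>R v t (fst p) + (1 / sqrt s) *\<^sub>R snd p) :: ennreal"
    have "emeasure (distr (C.Q N) borel Y) A = (\<integral>\<^sup>+q. ?F (stX q, stS q) \<partial>C.Q N)"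
      by (simp add: nn_integral_indicator[symmetric] nn_integral_distr Y_def del: nn_integral_indicator)
    also have "\<dots> = (\<integral>\<^sup>+x. \<integral>\<^sup>+z. ?F (x, sqrt (real N * h) *\<^sub>R (z::'a)) \<partial>std_gaussian \<partial>law t)"
      by (rule nn_integral_chain_noise[where \<psi>="?F", OF t(1) less_imp_le[OF t(2)] less_imp_le[OF hN(2)]]) measurable
    also have "\<dots> = (\<integral>\<^sup>+x. \<integral>\<^sup>+z. indicator A (x + s *\<^sub>R v t x + z) \<partial>std_gaussian \<partial>law t)"
      using s by (simp add: hN)
    also have "\<dots> = (\<integral>\<^sup>+z. \<integral>\<^sup>+x. indicator A (x + s *\<^sub>R v t x + z) \<partial>law t \<partial>std_gaussian)"
      by (rule P.Fubini'[symmetric]) measurable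
    also have "\<dots> = (\<integral>\<^sup>+z. \<integral>\<^sup>+y. indicator A (z + y) \<partial>mixing t \<partial>std_gaussian)"
      unfolding mixing_def by (subst nn_integral_distr) (auto simp: s_def add_ac)
    also have "\<dots> = emeasure (distr (std_gaussian \<Otimes>\<^sub>M mixing t) borel (\<lambda>(x, y). x + y)) A"
    proof -
      have m: "(\<lambda>p. indicator A (fst p + snd p) :: ennreal) \<in> borel_measurable (std_gaussian \<Otimes>\<^sub>M mixing t)" by measurable
      have "(\<integral>\<^sup>+z. \<integral>\<^sup>+y. indicator A (z + y) \<partial>mixing t \<partial>std_gaussian) = (\<integral>\<^sup>+p. indicator A (fst p + snd p) \<partial>(std_gaussian \<Otimes>\<^sub>M mixing t))"
        using mu.nn_integral_fst[OF m] by simp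
      also have "\<dots> = (\<integral>\<^sup>+y. indicator A y \<partial>distr (std_gaussian \<Otimes>\<^sub>M mixing t) borel (\<lambda>(x, y). x + y))"
        by (subst nn_integral_distr) (auto simp: case_prod_beta')
      finally show ?thesis by simp
    qed
    finally show "emeasure (distr (C.Q N) borel Y) A = emeasure (distr (std_gaussian \<Otimes>\<^sub>M mixing t) borel (\<lambda>(x, y). x + y)) A" .
  qed simp
  have R1: "(\<integral>\<^sup>+q. ennreal \<bar>stR q\<bar> \<partial>C.Q N) = 1"
  proof -
    have "(\<integral>\<^sup>+q. ennreal \<bar>stR q\<bar> \<partial>C.Q N) = (\<integral>\<^sup>+q. ennreal (stR q) \<partial>C.Q N)"
      using C.AE_R[of N] by (intro nn_integral_cong_AE) auto
    also have "\<dots> = 1"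
      using C.has_integral_R[of N] C.AE_R[of N] by (subst nn_integral_eq_integral) auto
    finally show ?thesis .
  qed
  have "W2_squared (law 1) (distr (std_gaussian \<Otimes>\<^sub>M mixing t) borel (\<lambda>(x, y). x + y)) \<le>
      (\<integral>\<^sup>+q. ennreal (min 1 \<bar>stR q\<bar>) * ennreal ((norm (stY q - Y q))\<^sup>2) \<partial>C.Q N)
      + ((\<integral>\<^sup>+q. ennreal (2 * (\<bar>\<bar>stR q\<bar> - 1\<bar> * (norm (stY q))\<^sup>2)) \<partial>C.Q N) + (\<integral>\<^sup>+q. ennreal (2 * (\<bar>\<bar>stR q\<bar> - 1\<bar> * (norm (Y q))\<^sup>2)) \<partial>C.Q N))"
    unfolding lawX[symmetric] lawY[symmetric]
    by (rule W2_squared_density_le) (use C.Q.prob_space_axioms R1 in auto)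
  also have "\<dots> \<le> ennreal (2 * s\<^sup>2 * (m 1 - m t) + 2 * (1 - sqrt s)\<^sup>2 * real DIM('a)) + (ennreal (e / 2) + ennreal (e / 2))"
    by (intro add_mono on off wX) (simp add: wY)
  also have "ennreal (e / 2) + ennreal (e / 2) = ennreal e"
    using e by (subst ennreal_plus[symmetric]) auto
  finally show "W2_squared (law 1) (distr (std_gaussian \<Otimes>\<^sub>M mixing t) borel (\<lambda>(x, y). x + y)) \<le>
    ennreal (2 * (1 - t)\<^sup>2 * (m 1 - m t) + 2 * (1 - sqrt (1 - t))\<^sup>2 * real DIM('a)) + ennreal e"
    by (simp add: s_def)
qed

text \<open>Needed only when \<open>M + D = 0\<close>: the time used there is 0, at which the gap
  inequality carries no information.\<close>

lemma m_tendsto_0: "(\<lambda>i. m (1 / real (Suc i))) \<longlonglongrightarrow> m 0"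
proof -
  define \<tau> where "\<tau> i = 1 / real (Suc i)" for i
  have \<tau>: "0 \<le> \<tau> i" "\<tau> i \<le> 1" for i by (auto simp: \<tau>_def)
  have \<tau>0: "\<tau> \<longlonglongrightarrow> 0" unfolding \<tau>_def by (rule tendsto_inverse_Suc)
  \<comment> \<open>The argument of \<open>f\<close> in \<open>g\<close> at time
    \<open>\<tau>\<close> and point \<open>sqrt \<tau> z\<close>. It tends to \<open>z'\<close>
    whatever \<open>z\<close> is, so the values of \<open>g\<close> and \<open>V\<close> lose their
    dependence on the point.\<close>
  define p where "p i z z' = sqrt (\<tau> i) *\<^sub>R z + sqrt (1 - \<tau> i) *\<^sub>R z'" for i and z z' :: 'a
  have plim: "(\<lambda>i. p i z z') \<longlonglongrightarrow> z'" for z z'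
  proof -
    have "(\<lambda>i. sqrt (\<tau> i) *\<^sub>R z + sqrt (1 - \<tau> i) *\<^sub>R z') \<longlonglongrightarrow> sqrt 0 *\<^sub>R z + sqrt (1 - 0) *\<^sub>R z'"
      by (intro tendsto_intros \<tau>0)
    then show ?thesis by (simp add: p_def)
  qed
  have pn: "norm (p i z z') \<le> norm z + norm z'" for i z z'
  proof -
    have "norm (p i z z') \<le> sqrt (\<tau> i) * norm z + sqrt (1 - \<tau> i) * norm z'"
      unfolding p_def using norm_triangle_ineq[of "sqrt (\<tau> i) *\<^sub>R z" "sqrt (1 - \<tau> i) *\<^sub>R z'"] \<tau>[of i] by simp
    also have "\<dots> \<le> 1 * norm z + 1 * norm z'" using \<tau>[of i] by (intro add_mono mult_right_mono) auto
    finally show ?thesis by simp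
  qed
  have pb: "exp (f (p i z z')) \<le> exp (f 0) * exp (L * norm z) * exp (L * norm z')" for i z z'
  proof -
    have "exp (f (p i z z')) \<le> exp (f 0) * exp (L * norm (p i z z'))" using exp_f_shift_le[of 0 "p i z z'"] by simp
    also have "\<dots> \<le> exp (f 0) * exp (L * (norm z + norm z'))" using pn L_nonneg by (simp add: mult_left_mono)
    finally show ?thesis by (simp add: distrib_left exp_add mult_ac)
  qed
  have flim: "(\<lambda>i. exp (f (p i z z'))) \<longlonglongrightarrow> exp (f z')" for z z'
    using continuous_f[of UNIV] isCont_tendsto_compose[OF _ plim[of z z'], of f]
    by (intro tendsto_exp) (auto simp: continuous_on_eq_continuous_at)
  have dlim: "(\<lambda>i. df (p i z z')) \<longlonglongrightarrow> df z'" for z z'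
    using continuous_df isCont_tendsto_compose[OF _ plim[of z z'], of df] by (auto simp: continuous_on_eq_continuous_at)
  have glim: "(\<lambda>i. g (\<tau> i) (sqrt (\<tau> i) *\<^sub>R z)) \<longlonglongrightarrow> g 0 0" for z
    unfolding g_def p_def[symmetric]
  proof (rule integral_dominated_convergence[where w="\<lambda>z'. exp (f 0) * exp (L * norm z) * exp (L * norm z')"])
    show "integrable std_gaussian (\<lambda>z'::'a. exp (f 0) * exp (L * norm z) * exp (L * norm z'))" using integrable_exp_norm[of L] by simp
  qed (use flim[of z] pb[of _ z] in \<open>auto simp: p_def\<close>)
  have Vlim: "(\<lambda>i. V (\<tau> i) (sqrt (\<tau> i) *\<^sub>R z)) \<longlonglongrightarrow> V 0 0" for z
    unfolding V_def p_def[symmetric]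
  proof (rule integral_dominated_convergence[where w="\<lambda>z'. exp (f 0) * exp (L * norm z) * exp (L * norm z') * L"])
    show "integrable std_gaussian (\<lambda>z'::'a. exp (f 0) * exp (L * norm z) * exp (L * norm z') * L)" using integrable_exp_norm[of L] by simp
    show "AE z' in std_gaussian. (\<lambda>i. exp (f (p i z z')) *\<^sub>R df (p i z z')) \<longlonglongrightarrow> exp (f (0 + sqrt (1 - 0) *\<^sub>R z')) *\<^sub>R df (0 + sqrt (1 - 0) *\<^sub>R z')"
      using tendsto_scaleR[OF flim dlim] by simp
    fix i
    show "AE z' in std_gaussian. norm (exp (f (p i z z')) *\<^sub>R df (p i z z')) \<le> exp (f 0) * exp (L * norm z) * exp (L * norm z') * L"
      using pb norm_df_le by (auto intro!: mult_mono)
  qed (auto simp: p_def)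
  have g00: "g 0 0 > 0" by (rule g_pos) auto
  have vlim: "(\<lambda>i. v (\<tau> i) (sqrt (\<tau> i) *\<^sub>R z)) \<longlonglongrightarrow> v 0 0" for z
    unfolding v_def using g00 by (intro tendsto_intros glim Vlim) auto
  have "(\<lambda>i. \<integral>z. g (\<tau> i) (sqrt (\<tau> i) *\<^sub>R z) * (norm (v (\<tau> i) (sqrt (\<tau> i) *\<^sub>R z)))\<^sup>2 \<partial>std_gaussian)
      \<longlonglongrightarrow> (\<integral>z. g 0 0 * (norm (v 0 0))\<^sup>2 \<partial>(std_gaussian :: 'a measure))"
  proof (rule integral_dominated_convergence[where w="\<lambda>z. exp (f 0) * exp (L * norm z) * (\<integral>z'. exp (L * norm (z'::'a)) \<partial>std_gaussian) * L\<^sup>2"])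
    show "integrable std_gaussian (\<lambda>z::'a. exp (f 0) * exp (L * norm z) * (\<integral>z'. exp (L * norm (z'::'a)) \<partial>std_gaussian) * L\<^sup>2)"
      using integrable_exp_norm[of L] by simp
    show "AE z in std_gaussian. (\<lambda>i. g (\<tau> i) (sqrt (\<tau> i) *\<^sub>R z) * (norm (v (\<tau> i) (sqrt (\<tau> i) *\<^sub>R z)))\<^sup>2) \<longlonglongrightarrow> g 0 0 * (norm (v 0 0))\<^sup>2"
      by (intro AE_I2 tendsto_intros glim vlim)
    fix i
    show "AE z in std_gaussian. norm (g (\<tau> i) (sqrt (\<tau> i) *\<^sub>R z) * (norm (v (\<tau> i) (sqrt (\<tau> i) *\<^sub>R z)))\<^sup>2)
       \<le> exp (f 0) * exp (L * norm z) * (\<integral>z'. exp (L * norm (z'::'a)) \<partial>std_gaussian) * L\<^sup>2"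
    proof (rule AE_I2)
      fix z :: 'a
      have "g (\<tau> i) (sqrt (\<tau> i) *\<^sub>R z) \<le> (\<integral>z'. exp (f 0) * exp (L * norm z) * exp (L * norm (z'::'a)) \<partial>std_gaussian)"
        unfolding g_def p_def[symmetric]
      proof (rule integral_mono)
        show "integrable std_gaussian (\<lambda>z'. exp (f (p i z z')))" unfolding p_def by (rule integrable_exp_f)
      qed (use pb integrable_exp_norm[of L] in auto)
      then have "g (\<tau> i) (sqrt (\<tau> i) *\<^sub>R z) \<le> exp (f 0) * exp (L * norm z) * (\<integral>z'. exp (L * norm (z'::'a)) \<partial>std_gaussian)" by simp
      then show "norm (g (\<tau> i) (sqrt (\<tau> i) *\<^sub>R z) * (norm (v (\<tau> i) (sqrt (\<tau> i) *\<^sub>R z)))\<^sup>2)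
       \<le> exp (f 0) * exp (L * norm z) * (\<integral>z'. exp (L * norm (z'::'a)) \<partial>std_gaussian) * L\<^sup>2"
        using g_nonneg norm_v_sq_le order_trans[OF g_nonneg] by (auto simp: abs_mult intro!: mult_mono)
    qed
  qed auto
  moreover have "m (\<tau> i) = (\<integral>z. g (\<tau> i) (sqrt (\<tau> i) *\<^sub>R z) * (norm (v (\<tau> i) (sqrt (\<tau> i) *\<^sub>R z)))\<^sup>2 \<partial>std_gaussian)" for i
    unfolding m_def by (rule integral_law) measurable
  moreover have "m 0 = (\<integral>z. g 0 0 * (norm (v 0 0))\<^sup>2 \<partial>(std_gaussian :: 'a measure))"
    unfolding m_def by (subst integral_law) auto
  ultimately show ?thesis unfolding \<tau>_def by simp
qed

end

section \<open>Reduction to a bounded gradient and conclusion\<close>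

text \<open>The directions in which $K$ is bounded form a set $S$ of full measure, and $S+S\subseteq S$;
  since $S$ meets $c-S$ for every $c$, it is everything.\<close>

lemma bounded_of_support_fun_integrable:
  fixes K :: "'a::euclidean_space set"
  assumes "support_fun_integrable K"
  obtains L where "\<And>t. t \<in> K \<Longrightarrow> norm t \<le> L"
proof -
  define S where "S = {y. bdd_above ((\<lambda>t. y \<bullet> t) ` K)}"
  have "AE y in lborel. y \<in> S"
    using assms unfolding support_fun_integrable_def AE_std_gaussian_iff S_def by simp
  then obtain N where N: "N \<in> null_sets lborel" "{y. y \<notin> S} \<subseteq> N"
    unfolding eventually_ae_filter by auto
  have [measurable]: "N \<in> sets borel" using N by auto
  have AE1: "AE y in lborel. y \<notin> N" using N(1) by (rule AE_not_in)
  have all: "c \<in> S" for c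
  proof -
    have eq: "distr lborel borel (\<lambda>y. c + (- 1) *\<^sub>R y) = lborel"
      by (subst (2) lborel_affine[of "- 1" c]) (simp_all add: density_1)
    have "AE y in distr lborel borel (\<lambda>y. c + (- 1) *\<^sub>R y). y \<notin> N" unfolding eq by (rule AE1)
    then have "AE y in lborel. c - y \<notin> N" by (subst (asm) AE_distr_iff) auto
    with AE1 have "AE y in lborel. y \<notin> N \<and> c - y \<notin> N" by eventually_elim simp
    \<comment> \<open>A probability measure has no null universe, so an almost sure property yields
      an actual point.\<close>
    then have ae: "AE y in (std_gaussian :: 'a measure). y \<notin> N \<and> c - y \<notin> N" unfolding AE_std_gaussian_iff .
    have "\<exists>y. y \<notin> N \<and> c - y \<notin> N"
    proof (rule ccontr)
      assume "\<nexists>y. y \<notin> N \<and> c - y \<notin> N"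
      then have "\<And>y. y \<notin> N \<and> c - y \<notin> N \<Longrightarrow> False" by blast
      from eventually_mono[OF ae this] have "AE y in (std_gaussian :: 'a measure). False" .
      then show False using std_gaussian.AE_False by simp
    qed
    then obtain y where "y \<in> S" "c - y \<in> S" using N(2) by blast
    then obtain a b where ab: "\<And>t. t \<in> K \<Longrightarrow> y \<bullet> t \<le> a" "\<And>t. t \<in> K \<Longrightarrow> (c - y) \<bullet> t \<le> b"
      unfolding S_def bdd_above_def by auto
    have "c \<bullet> t \<le> a + b" if "t \<in> K" for t
      using ab[OF that] by (simp add: inner_diff)
    then show "c \<in> S" unfolding S_def by (auto intro!: bdd_aboveI2)
  qed
  \<comment> \<open>Upper bounds in the finitely many directions \<open>b\<close> and
    \<open>- b\<close> already bound \<open>K\<close> in norm.\<close>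
  have "\<exists>u. \<forall>t\<in>K. c \<bullet> t \<le> u" for c
    using all[of c] unfolding S_def bdd_above_def by auto
  then obtain u where u: "\<And>c t. t \<in> K \<Longrightarrow> c \<bullet> t \<le> u c" by metis
  show thesis
  proof (rule that)
    fix t assume t: "t \<in> K"
    have "norm t \<le> (\<Sum>b\<in>Basis. \<bar>t \<bullet> b\<bar>)" by (rule norm_le_l1)
    also have "\<dots> \<le> (\<Sum>b\<in>Basis. \<bar>u b\<bar> + \<bar>u (- b)\<bar>)"
    proof (rule sum_mono)
      fix b :: 'a
      show "\<bar>t \<bullet> b\<bar> \<le> \<bar>u b\<bar> + \<bar>u (- b)\<bar>"
        using u[OF t, of b] u[OF t, of "- b"] by (simp add: inner_commute)
    qed
    finally show "norm t \<le> (\<Sum>b\<in>Basis. \<bar>u b\<bar> + \<bar>u (- b)\<bar>)" .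
  qed
qed

section \<open>Gradient, Laplacian and the final choice of time\<close>

lemma has_derivative_grad:
  fixes f :: "'a::euclidean_space \<Rightarrow> real"
  assumes "f differentiable (at x)"
  shows "(f has_derivative (\<lambda>h. grad f x \<bullet> h)) (at x)"
proof -
  obtain f' where f': "(f has_derivative f') (at x)" using assms by (auto simp: differentiable_def)
  interpret bounded_linear f' using f' by (rule has_derivative_bounded_linear)
  define D where "D = (\<Sum>b\<in>Basis. f' b *\<^sub>R b)"
  have "f' = (\<lambda>h. h \<bullet> D)"
  proof
    fix h
    have "f' h = f' (\<Sum>b\<in>Basis. (h \<bullet> b) *\<^sub>R b)" by (simp add: euclidean_representation)
    also have "\<dots> = h \<bullet> D" by (simp add: sum scaleR D_def inner_sum_right mult.commute)
    finally show "f' h = h \<bullet> D" .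
  qed
  then have D: "GDERIV f x :> D" unfolding gderiv_def using f' by simp
  have "grad f x = D" unfolding grad_def
  proof (rule the_equality)
    show "GDERIV f x :> D" by (rule D)
    fix D' assume "GDERIV f x :> D'"
    then have "(\<lambda>h. h \<bullet> D') = (\<lambda>h. h \<bullet> D)"
      using D unfolding gderiv_def by (rule has_derivative_unique)
    then show "D' = D" by (metis inner_commute vector_eq_rdot)
  qed
  then show ?thesis using D by (simp add: gderiv_def inner_commute)
qed

text \<open>Along a coordinate line the first derivative is \<open>grad f \<bullet> b\<close>
  everywhere, so the second one at 0 is the Frechet derivative of the gradient tested on
  \<open>b\<close>. This links the iterated \<open>deriv\<close> to a trace.\<close>

lemma laplacian_eq:
  fixes f :: "'a::euclidean_space \<Rightarrow> real"
  assumes f: "twice_differentiable f" and H: "(grad f has_derivative H) (at x)"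
  shows "laplacian f x = (\<Sum>b\<in>Basis. H b \<bullet> b)"
  unfolding laplacian_def
proof (rule sum.cong[OF refl])
  fix b :: 'a
  have line: "((\<lambda>s. x + s *\<^sub>R b) has_derivative (\<lambda>h. h *\<^sub>R b)) (at t)" for t
    by (auto intro!: derivative_eq_intros)
  have "((\<lambda>t. f (x + t *\<^sub>R b)) has_real_derivative grad f (x + t *\<^sub>R b) \<bullet> b) (at t)" for t
  proof -
    have "(f has_derivative (\<lambda>h. grad f (x + t *\<^sub>R b) \<bullet> h)) (at (x + t *\<^sub>R b))"
      using f by (intro has_derivative_grad) (simp add: twice_differentiable_def)
    from has_derivative_compose[OF line this]
    show ?thesis by (simp add: has_field_derivative_def mult.commute[of _ "grad f (x + t *\<^sub>R b) \<bullet> b"])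
  qed
  then have 1: "deriv (\<lambda>t. f (x + t *\<^sub>R b)) = (\<lambda>t. grad f (x + t *\<^sub>R b) \<bullet> b)"
    by (intro ext DERIV_imp_deriv)
  interpret bounded_linear H using H by (rule has_derivative_bounded_linear)
  have "(grad f has_derivative H) (at (x + 0 *\<^sub>R b))" using H by simp
  from has_derivative_inner_left[OF has_derivative_compose[OF line this], of b]
  have "((\<lambda>t. grad f (x + t *\<^sub>R b) \<bullet> b) has_real_derivative H b \<bullet> b) (at 0)"
    by (simp add: has_field_derivative_def scaleR mult.commute[of _ "H b \<bullet> b"])
  then show "(deriv ^^ 2) (\<lambda>t. f (x + t *\<^sub>R b)) 0 = H b \<bullet> b"
    by (simp add: numeral_2_eq_2 1 DERIV_imp_deriv)
qed

lemma one_minus_sqrt_le: "0 \<le> t \<Longrightarrow> t \<le> 1 \<Longrightarrow> 0 \<le> 1 - sqrt (1 - t) \<and> 1 - sqrt (1 - t) \<le> t"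
proof
  assume t: "0 \<le> t" "t \<le> (1::real)"
  have "(1 - t)\<^sup>2 \<le> (1 - t) * 1" unfolding power2_eq_square using t by (intro mult_left_mono) auto
  then have "1 - t \<le> sqrt (1 - t)" by (intro real_le_rsqrt) simp
  then show "1 - sqrt (1 - t) \<le> t" by simp
  show "0 \<le> 1 - sqrt (1 - t)" using t by simp
qed

theorem corollary2:
  fixes f :: "real ^ 'n \<Rightarrow> real"
    and \<gamma> \<nu> :: "(real ^ 'n) measure"
    and K :: "(real ^ 'n) set"
    and D M :: real
  assumes gamma: "\<gamma> = std_gaussian"
    and f: "twice_differentiable f"
    and nu: "\<nu> = density \<gamma> (\<lambda>x. ennreal (exp (f x)))" "prob_space \<nu>"
    and entropy_finite: "integrable \<nu> f"
    and fisher_finite: "integrable \<nu> (\<lambda>x. (norm (grad f x))\<^sup>2)"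
    and K: "K = {grad f x | x. x \<in> UNIV}"
    and width_integrable: "support_fun_integrable K"
    and D: "D = gaussian_width K"
    and M_finite: "bdd_below (range (laplacian f))"
    and M: "M = - (INF x. laplacian f x)"
  shows "\<exists>\<mu> :: (real ^ 'n) measure. prob_space \<mu> \<and> sets \<mu> = sets borel \<and>
    W2_squared \<nu> (\<gamma> \<star> \<mu>)
      \<le> ennreal (16 * real CARD('n) powr (1 / 3) * (M + D) powr (2 / 3))"
proof -
  have Kr: "K = range (grad f)" using K by auto
  obtain L where L: "\<And>t. t \<in> K \<Longrightarrow> norm t \<le> L"
    using bounded_of_support_fun_integrable[OF width_integrable] by blast
  interpret lipschitz_potential f "grad f" L
  proof
    fix x
    show "(f has_derivative (\<lambda>h. grad f x \<bullet> h)) (at x)"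
      using f by (intro has_derivative_grad) (simp add: twice_differentiable_def)
    show "continuous_on UNIV (grad f)"
      using f unfolding twice_differentiable_def
      by (intro continuous_at_imp_continuous_on) (auto intro: differentiable_imp_continuous_within)
    show "norm (grad f x) \<le> L" using L Kr by auto
  qed
  define H where "H x = frechet_derivative (grad f) (at x)" for x
  have H: "(grad f has_derivative H x) (at x)" for x
    using f unfolding H_def twice_differentiable_def frechet_derivative_works by blast
  have MH: "- M \<le> (\<Sum>b\<in>Basis. H x b \<bullet> b)" for x
    unfolding M laplacian_eq[OF f H, symmetric] using cINF_lower[OF M_finite, of x] by simp
  have one: "(\<integral>x. exp (f x) \<partial>std_gaussian) = 1"
  proof -
    interpret nu: prob_space \<nu> by fact
    have "ennreal (\<integral>x. exp (f x) \<partial>std_gaussian) = (\<integral>\<^sup>+x. ennreal (exp (f x)) \<partial>std_gaussian)"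
      using integrable_exp_f[of 0 1] by (subst nn_integral_eq_integral) auto
    also have "\<dots> = emeasure \<nu> (space \<nu>)" unfolding nu gamma by (simp add: emeasure_density)
    also have "\<dots> = 1" by (rule nu.emeasure_space_1)
    finally show ?thesis by simp
  qed
  interpret normalized_potential f "grad f" L by unfold_locales (rule one)
  have nu1: "\<nu> = law 1" unfolding nu gamma law_1 ..
  define n where "n = real CARD('n)"
  have n: "n \<ge> 1" "n = real DIM(real ^ 'n)" by (simp_all add: n_def Suc_le_eq)
  define c where "c = M + D"
  have gap: "t * (m 1 - m t) \<le> c" if "0 \<le> t" "t \<le> 1" for t
    using m_gap[OF H MH that] by (simp add: c_def D Kr)
  \<comment> \<open>At \<open>t = 1\<close> the left side of the gap vanishes. The sign is needed
    before fractional powers of \<open>c\<close> can be handled.\<close>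
  have c0: "c \<ge> 0" using gap[of 1] by simp
  have conv: "\<gamma> \<star> \<mu> = distr (std_gaussian \<Otimes>\<^sub>M \<mu>) borel (\<lambda>(x, y). x + y)" for \<mu> :: "(real ^ 'n) measure"
    by (simp add: convolution_def gamma)
  show ?thesis
  \<comment> \<open>If \<open>c >= n\<close>, then \<open>n^(1/3) * c^(2/3)\<close> is at least
    \<open>n\<close>, the cost of adding independent noise to \<open>\<nu>\<close> itself.\<close>
  proof (cases "c \<ge> n")
    case True
    have "n = n powr (1 / 3) * n powr (2 / 3)" using n by (simp add: powr_add[symmetric])
    also have "\<dots> \<le> n powr (1 / 3) * c powr (2 / 3)" using True n by (intro mult_left_mono powr_mono2) auto
    finally have "n \<le> 16 * n powr (1 / 3) * c powr (2 / 3)" using n by simp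
    moreover have "W2_squared \<nu> (\<gamma> \<star> \<nu>) \<le> ennreal n"
      unfolding conv n(2) by (rule W2_squared_convolution_le) (use nu gamma in auto)
    ultimately show ?thesis
      using nu by (intro exI[of _ \<nu>]) (auto simp: n_def c_def gamma intro: order_trans ennreal_leI)
  next
    case False
    \<comment> \<open>From \<open>c / t = n * t^2\<close>; both sides then equal \<open>X\<close>
      below. The case \<open>c = 0\<close> uses the start of the process, where
      \<open>mixing 0\<close> is a point mass.\<close>
    define t where "t = (if c = 0 then 0 else (c / n) powr (1 / 3))"
    have t: "0 \<le> t" "t < 1"
      using False c0 n powr_less_mono2[of "1 / 3" "c / n" 1] by (auto simp: t_def)
    have key: "2 * (1 - t)\<^sup>2 * (m 1 - m t) + 2 * (1 - sqrt (1 - t))\<^sup>2 * n \<le> 16 * n powr (1 / 3) * c powr (2 / 3)"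
    proof (cases "c = 0")
      case True
      \<comment> \<open>For \<open>c = 0\<close> the gap gives \<open>m 1 <= m t\<close> for each
        \<open>t > 0\<close>; the limit along \<open>1 / (i + 1)\<close> extends this to
        \<open>t = 0\<close>.\<close>
      have "m 1 \<le> m (1 / real (Suc i))" for i
        using gap[of "1 / real (Suc i)"] True by (simp add: mult_le_0_iff divide_le_0_iff)
      then have "m 1 \<le> m 0" by (intro LIMSEQ_le_const[OF m_tendsto_0]) auto
      then have "2 * (m 1 - m 0) \<le> 0" by simp
      then show ?thesis using True by (simp add: t_def)
    next
      case False
      then have cp: "c > 0" using c0 by simp
      have tp: "t > 0" "t = (c / n) powr (1 / 3)" using cp n by (auto simp: t_def)
      define X where "X = n powr (1 / 3) * c powr (2 / 3)"
      have "c / t = X"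
      proof -
        have "c / t = c powr 1 / (c powr (1 / 3) / n powr (1 / 3))" using cp n by (simp add: tp powr_divide)
        also have "\<dots> = n powr (1 / 3) * (c powr 1 / c powr (1 / 3))" by simp
        also have "c powr 1 / c powr (1 / 3) = c powr (2 / 3)" by (subst powr_diff[symmetric]) simp
        finally show ?thesis by (simp add: X_def)
      qed
      moreover have "m 1 - m t \<le> c / t" using gap[of t] t tp by (simp add: field_simps)
      ultimately have 1: "m 1 - m t \<le> X" by simp
      have "t\<^sup>2 * n = X"
      proof -
        have "t\<^sup>2 = (c / n) powr (2 / 3)" unfolding tp(2) by (simp add: power2_eq_square powr_add[symmetric])
        then have "t\<^sup>2 * n = c powr (2 / 3) * (n powr 1 / n powr (2 / 3))" using cp n by (simp add: powr_divide)
        also have "n powr 1 / n powr (2 / 3) = n powr (1 / 3)" by (subst powr_diff[symmetric]) simp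
        finally show ?thesis by (simp add: X_def)
      qed
      moreover have "(1 - sqrt (1 - t))\<^sup>2 * n \<le> t\<^sup>2 * n"
        using one_minus_sqrt_le[of t] t n by (intro mult_right_mono power_mono) auto
      ultimately have 2: "(1 - sqrt (1 - t))\<^sup>2 * n \<le> X" by simp
      have "m 1 - m t \<ge> 0" using m_mono[of t 1] t by simp
      moreover have "(1 - t)\<^sup>2 \<le> 1" using t by (simp add: power_le_one)
      ultimately have "(1 - t)\<^sup>2 * (m 1 - m t) \<le> m 1 - m t" by (rule mult_left_le_one_le[rotated 2, OF _ _ zero_le_power2, rotated]) 
      moreover have "X \<ge> 0" by (simp add: X_def)
      \<comment> \<open>Each of the two terms is at most \<open>2 * X\<close>, so the argument
        yields the constant 4.\<close>
      ultimately show ?thesis using 1 2 by (simp add: X_def[symmetric] mult.assoc)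
    qed
    have "W2_squared \<nu> (\<gamma> \<star> mixing t) \<le> ennreal (2 * (1 - t)\<^sup>2 * (m 1 - m t) + 2 * (1 - sqrt (1 - t))\<^sup>2 * n)"
      unfolding nu1 conv n(2) by (rule W2_law_le[OF t])
    also have "\<dots> \<le> ennreal (16 * n powr (1 / 3) * c powr (2 / 3))" using key by (rule ennreal_leI)
    finally show ?thesis
      using prob_space_mixing[of t] t by (intro exI[of _ "mixing t"]) (simp add: n_def c_def)
  qed
qed

end
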